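(* There exists $\beta_*=\beta_*(n,s)\in(0,1)$ such that the following holds. Let $\Omega\subseteq\mathbb{R}^n$ be a bounded open set with smooth boundary, $\varepsilon>0$, $g\in C^{0,1}_{\mathrm{loc}}(\mathbb{R}^n)\cap L^\infty(\mathbb{R}^n)$, $f\in L^\infty(\Omega)$, and let $v_\varepsilon\in H^s_g(\Omega)\cap L^p(\Omega)$ be a weak solution of $(-\Delta)^sv_\varepsilon+\varepsilon^{-2s}W'(v_\varepsilon)=f$ in $\Omega$. Then $v_\varepsilon\in C^{0,\beta_*}_{\mathrm{loc}}(\Omega)\cap C^0(\mathbb{R}^n)$.
   Context: $n\ge2$, $s\in(0,1/2)$. $W$ satisfies: $W\in C^2(\mathbb{R};[0,\infty))$; $\{W=0\}=\{\pm1\}$, $W''(\pm1)>0$; there exist $p\in(1,\infty)$ and $c_W>0$ with $c_W^{-1}(|t|^{p-1}-1)\le|W'(t)|\le c_W(|t|^{p-1}+1)$ ($p$ is this exponent). $\gamma_{n,s}:=s2^{2s}\pi^{-n/2}\Gamma(\frac{n+2s}{2})/\Gamma(1-s)$; $\mathcal{E}(v,\Omega):=\frac{\gamma_{n,s}}{4}\iint_{\Omega\times\Omega}\frac{|v(x)-v(y)|^2}{|x-y|^{n+2s}}+\frac{\gamma_{n,s}}{2}\iint_{\Omega\times\Omega^c}\frac{|v(x)-v(y)|^2}{|x-y|^{n+2s}}$; $\widehat H^s(\Omega)=\{v\in L^2_{\mathrm{loc}}:\mathcal{E}(v,\Omega)<\infty\}$; $H^s_{00}(\Omega)=\{v\in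 H^s(\mathbb{R}^n):v=0$ a.e. outside $\Omega\}$; $H^s_g(\Omega)=\{v\in\widehat H^s(\Omega):v=g$ a.e. outside $\Omega\}$. $\langle(-\Delta)^sv,\varphi\rangle_\Omega=\frac{\gamma_{n,s}}{2}\iint_{\Omega\times\Omega}\frac{(v(x)-v(y))(\varphi(x)-\varphi(y))}{|x-y|^{n+2s}}+\gamma_{n,s}\iint_{\Omega\times\Omega^c}\frac{(v(x)-v(y))(\varphi(x)-\varphi(y))}{|x-y|^{n+2s}}$. Weak solution: $\langle(-\Delta)^sv,\varphi\rangle_\Omega+\varepsilon^{-2s}\int_\Omega W'(v)\varphi=\int_\Omega f\varphi$ for all $\varphi\in H^s_{00}(\Omega)\cap L^p(\Omega)$. *)

theory Defs
  imports "HOL-Analysis.Analysis"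
begin

text \<open>Points of R^n are elements of a Euclidean space 'a with n = DIM('a).
  Functions are taken Borel measurable (Borel representatives of the
  Lebesgue classes); all notions below are invariant under a.e. changes.\<close>

definition gamma_ns :: "nat \<Rightarrow> real \<Rightarrow> real" where
  "gamma_ns n s = s * ((2::real) powr (2 * s)) * (pi powr (- (real n / 2)))
      * Gamma ((real n + 2 * s) / 2) / Gamma (1 - s)"

definition frac_kernel :: "real \<Rightarrow> 'a::euclidean_space \<Rightarrow> 'a \<Rightarrow> real" where
  "frac_kernel s x y = 1 / norm (x - y) powr (real DIM('a) + 2 * s)"

definition frac_energy :: "real \<Rightarrow> ('a::euclidean_space \<Rightarrow> real) \<Rightarrow> 'a set \<Rightarrow> ennreal" where
  "frac_energy s v \<Omega> =
     ennreal (gamma_ns DIM('a) s / 4) *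
       (\<integral>\<^sup>+ z. indicator (\<Omega> \<times> \<Omega>) z *
          ennreal ((v (fst z) - v (snd z))\<^sup>2 * frac_kernel s (fst z) (snd z)) \<partial>(lborel \<Otimes>\<^sub>M lborel))
   + ennreal (gamma_ns DIM('a) s / 2) *
       (\<integral>\<^sup>+ z. indicator (\<Omega> \<times> (- \<Omega>)) z *
          ennreal ((v (fst z) - v (snd z))\<^sup>2 * frac_kernel s (fst z) (snd z)) \<partial>(lborel \<Otimes>\<^sub>M lborel))"

definition L2_loc :: "('a::euclidean_space \<Rightarrow> real) \<Rightarrow> bool" where
  "L2_loc v \<longleftrightarrow> v \<in> borel_measurable lborel \<and>
     (\<forall>K. compact K \<longrightarrow> (\<integral>\<^sup>+ x\<in>K. ennreal ((v x)\<^sup>2) \<partial>lborel) < \<infinity>)"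

definition Hhat :: "real \<Rightarrow> 'a::euclidean_space set \<Rightarrow> ('a \<Rightarrow> real) set" where
  "Hhat s \<Omega> = {v. L2_loc v \<and> frac_energy s v \<Omega> < \<infinity>}"

definition Hs_full :: "real \<Rightarrow> ('a::euclidean_space \<Rightarrow> real) set" where
  "Hs_full s = {v. v \<in> borel_measurable lborel \<and>
       (\<integral>\<^sup>+ x. ennreal ((v x)\<^sup>2) \<partial>lborel) < \<infinity> \<and>
       (\<integral>\<^sup>+ z. ennreal ((v (fst z) - v (snd z))\<^sup>2 * frac_kernel s (fst z) (snd z))
          \<partial>(lborel \<Otimes>\<^sub>M lborel)) < \<infinity>}"

definition Hs00 :: "real \<Rightarrow> 'a::euclidean_space set \<Rightarrow> ('a \<Rightarrow> real) set" where
  "Hs00 s \<Omega> = {v. v \<in> Hs_full s \<and> (AE x in lborel. x \<notin> \<Omega> \<longrightarrow> v x = 0)}"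

definition Hs_g :: "real \<Rightarrow> 'a::euclidean_space set \<Rightarrow> ('a \<Rightarrow> real) \<Rightarrow> ('a \<Rightarrow> real) set" where
  "Hs_g s \<Omega> g = {v. v \<in> Hhat s \<Omega> \<and> (AE x in lborel. x \<notin> \<Omega> \<longrightarrow> v x = g x)}"

definition Lp_on :: "real \<Rightarrow> 'a::euclidean_space set \<Rightarrow> ('a \<Rightarrow> real) \<Rightarrow> bool" where
  "Lp_on p \<Omega> v \<longleftrightarrow> v \<in> borel_measurable lborel \<and>
      (\<integral>\<^sup>+ x\<in>\<Omega>. ennreal (\<bar>v x\<bar> powr p) \<partial>lborel) < \<infinity>"

definition frac_form :: "real \<Rightarrow> 'a::euclidean_space set \<Rightarrow> ('a \<Rightarrow> real) \<Rightarrow> ('a \<Rightarrow> real) \<Rightarrow> real" where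
  "frac_form s \<Omega> v \<phi> =
     gamma_ns DIM('a) s / 2 *
       (\<integral> z. indicator (\<Omega> \<times> \<Omega>) z * ((v (fst z) - v (snd z)) * (\<phi> (fst z) - \<phi> (snd z))
            * frac_kernel s (fst z) (snd z)) \<partial>(lborel \<Otimes>\<^sub>M lborel))
   + gamma_ns DIM('a) s *
       (\<integral> z. indicator (\<Omega> \<times> (- \<Omega>)) z * ((v (fst z) - v (snd z)) * (\<phi> (fst z) - \<phi> (snd z))
            * frac_kernel s (fst z) (snd z)) \<partial>(lborel \<Otimes>\<^sub>M lborel))"

definition weak_solution ::
  "real \<Rightarrow> real \<Rightarrow> (real \<Rightarrow> real) \<Rightarrow> real \<Rightarrow> 'a::euclidean_space set \<Rightarrow> ('a \<Rightarrow> real) \<Rightarrow> ('a \<Rightarrow> real) \<Rightarrow> bool" where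
  "weak_solution s p W \<epsilon> \<Omega> f v \<longleftrightarrow>
     (\<forall>\<phi>. \<phi> \<in> Hs00 s \<Omega> \<and> Lp_on p \<Omega> \<phi> \<longrightarrow>
        frac_form s \<Omega> v \<phi> + \<epsilon> powr (-2 * s) * (\<integral> x. indicator \<Omega> x * (deriv W (v x) * \<phi> x) \<partial>lborel)
        = (\<integral> x. indicator \<Omega> x * (f x * \<phi> x) \<partial>lborel))"

fun Ck_on :: "nat \<Rightarrow> 'a::euclidean_space set \<Rightarrow> ('a \<Rightarrow> real) \<Rightarrow> bool" where
  "Ck_on 0 U f = continuous_on U f"
| "Ck_on (Suc k) U f = (continuous_on U f \<and> f differentiable_on U \<and>
      (\<forall>i\<in>Basis. Ck_on k U (\<lambda>x. frechet_derivative f (at x) i)))"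

definition Cinf_on :: "'a::euclidean_space set \<Rightarrow> ('a \<Rightarrow> real) \<Rightarrow> bool" where
  "Cinf_on U f \<longleftrightarrow> (\<forall>k. Ck_on k U f)"

definition smooth_boundary :: "'a::euclidean_space set \<Rightarrow> bool" where
  "smooth_boundary \<Omega> \<longleftrightarrow>
     (\<forall>x\<in>frontier \<Omega>. \<exists>U \<psi>. open U \<and> x \<in> U \<and> Cinf_on U \<psi> \<and>
        (\<forall>y\<in>U. frechet_derivative \<psi> (at y) \<noteq> (\<lambda>_. 0)) \<and>
        \<Omega> \<inter> U = {y\<in>U. \<psi> y < 0})"

definition C2_real :: "(real \<Rightarrow> real) \<Rightarrow> bool" where
  "C2_real W \<longleftrightarrow> (\<forall>t. W differentiable (at t)) \<and> (\<forall>t. deriv W differentiable (at t))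
      \<and> continuous_on UNIV (deriv (deriv W))"

definition locally_lipschitz :: "('a::euclidean_space \<Rightarrow> real) \<Rightarrow> bool" where
  "locally_lipschitz g \<longleftrightarrow> (\<forall>K. compact K \<longrightarrow> (\<exists>L. L-lipschitz_on K g))"

definition Linf :: "('a::euclidean_space \<Rightarrow> real) \<Rightarrow> 'a set \<Rightarrow> bool" where
  "Linf f A \<longleftrightarrow> f \<in> borel_measurable lborel \<and> (\<exists>M. AE x in lborel. x \<in> A \<longrightarrow> \<bar>f x\<bar> \<le> M)"

definition holder_loc :: "real \<Rightarrow> 'a::euclidean_space set \<Rightarrow> ('a \<Rightarrow> real) \<Rightarrow> bool" where
  "holder_loc \<beta> \<Omega> w \<longleftrightarrow> continuous_on \<Omega> w \<and>
     (\<forall>K. compact K \<and> K \<subseteq> \<Omega> \<longrightarrow> (\<exists>C. \<forall>x\<in>K. \<forall>y\<in>K. \<bar>w x - w y\<bar> \<le> C * dist x y powr \<beta>))"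

end

theory Submission
  imports Defs
begin

text \<open>
  Testing with truncations of \<open>v\<close> gives a comparison principle. Since \<open>W'\<close> is coercive with the right
  sign outside \<open>[-1, 1]\<close>, comparison with constants bounds \<open>v\<close>; hence \<open>v\<close> solves a linear equation
  with bounded right hand side. As \<open>2s < 1\<close>, the fractional Laplacian of a bounded Lipschitz
  function is an absolutely convergent integral, so no principal values are needed.

  Interior: mollifications \<open>u\<close> of \<open>v\<close> satisfy the equation pointwise. At a maximum \<open>(x, y)\<close> of
  \<open>u x - u y - L|x - y|^s\<close> (localised), pairing \<open>x + z\<close> with \<open>y - z\<close> for \<open>z\<close> near \<open>-(x - y)/2\<close> yields a
  negative contribution of order \<open>L|x - y|^(-s)\<close>, which is impossible for large \<open>L\<close>. So the
  mollifications are equi-Hoelder with exponent \<open>s\<close>; they converge to \<open>v\<close> almost everywhere along a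
  dyadic sequence because the energy controls \<open>u - v\<close> in \<open>L^2\<close>.

  Boundary: for a compact convex \<open>K\<close> outside \<open>\<Omega>\<close> and small \<open>\<alpha>\<close>, the function \<open>dist(x, K)^\<alpha>\<close> is a strict
  supersolution, because for \<open>\<alpha> \<rightarrow> 0\<close> it tends to the indicator of the complement of \<open>K\<close>. Exterior
  cones at boundary points, truncated away from the vertex, serve as \<open>K\<close>.
\<close>

section \<open>Moments of the kernel\<close>

text \<open>The class of \<open>v\<close> is fixed only almost everywhere, so the doubled function
  need not attain a maximum; this forces mollification. Mollification does not commute with
  \<open>deriv W\<close>, which is why the bound on \<open>v\<close> comes first and the nonlinear
  term is then frozen in the right hand side \<open>F\<close>. With Hoelder exponent b the doubling
  gain is of order L|x - y|^(b - 2s), so exponents below 2s serve; b = s is a convenient choice and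
  becomes the witness for \<beta>. Two weights tame the kernel: min(|z|, 1) fits bounded Lipschitz
  functions, min(|z|, |z|^s) fits the growth of dist^\<alpha> with \<alpha> \<le> s. At the boundary
  a full exterior cone meets the closure of \<Omega> at its vertex, where dist^\<alpha> is not
  Lipschitz. Truncation restores a positive distance \<eta>; the decisive point is that \<alpha> and
  the lower bound for the fractional Laplacian depend neither on \<eta> nor on the truncation, so
  the truncation can be removed in the final estimate.\<close>

definition riesz :: "real \<Rightarrow> 'a::euclidean_space \<Rightarrow> real" where
  "riesz s z = 1 / norm z powr (real DIM('a) + 2 * s)"

lemma frac_kernel_riesz: "frac_kernel s x y = riesz s (x - y)"
  by (simp add: frac_kernel_def riesz_def)

lemma riesz_nonneg [simp]: "riesz s z \<ge> 0"
  by (simp add: riesz_def)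

lemma riesz_minus [simp]: "riesz s (- z) = riesz s z"
  by (simp add: riesz_def)

lemma riesz_measurable [measurable]: "riesz s \<in> borel_measurable borel"
  unfolding riesz_def by measurable

lemma dyadic_small:
  fixes r :: real assumes "0 < r" "r < 1"
  obtains j where "(1/2) ^ Suc j \<le> r" "r < (1/2) ^ j"
proof -
  obtain m where "(1/2) ^ m < r" using real_arch_pow_inv[of r "1/2"] assms by auto
  then have ex: "\<exists>j. (1/2) ^ Suc j \<le> r"
    by (intro exI[of _ m]) (simp add: power_le_imp_le_exp, smt (verit) zero_le_power divide_nonneg_nonneg)
  define j where "j = (LEAST j. (1/2) ^ Suc j \<le> r)"
  have 1: "(1/2) ^ Suc j \<le> r"
    unfolding j_def by (rule LeastI_ex) fact
  have 2: "r < (1/2) ^ j"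
  proof (cases j)
    case 0 then show ?thesis using assms by simp
  next
    case (Suc i)
    then have "\<not> (1/2) ^ Suc i \<le> r"
      using not_less_Least[of i "\<lambda>j. (1/2) ^ Suc j \<le> r"] j_def by simp
    then show ?thesis using Suc by simp
  qed
  show ?thesis using that 1 2 by blast
qed

lemma dyadic_large:
  fixes r :: real assumes "1 \<le> r"
  obtains j where "2 ^ j \<le> r" "r < 2 ^ Suc j"
proof -
  obtain m where "r < 2 ^ m" using real_arch_pow[of 2 r] by auto
  then have ex: "\<exists>j. r < 2 ^ Suc j" using assms
    by (intro exI[of _ m]) simp
  define j where "j = (LEAST j. r < 2 ^ Suc j)"
  have 1: "r < 2 ^ Suc j"
    unfolding j_def by (rule LeastI_ex) fact
  have 2: "2 ^ j \<le> r"
  proof (cases j)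
    case 0 then show ?thesis using assms by simp
  next
    case (Suc i)
    then have "\<not> r < 2 ^ Suc i"
      using not_less_Least[of i "\<lambda>j. r < 2 ^ Suc j"] j_def by simp
    then show ?thesis using Suc by simp
  qed
  show ?thesis using that 1 2 by blast
qed

lemma suminf_geometric_ennreal_finite:
  assumes "0 \<le> q" "q < (1::real)" "0 \<le> c" "\<And>j. f j \<le> ennreal (c * q ^ j)"
  shows "(\<Sum>j. f j) < (\<infinity>::ennreal)"
proof -
  have "(\<Sum>j. f j) \<le> (\<Sum>j. ennreal (c * q ^ j))"
    by (rule suminf_le) (use assms in auto)
  also have "\<dots> = ennreal (\<Sum>j. c * q ^ j)"
    by (rule suminf_ennreal2) (use assms in \<open>auto intro!: summable_mult summable_geometric\<close>)
  finally show ?thesis using order_le_less_trans by fastforce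
qed

text \<open>On dyadic shells the integrand is frozen at its largest value and the shell is enlarged
  to a ball. The inner shells contribute a geometric series of ratio 2^(2s-1), which is where s <
  1/2 enters; the outer ones have ratio 2^(-s), thanks to the weaker growth |z|^s of the
  weight.\<close>

lemma riesz_moment_unit:
  assumes s: "0 < s" "s < 1/2"
  shows "(\<integral>\<^sup>+ z. ennreal (min (norm z) (norm z powr s) * riesz s (z::'a::euclidean_space)) \<partial>lborel) < \<infinity>"
proof -
  define N where "N = real DIM('a)"
  have N: "N \<ge> 1" unfolding N_def using DIM_positive[where 'a='a] by linarith
  define e where "e = N + 2 * s"
  define a where "a j = (1/2) ^ j * (1 / ((1/2) ^ Suc j) powr e)" for j :: nat
  define b where "b j = (2 ^ Suc j) powr s * (1 / (2 ^ j) powr e)" for j :: nat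
  define U where "U = unit_ball_vol N"
  have U: "U \<ge> 0" unfolding U_def using N by simp
  define A where "A j z = ennreal (a j) * indicator (ball (0::'a) ((1/2) ^ j)) z" for j z
  define B where "B j z = ennreal (b j) * indicator (ball (0::'a) (2 ^ Suc j)) z" for j z
  have [measurable]: "A j \<in> borel_measurable lborel" "B j \<in> borel_measurable lborel" for j
    unfolding A_def B_def by (auto intro!: borel_measurable_times_ennreal borel_measurable_indicator)
  \<comment> \<open>Each z \<noteq> 0 lies in one shell, and the single matching term of the series
    already dominates.\<close>
  have pw: "ennreal (min (norm z) (norm z powr s) * riesz s z) \<le> (\<Sum>j. A j z) + (\<Sum>j. B j z)" for z :: 'a
  proof (cases "z = 0")
    case True then show ?thesis by (simp add: riesz_def)
  next
    case nz: False
    show ?thesis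
    proof (cases "norm z < 1")
      case True
      obtain j where j: "(1/2) ^ Suc j \<le> norm z" "norm z < (1/2) ^ j"
        using dyadic_small[of "norm z"] True nz by auto
      have "min (norm z) (norm z powr s) * riesz s z \<le> (1/2) ^ j * (1 / ((1/2) ^ Suc j) powr e)"
        unfolding riesz_def e_def N_def
      proof (intro mult_mono divide_left_mono powr_mono2)
        show "min (norm z) (norm z powr s) \<le> (1/2) ^ j" using j by linarith
      qed (use j s nz in \<open>auto\<close>)
      then have "ennreal (min (norm z) (norm z powr s) * riesz s z) \<le> A j z"
        unfolding A_def a_def using j by (simp add: indicator_def ennreal_leI)
      also have "\<dots> \<le> (\<Sum>j. A j z)"
        using sum_le_suminf[of "\<lambda>j. A j z" "{j}"] by simp
      finally show ?thesis by (simp add: add_increasing2)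
    next
      case False
      obtain j where j: "2 ^ j \<le> norm z" "norm z < 2 ^ Suc j"
        using dyadic_large[of "norm z"] False by auto
      have "norm z powr s \<le> (2 ^ Suc j) powr s" using j s by (intro powr_mono2) auto
      then have "min (norm z) (norm z powr s) * riesz s z \<le> (2 ^ Suc j) powr s * (1 / (2 ^ j) powr e)"
        unfolding riesz_def e_def N_def
      proof (intro mult_mono divide_left_mono powr_mono2)
        show "min (norm z) (norm z powr s) \<le> (2 ^ Suc j) powr s" 
          using \<open>norm z powr s \<le> (2 ^ Suc j) powr s\<close> by linarith
      qed (use j s nz in \<open>auto\<close>)
      then have "ennreal (min (norm z) (norm z powr s) * riesz s z) \<le> B j z"
        unfolding B_def b_def using j by (simp add: indicator_def ennreal_leI)
      also have "\<dots> \<le> (\<Sum>j. B j z)"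
        using sum_le_suminf[of "\<lambda>j. B j z" "{j}"] by simp
      finally show ?thesis by (simp add: add_increasing)
    qed
  qed
  have vol: "emeasure lborel (ball (0::'a) r) = ennreal (U * r powr N)" if "r > 0" for r
    using that by (simp add: emeasure_ball U_def N_def powr_realpow)
  have IA: "(\<integral>\<^sup>+ z. A j z \<partial>lborel) = ennreal (U * 2 powr e * (2 powr (2 * s - 1)) ^ j)" for j
  proof -
    have "(\<integral>\<^sup>+ z. A j z \<partial>lborel) = ennreal (a j) * ennreal (U * ((1/2) ^ j) powr N)"
      unfolding A_def by (subst nn_integral_cmult_indicator) (simp_all add: vol)
    also have "\<dots> = ennreal (a j * (U * ((1/2) ^ j) powr N))"
      by (rule ennreal_mult[symmetric]) (use U in \<open>auto simp: a_def\<close>)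
    also have "a j * (U * ((1/2) ^ j) powr N) = U * 2 powr e * (2 powr (2 * s - 1)) ^ j"
    proof -
      have h: "((1/2) ^ j :: real) = 2 powr (- real j)" for j
        by (simp add: powr_minus powr_realpow power_one_over inverse_eq_divide)
      have "a j * (U * ((1/2) ^ j) powr N) = U * 2 powr (- real j + real (Suc j) * e - real j * N)"
        unfolding a_def h powr_powr by (simp add: powr_add powr_diff powr_minus field_simps)
      also have "- real j + real (Suc j) * e - real j * N = e + (2 * s - 1) * real j"
        by (simp add: e_def algebra_simps)
      finally show ?thesis by (simp only: powr_add powr_power) (simp add: mult_ac)
    qed
    finally show ?thesis .
  qed
  have IB: "(\<integral>\<^sup>+ z. B j z \<partial>lborel) = ennreal (U * 2 powr (N + s) * (2 powr (- s)) ^ j)" for j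
  proof -
    have "(\<integral>\<^sup>+ z. B j z \<partial>lborel) = ennreal (b j) * ennreal (U * (2 ^ Suc j) powr N)"
      unfolding B_def by (subst nn_integral_cmult_indicator) (simp_all add: vol del: power_Suc)
    also have "\<dots> = ennreal (b j * (U * (2 ^ Suc j) powr N))"
      by (rule ennreal_mult[symmetric]) (use U in \<open>auto simp: b_def\<close>)
    also have "b j * (U * (2 ^ Suc j) powr N) = U * 2 powr (N + s) * (2 powr (- s)) ^ j"
    proof -
      have h: "(2 ^ j :: real) = 2 powr (real j)" for j
        by (simp add: powr_realpow)
      have "b j * (U * (2 ^ Suc j) powr N) = U * 2 powr (real (Suc j) * s - real j * e + real (Suc j) * N)"
        unfolding b_def h powr_powr by (simp add: powr_add powr_diff field_simps)
      also have "real (Suc j) * s - real j * e + real (Suc j) * N = (N + s) + (- s) * real j"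
        by (simp add: e_def algebra_simps)
      finally show ?thesis by (simp only: powr_add powr_power) (simp add: mult_ac)
    qed
    finally show ?thesis .
  qed
  have "(\<integral>\<^sup>+ z. ennreal (min (norm z) (norm z powr s) * riesz s (z::'a)) \<partial>lborel)
      \<le> (\<integral>\<^sup>+ z. (\<Sum>j. A j z) + (\<Sum>j. B j z) \<partial>lborel)"
    by (rule nn_integral_mono) (rule pw)
  also have "\<dots> = (\<Sum>j. \<integral>\<^sup>+ z. A j z \<partial>lborel) + (\<Sum>j. \<integral>\<^sup>+ z. B j z \<partial>lborel)"
    by (simp add: nn_integral_add nn_integral_suminf)
  also have "\<dots> < \<infinity>"
  proof -
    have 1: "(\<Sum>j. \<integral>\<^sup>+ z. A j z \<partial>lborel) < \<infinity>"
      by (rule suminf_geometric_ennreal_finite[of "2 powr (2 * s-1)" "U * 2 powr e"])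
         (use s U in \<open>auto simp: IA intro: powr_less_one\<close>)
    have 2: "(\<Sum>j. \<integral>\<^sup>+ z. B j z \<partial>lborel) < \<infinity>"
      by (rule suminf_geometric_ennreal_finite[of "2 powr (-s)" "U * 2 powr (N+s)"])
         (use s U in \<open>auto simp: IB intro: powr_less_one\<close>)
    show ?thesis using 1 2 by simp
  qed
  finally show ?thesis .
qed

lemma nn_integral_scale:
  fixes f :: "'a::euclidean_space \<Rightarrow> ennreal"
  assumes [measurable]: "f \<in> borel_measurable borel" and D: "D > 0"
  shows "(\<integral>\<^sup>+ z. f z \<partial>lborel) = ennreal (D ^ DIM('a)) * (\<integral>\<^sup>+ z. f (D *\<^sub>R z) \<partial>lborel)"
proof -
  have "(\<integral>\<^sup>+ z. f z \<partial>lborel) = (\<integral>\<^sup>+ z. f z \<partial>density (distr lborel borel (\<lambda>x. 0 + D *\<^sub>R x)) (\<lambda>_. \<bar>D\<bar>^DIM('a)))"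
    using lborel_affine[of D "0::'a"] D by simp
  also have "\<dots> = ennreal (D ^ DIM('a)) * (\<integral>\<^sup>+ z. f (D *\<^sub>R z) \<partial>lborel)"
    using D by (simp add: nn_integral_density nn_integral_distr nn_integral_cmult)
  finally show ?thesis .
qed

text \<open>Homogeneity of the kernel: substituting z = D w produces D^n from the volume and
  D^(-n-2s) from \<open>riesz\<close>. In the barrier estimate D is the distance to the obstacle, so
  gain and loss both scale like D^(-2s).\<close>

lemma riesz_moment:
  assumes s: "0 < s" "s < 1/2"
  obtains C where "C > 0" "\<And>D. D > 0 \<Longrightarrow>
    (\<integral>\<^sup>+ z. ennreal (min (norm z / D) ((norm z / D) powr s) * riesz s (z::'a::euclidean_space)) \<partial>lborel)
      \<le> ennreal (C * D powr (- 2 * s))"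
proof -
  define I where "I = (\<integral>\<^sup>+ z. ennreal (min (norm z) (norm z powr s) * riesz s (z::'a)) \<partial>lborel)"
  define C where "C = enn2real I + 1"
  have IC: "I \<le> ennreal C"
    using riesz_moment_unit[OF s, where 'a='a] unfolding C_def I_def[symmetric]
    by (cases I) (auto intro: ennreal_leI)
  have "(\<integral>\<^sup>+ z. ennreal (min (norm z / D) ((norm z / D) powr s) * riesz s (z::'a)) \<partial>lborel)
      \<le> ennreal (C * D powr (- 2 * s))" if D: "D > 0" for D
  proof -
    have D1: "D ^ DIM('a) = D powr real DIM('a)" using D by (simp add: powr_realpow)
    have "(\<integral>\<^sup>+ z. ennreal (min (norm z / D) ((norm z / D) powr s) * riesz s (z::'a)) \<partial>lborel)
       = ennreal (D ^ DIM('a)) * (\<integral>\<^sup>+ z. ennreal (min (norm z) ((norm z) powr s) * (D powr (- (real DIM('a) + 2 * s)) * riesz s (z::'a))) \<partial>lborel)"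
      by (subst nn_integral_scale[OF _ D])
         (use D in \<open>simp_all add: riesz_def powr_mult powr_minus_divide del: minus_add_distrib\<close>)
    also have "\<dots> = ennreal (D ^ DIM('a)) * (ennreal (D powr (- (real DIM('a) + 2 * s))) * I)"
      unfolding I_def by (subst nn_integral_cmult[symmetric]) (simp_all add: ennreal_mult' algebra_simps)
    also have "\<dots> = ennreal (D powr (- 2 * s)) * I"
      unfolding D1 by (simp add: mult.assoc[symmetric] ennreal_mult[symmetric] flip: powr_add)
    also have "\<dots> \<le> ennreal (D powr (- 2 * s)) * ennreal C"
      by (intro mult_left_mono IC) simp
    also have "\<dots> = ennreal (C * D powr (- 2 * s))"
      by (subst ennreal_mult[symmetric]) (auto simp: C_def mult.commute)
    finally show ?thesis .
  qed
  moreover have "C > 0" unfolding C_def by (simp add: add_nonneg_pos)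
  ultimately show ?thesis using that by blast
qed

lemma min1_le_min_powr:
  assumes "0 \<le> t" "0 < s" "s \<le> (1::real)" shows "min t 1 \<le> min t (t powr s)"
proof (cases "t \<le> 1")
  case True
  then have "t powr 1 \<le> t powr s" if "t > 0" using assms that powr_mono'[of s 1 t] by simp
  then show ?thesis using assms True by (cases "t = 0") auto
next
  case False
  then show ?thesis using assms by (simp add: ge_one_powr_ge_zero)
qed

lemma riesz_min1_integrable:
  assumes s: "0 < s" "s < 1/2"
  shows "integrable lborel (\<lambda>z::'a::euclidean_space. min (norm z) 1 * riesz s z)"
proof (rule integrableI_nonneg)
  show "(\<integral>\<^sup>+ z. ennreal (min (norm z) 1 * riesz s (z::'a)) \<partial>lborel) < \<infinity>"
    by (rule le_less_trans[OF _ riesz_moment_unit[OF s, where 'a='a]])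
       (intro nn_integral_mono ennreal_leI mult_right_mono min1_le_min_powr, use s in auto)
qed auto

section \<open>The quadratic form on the whole space\<close>

lemma lborel_distr_reflect: "distr lborel borel (\<lambda>y. x - y) = (lborel :: 'a::euclidean_space measure)"
proof -
  have "(lborel :: 'a measure) = density (distr lborel borel (\<lambda>y. x + (-1) *\<^sub>R y)) (\<lambda>_. \<bar>-1::real\<bar>^DIM('a))"
    by (rule lborel_affine) simp
  then show ?thesis by (simp add: density_1)
qed

lemma nn_integral_reflect:
  fixes x :: "'a::euclidean_space"
  assumes [measurable]: "f \<in> borel_measurable borel"
  shows "(\<integral>\<^sup>+ y. f (x - y) \<partial>lborel) = (\<integral>\<^sup>+ y. f y \<partial>lborel)"
  by (subst (2) lborel_distr_reflect[of x, symmetric]) (simp add: nn_integral_distr)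

lemma nn_integral_shift:
  fixes x :: "'a::euclidean_space"
  assumes [measurable]: "f \<in> borel_measurable borel"
  shows "(\<integral>\<^sup>+ y. f (x + y) \<partial>lborel) = (\<integral>\<^sup>+ y. f y \<partial>lborel)"
  by (subst (2) lborel_distr_plus[of x, symmetric]) (simp add: nn_integral_distr)

lemma integral_reflect:
  fixes x :: "'a::euclidean_space" and f :: "'a \<Rightarrow> real"
  assumes [measurable]: "f \<in> borel_measurable borel"
  shows "(\<integral> y. f (x - y) \<partial>lborel) = (\<integral> y. f y \<partial>lborel)"
  by (subst (2) lborel_distr_reflect[of x, symmetric]) (simp add: integral_distr)

lemma integral_shift:
  fixes x :: "'a::euclidean_space" and f :: "'a \<Rightarrow> real"
  assumes [measurable]: "f \<in> borel_measurable borel"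
  shows "(\<integral> y. f (x + y) \<partial>lborel) = (\<integral> y. f y \<partial>lborel)"
  by (subst (2) lborel_distr_plus[of x, symmetric]) (simp add: integral_distr)

lemma integrable_reflect:
  fixes x :: "'a::euclidean_space" and f :: "'a \<Rightarrow> real"
  assumes [measurable]: "f \<in> borel_measurable borel"
  shows "integrable lborel (\<lambda>y. f (x - y)) \<longleftrightarrow> integrable lborel f"
  by (subst (2) lborel_distr_reflect[of x, symmetric]) (simp add: integrable_distr_eq)

lemma integrable_shift:
  fixes x :: "'a::euclidean_space" and f :: "'a \<Rightarrow> real"
  assumes [measurable]: "f \<in> borel_measurable borel"
  shows "integrable lborel (\<lambda>y. f (x + y)) \<longleftrightarrow> integrable lborel f"
  by (subst (2) lborel_distr_plus[of x, symmetric]) (simp add: integrable_distr_eq)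

text \<open>The exceptional set is enlarged to a Borel null set, since measurability of
  \<open>P\<close> is not assumed and Fubini needs a measurable set in the product.\<close>

lemma AE_lborel_pair:
  fixes P :: "'a::euclidean_space \<Rightarrow> bool"
  assumes "AE x in lborel. P x"
  shows "AE z in lborel \<Otimes>\<^sub>M lborel. P (fst z) \<and> P (snd z)"
proof -
  obtain N where N: "{x \<in> space lborel. \<not> P x} \<subseteq> N" "N \<in> null_sets lborel"
    using assms by (elim AE_E) (auto simp: null_sets_def)
  have [measurable]: "N \<in> sets borel" using N by auto
  have ae: "AE x in lborel. x \<notin> N" using N AE_not_in by blast
  have "AE z in lborel \<Otimes>\<^sub>M lborel. fst z \<notin> N \<and> snd z \<notin> N"
  proof (rule lborel_pair.AE_pair_measure)
    show "{z \<in> space (lborel \<Otimes>\<^sub>M lborel). fst z \<notin> N \<and> snd z \<notin> N} \<in> sets (lborel \<Otimes>\<^sub>M lborel)"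
      by measurable
    show "AE x in lborel. AE y in lborel. fst (x, y) \<notin> N \<and> snd (x, y) \<notin> N"
      using ae by (auto elim!: eventually_mono)
  qed
  then show ?thesis by (rule eventually_mono) (use N in auto)
qed

lemma nn_integral_pair_swap:
  fixes f :: "'a::euclidean_space \<times> 'a \<Rightarrow> ennreal"
  assumes [measurable]: "f \<in> borel_measurable (lborel \<Otimes>\<^sub>M lborel)"
  shows "(\<integral>\<^sup>+ z. f (snd z, fst z) \<partial>(lborel \<Otimes>\<^sub>M lborel)) = (\<integral>\<^sup>+ z. f z \<partial>(lborel \<Otimes>\<^sub>M lborel))"
  by (subst (2) lborel_pair.distr_pair_swap) (simp add: nn_integral_distr case_prod_beta)

lemma integral_pair_swap:
  fixes f :: "'a::euclidean_space \<times> 'a \<Rightarrow> real"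
  assumes [measurable]: "f \<in> borel_measurable (lborel \<Otimes>\<^sub>M lborel)"
  shows "(\<integral> z. f (snd z, fst z) \<partial>(lborel \<Otimes>\<^sub>M lborel)) = (\<integral> z. f z \<partial>(lborel \<Otimes>\<^sub>M lborel))"
  by (subst (2) lborel_pair.distr_pair_swap) (simp add: integral_distr case_prod_beta)

lemma integrable_pair_swap:
  fixes f :: "'a::euclidean_space \<times> 'a \<Rightarrow> real"
  assumes "integrable (lborel \<Otimes>\<^sub>M lborel) f"
  shows "integrable (lborel \<Otimes>\<^sub>M lborel) (\<lambda>z. f (snd z, fst z))"
  using lborel_pair.integrable_product_swap[OF assms] by (simp add: case_prod_beta')

section \<open>The bilinear form, its integrability and its strong form\<close>

definition gform :: "real \<Rightarrow> ('a::euclidean_space \<Rightarrow> real) \<Rightarrow> ('a \<Rightarrow> real) \<Rightarrow> 'a \<times> 'a \<Rightarrow> real" where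
  "gform s v \<phi> z = (v (fst z) - v (snd z)) * (\<phi> (fst z) - \<phi> (snd z)) * riesz s (fst z - snd z)"

text \<open>Finite as soon as \<open>frac_energy\<close> is, whose two weights are dropped here. The
  cylinder and its mirror image cover all pairs except those with both points outside \<Omega>, and
  there a function vanishing off \<Omega> has no differences.\<close>

definition cyl_energy :: "real \<Rightarrow> 'a::euclidean_space set \<Rightarrow> ('a \<Rightarrow> real) \<Rightarrow> ennreal" where
  "cyl_energy s \<Omega> v = (\<integral>\<^sup>+ z. indicator (\<Omega> \<times> UNIV) z * ennreal (gform s v v z) \<partial>(lborel \<Otimes>\<^sub>M lborel))"

lemma gform_measurable [measurable]:
  assumes [measurable]: "v \<in> borel_measurable borel" "\<phi> \<in> borel_measurable borel"
  shows "gform s v \<phi> \<in> borel_measurable (lborel \<Otimes>\<^sub>M lborel)"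
  unfolding gform_def[abs_def] by measurable

lemma gform_self: "gform s v v z = (v (fst z) - v (snd z))\<^sup>2 * frac_kernel s (fst z) (snd z)"
  by (simp add: gform_def frac_kernel_riesz power2_eq_square)

lemma gform_swap: "gform s v \<phi> (snd z, fst z) = gform s v \<phi> z"
  by (simp add: gform_def algebra_simps) (metis minus_diff_eq riesz_minus)

lemma gform_self_nonneg [simp]: "gform s v v z \<ge> 0"
  by (simp add: gform_def)

lemma gform_abs_le: "\<bar>gform s v \<phi> z\<bar> \<le> gform s v v z + gform s \<phi> \<phi> z"
proof -
  have "\<bar>a * b\<bar> \<le> a * a + b * b" for a b :: real
    using sum_squares_bound[of "\<bar>a\<bar>" "\<bar>b\<bar>"] abs_ge_zero[of "a * b"]
    unfolding abs_mult power2_eq_square abs_mult_self_eq by linarith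
  then show ?thesis
    by (auto simp: gform_def abs_mult distrib_right[symmetric] intro!: mult_right_mono)
qed

lemma gamma_ns_pos: "0 < s \<Longrightarrow> s < 1/2 \<Longrightarrow> gamma_ns n s > 0"
  unfolding gamma_ns_def by (intro divide_pos_pos mult_pos_pos Gamma_real_pos) auto

lemma cyl_energy_finite:
  fixes v :: "'a::euclidean_space \<Rightarrow> real"
  assumes s: "0 < s" "s < 1/2" and [measurable]: "v \<in> borel_measurable borel" "\<Omega> \<in> sets borel"
    and fin: "frac_energy s v \<Omega> < \<infinity>"
  shows "cyl_energy s \<Omega> v < \<infinity>"
proof -
  let ?P = "lborel \<Otimes>\<^sub>M lborel :: ('a \<times> 'a) measure"
  define A where "A = (\<integral>\<^sup>+ z. indicator (\<Omega> \<times> \<Omega>) z * ennreal (gform s v v z) \<partial>?P)"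
  define B where "B = (\<integral>\<^sup>+ z. indicator (\<Omega> \<times> -\<Omega>) z * ennreal (gform s v v z) \<partial>?P)"
  have g: "gamma_ns DIM('a) s > 0" using gamma_ns_pos s by blast
  have "ennreal (gamma_ns DIM('a) s / 4) * A + ennreal (gamma_ns DIM('a) s / 2) * B < \<infinity>"
    using fin unfolding frac_energy_def A_def B_def gform_self by simp
  then have "A < \<infinity>" "B < \<infinity>"
    using g by (auto simp: ennreal_mult_less_top)
  moreover have "cyl_energy s \<Omega> v = A + B"
    unfolding cyl_energy_def A_def B_def
    by (subst nn_integral_add[symmetric]) (auto intro!: nn_integral_cong simp: indicator_def)
  ultimately show ?thesis by simp
qed

text \<open>The energy of \<open>v\<close> over pairs outside \<Omega> may be infinite, but
  \<open>\<phi>\<close> kills those pairs. On all others the product is dominated by the two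
  energies, using the cylinder for \<open>v\<close> once directly and once with the variables
  exchanged.\<close>

lemma gform_integrable:
  fixes v :: "'a::euclidean_space \<Rightarrow> real"
  assumes v[measurable]: "v \<in> borel_measurable borel" and O[measurable]: "\<Omega> \<in> sets borel"
    and fin: "cyl_energy s \<Omega> v < \<infinity>"
    and phi: "\<phi> \<in> Hs_full s" and z: "\<And>x. x \<notin> \<Omega> \<Longrightarrow> \<phi> x = 0"
  shows "integrable (lborel \<Otimes>\<^sub>M lborel) (gform s v \<phi>)"
proof (rule integrableI_bounded)
  let ?P = "lborel \<Otimes>\<^sub>M lborel :: ('a \<times> 'a) measure"
  have [measurable]: "\<phi> \<in> borel_measurable borel" using phi by (simp add: Hs_full_def)
  show "gform s v \<phi> \<in> borel_measurable ?P" by measurable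
  let ?c = "\<lambda>z. indicator (\<Omega> \<times> UNIV) z * ennreal (gform s v v z)"
  have "ennreal (norm (gform s v \<phi> z)) \<le> ?c z + ?c (snd z, fst z) + ennreal (gform s \<phi> \<phi> z)" for z
  proof (cases "fst z \<in> \<Omega> \<or> snd z \<in> \<Omega>")
    case True
    have "ennreal (norm (gform s v \<phi> z)) \<le> ennreal (gform s v v z) + ennreal (gform s \<phi> \<phi> z)"
      using gform_abs_le[of s v \<phi> z] by (simp flip: ennreal_plus)
    also have "\<dots> \<le> ?c z + ?c (snd z, fst z) + ennreal (gform s \<phi> \<phi> z)"
      using True by (intro add_right_mono) (auto simp: indicator_def gform_swap mem_Times_iff)
    finally show ?thesis .
  next
    case False
    then have "gform s v \<phi> z = 0" using z by (simp add: gform_def)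
    then show ?thesis by simp
  qed
  then have "(\<integral>\<^sup>+ z. ennreal (norm (gform s v \<phi> z)) \<partial>?P)
     \<le> (\<integral>\<^sup>+ z. ?c z + ?c (snd z, fst z) + ennreal (gform s \<phi> \<phi> z) \<partial>?P)"
    by (rule nn_integral_mono)
  also have "\<dots> = (\<integral>\<^sup>+ z. ?c z \<partial>?P) + (\<integral>\<^sup>+ z. ?c (snd z, fst z) \<partial>?P) + (\<integral>\<^sup>+ z. ennreal (gform s \<phi> \<phi> z) \<partial>?P)"
    by (subst nn_integral_add; simp?)+
  also have "(\<integral>\<^sup>+ z. ?c (snd z, fst z) \<partial>?P) = (\<integral>\<^sup>+ z. ?c z \<partial>?P)"
    by (rule nn_integral_pair_swap) simp
  also have "(\<integral>\<^sup>+ z. ?c z \<partial>?P) + (\<integral>\<^sup>+ z. ?c z \<partial>?P) + (\<integral>\<^sup>+ z. ennreal (gform s \<phi> \<phi> z) \<partial>?P) < \<infinity>"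
    using fin phi by (simp add: cyl_energy_def Hs_full_def gform_self)
  finally show "(\<integral>\<^sup>+ z. ennreal (norm (gform s v \<phi> z)) \<partial>?P) < \<infinity>" .
qed

text \<open>The mixed region occurs twice in the whole-space integral, by symmetry, but once in
  \<open>frac_form\<close>; this explains the weights 1/2 and 1 there and the single factor 1/2
  here.\<close>

lemma frac_form_whole:
  fixes v :: "'a::euclidean_space \<Rightarrow> real"
  assumes int: "integrable (lborel \<Otimes>\<^sub>M lborel) (gform s v \<phi>)" and O[measurable]: "\<Omega> \<in> sets borel"
    and z: "\<And>x. x \<notin> \<Omega> \<Longrightarrow> \<phi> x = 0"
  shows "frac_form s \<Omega> v \<phi> = gamma_ns DIM('a) s / 2 * (\<integral> z. gform s v \<phi> z \<partial>(lborel \<Otimes>\<^sub>M lborel))"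
proof -
  let ?P = "lborel \<Otimes>\<^sub>M lborel :: ('a \<times> 'a) measure"
  have [measurable]: "gform s v \<phi> \<in> borel_measurable ?P" using int by simp
  let ?i = "\<lambda>A B z. indicator (A \<times> B) z * gform s v \<phi> z"
  have I: "integrable ?P (?i A B)" if [measurable]: "A \<in> sets borel" "B \<in> sets borel" for A B
    by (rule Bochner_Integration.integrable_bound[OF int]) (auto simp: indicator_def)
  have "(\<integral> z. gform s v \<phi> z \<partial>?P) = (\<integral> z. ?i \<Omega> \<Omega> z + ?i \<Omega> (-\<Omega>) z + ?i (-\<Omega>) \<Omega> z \<partial>?P)"
  proof (intro Bochner_Integration.integral_cong refl)
    fix z :: "'a \<times> 'a"
    show "gform s v \<phi> z = ?i \<Omega> \<Omega> z + ?i \<Omega> (-\<Omega>) z + ?i (-\<Omega>) \<Omega> z"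
      using z[of "fst z"] z[of "snd z"]
      by (cases "fst z \<in> \<Omega>"; cases "snd z \<in> \<Omega>") (simp_all add: indicator_def mem_Times_iff gform_def)
  qed
  also have "\<dots> = (\<integral> z. ?i \<Omega> \<Omega> z \<partial>?P) + (\<integral> z. ?i \<Omega> (-\<Omega>) z \<partial>?P) + (\<integral> z. ?i (-\<Omega>) \<Omega> z \<partial>?P)"
    using I[of \<Omega> \<Omega>] I[of \<Omega> "-\<Omega>"] I[of "-\<Omega>" \<Omega>] by simp
  also have "(\<integral> z. ?i (-\<Omega>) \<Omega> z \<partial>?P) = (\<integral> z. ?i \<Omega> (-\<Omega>) (snd z, fst z) \<partial>?P)"
    by (intro Bochner_Integration.integral_cong) (auto simp: indicator_def gform_swap)
  also have "\<dots> = (\<integral> z. ?i \<Omega> (-\<Omega>) z \<partial>?P)"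
    by (rule integral_pair_swap) simp
  finally have "(\<integral> z. gform s v \<phi> z \<partial>?P) = (\<integral> z. ?i \<Omega> \<Omega> z \<partial>?P) + 2 * (\<integral> z. ?i \<Omega> (-\<Omega>) z \<partial>?P)" by simp
  then show ?thesis
    unfolding frac_form_def frac_kernel_riesz gform_def[symmetric] by (simp add: algebra_simps)
qed

text \<open>The fractional Laplacian without its normalising constant; meaningful only where the integrand is integrable (otherwise the integral is \<open>0\<close>).\<close>

definition frac_lap :: "real \<Rightarrow> ('a::euclidean_space \<Rightarrow> real) \<Rightarrow> 'a \<Rightarrow> real" where
  "frac_lap s B x = (\<integral> y. (B x - B y) * riesz s (x - y) \<partial>lborel)"

lemma frac_lap_integrable:
  fixes B :: "'a::euclidean_space \<Rightarrow> real"
  assumes s: "0 < s" "s < 1/2" and [measurable]: "B \<in> borel_measurable borel"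
    and L: "\<And>y. \<bar>B x - B y\<bar> \<le> A * min (norm (x - y)) 1"
  shows "integrable lborel (\<lambda>y. (B x - B y) * riesz s (x - y))"
proof (rule Bochner_Integration.integrable_bound)
  have "integrable lborel (\<lambda>z::'a. A * (min (norm z) 1 * riesz s z))"
    using riesz_min1_integrable[OF s, where 'a='a] by simp
  then show "integrable lborel (\<lambda>y. A * (min (norm (x - y)) 1 * riesz s (x - y)))"
    by (subst integrable_reflect) auto
  show "AE y in lborel. norm ((B x - B y) * riesz s (x - y)) \<le> norm (A * (min (norm (x - y)) 1 * riesz s (x - y)))"
  proof (intro AE_I2)
    fix y
    have "\<bar>B x - B y\<bar> * riesz s (x - y) \<le> A * min (norm (x - y)) 1 * riesz s (x - y)"
      by (intro mult_right_mono L) simp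
    then show "norm ((B x - B y) * riesz s (x - y)) \<le> norm (A * (min (norm (x - y)) 1 * riesz s (x - y)))"
      by (simp add: abs_mult[of "B x - B y"] mult.assoc)
  qed
qed simp

text \<open>Integration by parts without a principal value: the form splits as Q(x, y) + Q(y, x)
  with Q(x, y) = \<phi>(x)(B(x) - B(y)) times the kernel. For 2s < 1 the Lipschitz bound makes each
  half absolutely integrable, so Fubini applies to both separately.\<close>

lemma gform_Lipschitz:
  fixes B :: "'a::euclidean_space \<Rightarrow> real"
  assumes s: "0 < s" "s < 1/2" and [measurable]: "B \<in> borel_measurable borel"
    and L: "\<And>x y. x \<in> \<Omega> \<Longrightarrow> \<bar>B x - B y\<bar> \<le> A * min (norm (x - y)) 1"
    and phi: "integrable lborel \<phi>" and z: "\<And>x. x \<notin> \<Omega> \<Longrightarrow> \<phi> x = 0"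
  shows "integrable (lborel \<Otimes>\<^sub>M lborel) (gform s B \<phi>)"
    and "integrable lborel (\<lambda>x. \<phi> x * frac_lap s B x)"
    and "(\<integral> z. gform s B \<phi> z \<partial>(lborel \<Otimes>\<^sub>M lborel)) = 2 * (\<integral> x. \<phi> x * frac_lap s B x \<partial>lborel)"
proof -
  let ?P = "lborel \<Otimes>\<^sub>M lborel :: ('a \<times> 'a) measure"
  have [measurable]: "\<phi> \<in> borel_measurable borel" using phi by simp
  \<comment> \<open>If \<Omega> is empty the Lipschitz hypothesis is vacuous and does not force A
    \<ge> 0.\<close>
  define A' where "A' = max A 0"
  have L': "\<bar>B x - B y\<bar> \<le> A' * min (norm (x - y)) 1" if "x \<in> \<Omega>" for x y
    using L[OF that, of y] by (rule order_trans) (auto simp: A'_def intro!: mult_right_mono)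
  define J where "J = (\<integral>\<^sup>+ z. ennreal (min (norm z) 1 * riesz s (z::'a)) \<partial>lborel)"
  have J: "J < \<infinity>"
    using riesz_min1_integrable[OF s, where 'a='a] unfolding J_def
    by (subst (asm) integrable_iff_bounded) auto
  define Q where "Q z = \<phi> (fst z) * ((B (fst z) - B (snd z)) * riesz s (fst z - snd z))" for z
  have [measurable]: "Q \<in> borel_measurable ?P" unfolding Q_def[abs_def] by measurable
  have Q: "integrable ?P Q"
  proof (rule integrableI_bounded)
    have "ennreal (norm (Q (x, y))) \<le> ennreal (A' * \<bar>\<phi> x\<bar>) * ennreal (min (norm (x - y)) 1 * riesz s (x - y))" for x y
    proof (cases "x \<in> \<Omega>")
      case True
      have "norm (Q (x, y)) = \<bar>\<phi> x\<bar> * (\<bar>B x - B y\<bar> * riesz s (x - y))"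
        by (simp add: Q_def abs_mult)
      also have "\<dots> \<le> \<bar>\<phi> x\<bar> * ((A' * min (norm (x - y)) 1) * riesz s (x - y))"
        using L'[OF True] by (intro mult_left_mono mult_right_mono) auto
      finally show ?thesis
        by (subst ennreal_mult[symmetric]) (auto simp: A'_def intro!: ennreal_leI simp: mult_ac)
    qed (simp add: Q_def z)
    then have "(\<integral>\<^sup>+ x. \<integral>\<^sup>+ y. ennreal (norm (Q (x, y))) \<partial>lborel \<partial>lborel)
      \<le> (\<integral>\<^sup>+ x. \<integral>\<^sup>+ y. ennreal (A' * \<bar>\<phi> x\<bar>) * ennreal (min (norm (x - y)) 1 * riesz s (x - y)) \<partial>lborel \<partial>lborel)"
      by (intro nn_integral_mono) auto
    also have "\<dots> = (\<integral>\<^sup>+ x. ennreal (A' * \<bar>\<phi> x\<bar>) * J \<partial>lborel)"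
      unfolding J_def
      by (subst nn_integral_cmult, simp, subst nn_integral_reflect[of "\<lambda>z. ennreal (min (norm z) 1 * riesz s z)"]) simp_all
    also have "\<dots> = (\<integral>\<^sup>+ x. ennreal (A' * \<bar>\<phi> x\<bar>) \<partial>lborel) * J"
      by (rule nn_integral_multc) simp
    also have "\<dots> < \<infinity>"
    proof -
      have "integrable lborel (\<lambda>x. A' * \<bar>\<phi> x\<bar>)" using phi by simp
      then have "(\<integral>\<^sup>+ x. ennreal (A' * \<bar>\<phi> x\<bar>) \<partial>lborel) < \<infinity>"
        by (subst (asm) integrable_iff_bounded) (auto simp: A'_def abs_mult)
      then show ?thesis using J by (simp add: ennreal_mult_less_top)
    qed
    finally show "(\<integral>\<^sup>+ z. ennreal (norm (Q z)) \<partial>?P) < \<infinity>"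
      by (subst lborel.nn_integral_fst[symmetric]) simp_all
  qed simp
  have eq: "gform s B \<phi> z = Q z + Q (snd z, fst z)" for z
    using riesz_minus[of s "fst z - snd z"] by (simp add: gform_def Q_def algebra_simps)
  show "integrable ?P (gform s B \<phi>)"
    unfolding eq[abs_def] by (intro Bochner_Integration.integrable_add Q integrable_pair_swap)
  have fub: "(\<integral> x. \<phi> x * frac_lap s B x \<partial>lborel) = integral\<^sup>L ?P Q"
    using lborel_pair.integral_fst'[OF Q] by (simp add: Q_def frac_lap_def)
  show "integrable lborel (\<lambda>x. \<phi> x * frac_lap s B x)"
    using lborel_pair.integrable_fst'[OF Q] by (simp add: Q_def frac_lap_def)
  have "(\<integral> z. gform s B \<phi> z \<partial>?P) = integral\<^sup>L ?P Q + (\<integral> z. Q (snd z, fst z) \<partial>?P)"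
    unfolding eq[abs_def] by (intro Bochner_Integration.integral_add Q integrable_pair_swap)
  also have "\<dots> = 2 * (\<integral> x. \<phi> x * frac_lap s B x \<partial>lborel)"
    by (simp add: integral_pair_swap fub)
  finally show "(\<integral> z. gform s B \<phi> z \<partial>?P) = 2 * (\<integral> x. \<phi> x * frac_lap s B x \<partial>lborel)" .
qed

section \<open>Comparison for weak solutions\<close>

text \<open>One of the two factors min(|x - y|, 1) in the squared difference is bounded by 1; the
  remaining one is integrable against the kernel, and the outer integral is finite because \<Omega>
  is bounded.\<close>

lemma cyl_energy_Lipschitz:
  fixes B :: "'a::euclidean_space \<Rightarrow> real"
  assumes s: "0 < s" "s < 1/2" and [measurable]: "B \<in> borel_measurable borel" "\<Omega> \<in> sets borel"
    and bd: "bounded \<Omega>"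
    and L: "\<And>x y. x \<in> \<Omega> \<Longrightarrow> \<bar>B x - B y\<bar> \<le> A * min (norm (x - y)) 1"
  shows "cyl_energy s \<Omega> B < \<infinity>"
proof -
  let ?P = "lborel \<Otimes>\<^sub>M lborel :: ('a \<times> 'a) measure"
  define J where "J = (\<integral>\<^sup>+ z. ennreal (min (norm z) 1 * riesz s (z::'a)) \<partial>lborel)"
  have J: "J < \<infinity>"
    using riesz_min1_integrable[OF s, where 'a='a] unfolding J_def
    by (subst (asm) integrable_iff_bounded) auto
  have pw: "indicator (\<Omega> \<times> UNIV) (x, y) * ennreal (gform s B B (x, y))
     \<le> indicator \<Omega> x * ennreal (A\<^sup>2) * ennreal (min (norm (x - y)) 1 * riesz s (x - y))" for x y :: 'a
  proof (cases "x \<in> \<Omega>")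
    case True
    have "(B x - B y)\<^sup>2 \<le> (A * min (norm (x - y)) 1)\<^sup>2"
      using L[OF True, of y] by (simp add: abs_le_square_iff[symmetric])
    also have "\<dots> = A\<^sup>2 * (min (norm (x - y)) 1 * min (norm (x - y)) 1)"
      by (simp add: power2_eq_square)
    also have "\<dots> \<le> A\<^sup>2 * (min (norm (x - y)) 1 * 1)"
      by (intro mult_left_mono) auto
    finally have "gform s B B (x, y) \<le> A\<^sup>2 * min (norm (x - y)) 1 * riesz s (x - y)"
      by (simp add: gform_self frac_kernel_riesz mult_right_mono)
    then show ?thesis using True
      by (simp add: ennreal_mult[symmetric] ennreal_leI mult.assoc)
  qed simp
  have "cyl_energy s \<Omega> B \<le> (\<integral>\<^sup>+ x. \<integral>\<^sup>+ y. indicator \<Omega> x * ennreal (A\<^sup>2) * ennreal (min (norm (x - y)) 1 * riesz s (x - y)) \<partial>lborel \<partial>lborel)"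
    unfolding cyl_energy_def
    by (subst lborel.nn_integral_fst[symmetric]) (auto intro!: nn_integral_mono pw)
  also have "\<dots> = (\<integral>\<^sup>+ x. indicator \<Omega> x * ennreal (A\<^sup>2) * J \<partial>lborel)"
    unfolding J_def
    by (subst nn_integral_cmult, simp, subst nn_integral_reflect[of "\<lambda>z. ennreal (min (norm z) 1 * riesz s z)"]) simp_all
  also have "\<dots> = emeasure lborel \<Omega> * ennreal (A\<^sup>2) * J"
    by (simp add: nn_integral_multc)
  also have "\<dots> < \<infinity>"
    using J emeasure_bounded_finite[OF bd] by (simp add: ennreal_mult_less_top less_top)
  finally show ?thesis .
qed

lemma Hs_full_of_cyl:
  fixes \<phi> :: "'a::euclidean_space \<Rightarrow> real"
  assumes [measurable]: "\<phi> \<in> borel_measurable borel" "\<Omega> \<in> sets borel"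
    and z: "\<And>x. x \<notin> \<Omega> \<Longrightarrow> \<phi> x = 0" and cyl: "cyl_energy s \<Omega> \<phi> < \<infinity>"
    and L2: "(\<integral>\<^sup>+ x. ennreal ((\<phi> x)\<^sup>2) \<partial>lborel) < \<infinity>"
  shows "\<phi> \<in> Hs_full s"
proof -
  let ?P = "lborel \<Otimes>\<^sub>M lborel :: ('a \<times> 'a) measure"
  let ?c = "\<lambda>z. indicator (\<Omega> \<times> UNIV) z * ennreal (gform s \<phi> \<phi> z)"
  have "ennreal (gform s \<phi> \<phi> z) \<le> ?c z + ?c (snd z, fst z)" for z
  proof (cases "fst z \<in> \<Omega> \<or> snd z \<in> \<Omega>")
    case True
    then show ?thesis by (auto simp: indicator_def gform_swap mem_Times_iff)
  next
    case False
    then show ?thesis using z by (simp add: gform_def)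
  qed
  then have "(\<integral>\<^sup>+ z. ennreal (gform s \<phi> \<phi> z) \<partial>?P) \<le> (\<integral>\<^sup>+ z. ?c z + ?c (snd z, fst z) \<partial>?P)"
    by (rule nn_integral_mono)
  also have "\<dots> = (\<integral>\<^sup>+ z. ?c z \<partial>?P) + (\<integral>\<^sup>+ z. ?c (snd z, fst z) \<partial>?P)"
    by (subst nn_integral_add; simp?)
  also have "(\<integral>\<^sup>+ z. ?c (snd z, fst z) \<partial>?P) = (\<integral>\<^sup>+ z. ?c z \<partial>?P)"
    by (rule nn_integral_pair_swap) simp
  also have "(\<integral>\<^sup>+ z. ?c z \<partial>?P) + (\<integral>\<^sup>+ z. ?c z \<partial>?P) < \<infinity>"
    using cyl by (simp add: cyl_energy_def)
  finally show ?thesis using L2 by (simp add: Hs_full_def gform_self)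
qed

text \<open>The positive part is 1-Lipschitz, so the truncation of v - B has at most the differences
  of v and B combined.\<close>

lemma square_diff_max_le:
  fixes a b c d :: real
  shows "(max (a - b) 0 - max (c - d) 0)\<^sup>2 \<le> 2 * (a - c)\<^sup>2 + 2 * (b - d)\<^sup>2"
proof -
  have "\<bar>max (a - b) 0 - max (c - d) 0\<bar> \<le> \<bar>(a - c) - (b - d)\<bar>" by linarith
  then have "(max (a - b) 0 - max (c - d) 0)\<^sup>2 \<le> ((a - c) - (b - d))\<^sup>2"
    by (simp only: abs_le_square_iff)
  also have "\<dots> \<le> 2 * (a - c)\<^sup>2 + 2 * (b - d)\<^sup>2"
    using zero_le_power2[of "(a - c) + (b - d)"] by (simp add: power2_eq_square algebra_simps)
  finally show ?thesis .
qed

lemma ennreal_le_double: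
  assumes "a \<le> 2 * b + 2 * c" "0 \<le> b" "0 \<le> c"
  shows "ennreal a \<le> 2 * ennreal b + 2 * ennreal c"
proof -
  have "ennreal a \<le> ennreal (2 * b + 2 * c)" using assms(1) by (rule ennreal_leI)
  also have "\<dots> = 2 * ennreal b + 2 * ennreal c" using assms by (simp add: ennreal_plus ennreal_mult')
  finally show ?thesis .
qed

text \<open>Admissibility of the test function used in the comparison principle. That it vanishes
  off \<Omega> is the hypothesis v \<le> B there, so only the cylinder energies of \<open>v\<close>
  and \<open>B\<close> enter.\<close>

lemma truncation_Hs_full:
  fixes v B :: "'a::euclidean_space \<Rightarrow> real"
  assumes s: "0 < s" "s < 1/2" and [measurable]: "v \<in> borel_measurable borel" "B \<in> borel_measurable borel" "\<Omega> \<in> sets borel"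
    and bd: "bounded \<Omega>" and cyl: "cyl_energy s \<Omega> v < \<infinity>"
    and L2: "(\<integral>\<^sup>+ x\<in>\<Omega>. ennreal ((v x)\<^sup>2) \<partial>lborel) < \<infinity>"
    and L: "\<And>x y. x \<in> \<Omega> \<Longrightarrow> \<bar>B x - B y\<bar> \<le> A * min (norm (x - y)) 1"
    and Bb: "\<And>x. x \<in> \<Omega> \<Longrightarrow> \<bar>B x\<bar> \<le> c" and out: "\<And>x. x \<notin> \<Omega> \<Longrightarrow> v x \<le> B x"
  shows "(\<lambda>x. max (v x - B x) 0) \<in> Hs_full s"
proof (rule Hs_full_of_cyl[where \<Omega>=\<Omega>])
  let ?P = "lborel \<Otimes>\<^sub>M lborel :: ('a \<times> 'a) measure"
  let ?\<phi> = "\<lambda>x. max (v x - B x) 0"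
  show "max (v x - B x) 0 = 0" if "x \<notin> \<Omega>" for x using out[OF that] by simp
  have cB: "cyl_energy s \<Omega> B < \<infinity>" by (rule cyl_energy_Lipschitz[OF s _ _ bd L]) auto
  have "gform s ?\<phi> ?\<phi> z \<le> 2 * gform s v v z + 2 * gform s B B z" for z
  proof -
    have "gform s ?\<phi> ?\<phi> z \<le> (2 * (v (fst z) - v (snd z))\<^sup>2 + 2 * (B (fst z) - B (snd z))\<^sup>2) * riesz s (fst z - snd z)"
      unfolding gform_self frac_kernel_riesz by (intro mult_right_mono square_diff_max_le) simp
    then show ?thesis by (simp add: gform_self frac_kernel_riesz algebra_simps)
  qed
  then have "ennreal (gform s ?\<phi> ?\<phi> z) \<le> 2 * ennreal (gform s v v z) + 2 * ennreal (gform s B B z)" for z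
    by (rule ennreal_le_double) simp_all
  then have "cyl_energy s \<Omega> ?\<phi> \<le> (\<integral>\<^sup>+ z. 2 * (indicator (\<Omega> \<times> UNIV) z * ennreal (gform s v v z)) + 2 * (indicator (\<Omega> \<times> UNIV) z * ennreal (gform s B B z)) \<partial>?P)"
    unfolding cyl_energy_def by (intro nn_integral_mono) (auto simp: indicator_def)
  also have "\<dots> = 2 * cyl_energy s \<Omega> v + 2 * cyl_energy s \<Omega> B"
    unfolding cyl_energy_def by (simp add: nn_integral_add nn_integral_cmult)
  also have "\<dots> < \<infinity>" using cyl cB by (simp add: ennreal_mult_less_top)
  finally show "cyl_energy s \<Omega> ?\<phi> < \<infinity>" .
  have "ennreal ((?\<phi> x)\<^sup>2) \<le> 2 * (ennreal ((v x)\<^sup>2) * indicator \<Omega> x) + 2 * ennreal (c\<^sup>2) * indicator \<Omega> x" for x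
  proof (cases "x \<in> \<Omega>")
    case True
    have "(?\<phi> x)\<^sup>2 \<le> 2 * (v x)\<^sup>2 + 2 * (B x)\<^sup>2"
      using square_diff_max_le[of "v x" "B x" 0 0] by simp
    also have "\<dots> \<le> 2 * (v x)\<^sup>2 + 2 * c\<^sup>2"
      using power_mono[OF Bb[OF True], of 2] by simp
    finally show ?thesis using True ennreal_le_double by simp
  qed (use out in auto)
  then have "(\<integral>\<^sup>+ x. ennreal ((?\<phi> x)\<^sup>2) \<partial>lborel) \<le> (\<integral>\<^sup>+ x. 2 * (ennreal ((v x)\<^sup>2) * indicator \<Omega> x) + 2 * ennreal (c\<^sup>2) * indicator \<Omega> x \<partial>lborel)"
    by (rule nn_integral_mono)
  also have "\<dots> = 2 * (\<integral>\<^sup>+ x\<in>\<Omega>. ennreal ((v x)\<^sup>2) \<partial>lborel) + 2 * ennreal (c\<^sup>2) * emeasure lborel \<Omega>"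
    by (simp add: nn_integral_add nn_integral_cmult)
  also have "\<dots> < \<infinity>" using L2 emeasure_bounded_finite[OF bd] by (simp add: ennreal_mult_less_top less_top)
  finally show "(\<integral>\<^sup>+ x. ennreal ((?\<phi> x)\<^sup>2) \<partial>lborel) < \<infinity>" .
qed auto

text \<open>From |t| \<le> t^2 + 1 and the finite measure of the support.\<close>

lemma Hs_full_integrable:
  fixes \<phi> :: "'a::euclidean_space \<Rightarrow> real"
  assumes phi: "\<phi> \<in> Hs_full s" and [measurable]: "\<Omega> \<in> sets borel" and bd: "bounded \<Omega>"
    and z: "\<And>x. x \<notin> \<Omega> \<Longrightarrow> \<phi> x = 0"
  shows "integrable lborel \<phi>"
proof (rule integrableI_bounded)
  show [measurable]: "\<phi> \<in> borel_measurable lborel" using phi by (simp add: Hs_full_def)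
  have "ennreal (norm (\<phi> x)) \<le> ennreal ((\<phi> x)\<^sup>2) + indicator \<Omega> x" for x
  proof (cases "x \<in> \<Omega>")
    case True
    have "\<bar>\<phi> x\<bar> \<le> (\<phi> x)\<^sup>2 + 1"
      using zero_le_power2[of "\<bar>\<phi> x\<bar> - 1"] abs_ge_zero[of "\<phi> x"] by (simp add: power2_diff)
    then have "ennreal (norm (\<phi> x)) \<le> ennreal ((\<phi> x)\<^sup>2 + 1)" by (intro ennreal_leI) simp
    also have "\<dots> = ennreal ((\<phi> x)\<^sup>2) + indicator \<Omega> x" using True by (simp add: ennreal_plus)
    finally show ?thesis .
  qed (simp add: z)
  then have "(\<integral>\<^sup>+ x. ennreal (norm (\<phi> x)) \<partial>lborel) \<le> (\<integral>\<^sup>+ x. ennreal ((\<phi> x)\<^sup>2) + indicator \<Omega> x \<partial>lborel)"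
    by (rule nn_integral_mono)
  also have "\<dots> = (\<integral>\<^sup>+ x. ennreal ((\<phi> x)\<^sup>2) \<partial>lborel) + emeasure lborel \<Omega>"
    by (simp add: nn_integral_add)
  also have "\<dots> < \<infinity>" using phi emeasure_bounded_finite[OF bd] by (simp add: Hs_full_def less_top)
  finally show "(\<integral>\<^sup>+ x. ennreal (norm (\<phi> x)) \<partial>lborel) < \<infinity>" .
qed

text \<open>The semilinear term is absorbed into the right hand side \<open>F\<close>; the exponent \<open>p\<close> only restricts the test functions.\<close>

definition weak_eq :: "real \<Rightarrow> real \<Rightarrow> 'a::euclidean_space set \<Rightarrow> ('a \<Rightarrow> real) \<Rightarrow> ('a \<Rightarrow> real) \<Rightarrow> bool" where
  "weak_eq s p \<Omega> v F \<longleftrightarrow> v \<in> borel_measurable borel \<and> cyl_energy s \<Omega> v < \<infinity> \<and>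
     (\<integral>\<^sup>+ x\<in>\<Omega>. ennreal ((v x)\<^sup>2) \<partial>lborel) < \<infinity> \<and>
     (\<forall>\<phi>. \<phi> \<in> Hs_full s \<longrightarrow> (\<forall>x. x \<notin> \<Omega> \<longrightarrow> \<phi> x = 0) \<longrightarrow> Lp_on p \<Omega> \<phi> \<longrightarrow>
        integrable lborel (\<lambda>x. F x * \<phi> x) \<and>
        gamma_ns DIM('a) s / 2 * (\<integral> z. gform s v \<phi> z \<partial>(lborel \<Otimes>\<^sub>M lborel)) = (\<integral> x. F x * \<phi> x \<partial>lborel))"

text \<open>Later lemmas ask for bounds and exterior values at every point; this allows the
  representative to be corrected on null sets while \<open>F\<close> is kept fixed.\<close>

lemma weak_eq_cong_AE:
  fixes v :: "'a::euclidean_space \<Rightarrow> real"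
  assumes w: "weak_eq s p \<Omega> v F" and ae: "AE x in lborel. v' x = v x"
    and [measurable]: "v' \<in> borel_measurable borel" "\<Omega> \<in> sets borel"
  shows "weak_eq s p \<Omega> v' F"
proof -
  have [measurable]: "v \<in> borel_measurable borel" using w by (simp add: weak_eq_def)
  note ae2 = AE_lborel_pair[OF ae]
  have "cyl_energy s \<Omega> v' = cyl_energy s \<Omega> v"
    unfolding cyl_energy_def
    by (intro nn_integral_cong_AE eventually_mono[OF ae2]) (auto simp: gform_def)
  moreover have "(\<integral>\<^sup>+ x\<in>\<Omega>. ennreal ((v' x)\<^sup>2) \<partial>lborel) = (\<integral>\<^sup>+ x\<in>\<Omega>. ennreal ((v x)\<^sup>2) \<partial>lborel)"
    by (intro nn_integral_cong_AE eventually_mono[OF ae]) auto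
  moreover have "(\<integral> z. gform s v' \<phi> z \<partial>(lborel \<Otimes>\<^sub>M lborel)) = (\<integral> z. gform s v \<phi> z \<partial>(lborel \<Otimes>\<^sub>M lborel))" if "\<phi> \<in> Hs_full s" for \<phi>
  proof -
    have [measurable]: "\<phi> \<in> borel_measurable borel" using that by (simp add: Hs_full_def)
    show ?thesis
      by (intro integral_cong_AE eventually_mono[OF ae2]) (measurable, auto simp: gform_def)
  qed
  ultimately show ?thesis using w by (simp add: weak_eq_def)
qed

lemma weak_eq_uminus:
  fixes v :: "'a::euclidean_space \<Rightarrow> real"
  assumes w: "weak_eq s p \<Omega> v F"
  shows "weak_eq s p \<Omega> (\<lambda>x. - v x) (\<lambda>x. - F x)"
proof -
  have "gform s (\<lambda>x. - v x) \<phi> = (\<lambda>z. - gform s v \<phi> z)" for \<phi>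
    by (rule ext) (simp add: gform_def algebra_simps)
  moreover have "gform s (\<lambda>x. - v x) (\<lambda>x. - v x) = gform s v v"
    by (rule ext) (simp add: gform_def algebra_simps)
  ultimately show ?thesis using w by (simp add: weak_eq_def cyl_energy_def)
qed

text \<open>Test with \<phi> = (v - B)+. Replacing v by B in the form can only decrease it, so
  \<gamma> times the integral of \<phi> \<open>frac_lap s B\<close> is at most that of F \<phi>. The
  supersolution inequality points the other way on {v > B}, and its strictness replaces any
  coercivity argument.\<close>

lemma comparison:
  fixes v B F :: "'a::euclidean_space \<Rightarrow> real"
  assumes s: "0 < s" "s < 1/2" and w: "weak_eq s p \<Omega> v F"
    and [measurable]: "B \<in> borel_measurable borel" "\<Omega> \<in> sets borel"
    and bd: "bounded \<Omega>"
    and L: "\<And>x y. x \<in> \<Omega> \<Longrightarrow> \<bar>B x - B y\<bar> \<le> A * min (norm (x - y)) 1"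
    and Bb: "\<And>x. x \<in> \<Omega> \<Longrightarrow> \<bar>B x\<bar> \<le> c" and out: "\<And>x. x \<notin> \<Omega> \<Longrightarrow> v x \<le> B x"
    and Lp: "Lp_on p \<Omega> (\<lambda>x. max (v x - B x) 0)"
    and super: "AE x in lborel. x \<in> \<Omega> \<and> v x > B x \<longrightarrow> F x < gamma_ns DIM('a) s * frac_lap s B x"
  shows "AE x in lborel. v x \<le> B x"
proof -
  let ?P = "lborel \<Otimes>\<^sub>M lborel :: ('a \<times> 'a) measure"
  define g where "g = gamma_ns DIM('a) s"
  have g: "g > 0" unfolding g_def using gamma_ns_pos s by blast
  have [measurable]: "v \<in> borel_measurable borel" using w by (simp add: weak_eq_def)
  define \<phi> where "\<phi> x = max (v x - B x) 0" for x
  have [measurable]: "\<phi> \<in> borel_measurable borel" unfolding \<phi>_def[abs_def] by measurable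
  have H: "\<phi> \<in> Hs_full s"
    unfolding \<phi>_def[abs_def]
    by (rule truncation_Hs_full[OF s _ _ _ bd _ _ L Bb out]) (use w in \<open>auto simp: weak_eq_def\<close>)
  have z: "\<phi> x = 0" if "x \<notin> \<Omega>" for x using out[OF that] by (simp add: \<phi>_def)
  have int: "integrable lborel \<phi>" by (rule Hs_full_integrable[OF H _ bd z]) auto
  note GB = gform_Lipschitz[OF s \<open>B \<in> borel_measurable borel\<close> L int z]
  have Gv: "integrable ?P (gform s v \<phi>)"
    by (rule gform_integrable[OF _ _ _ H z]) (use w in \<open>auto simp: weak_eq_def\<close>)
  have eq: "integrable lborel (\<lambda>x. F x * \<phi> x)" "g / 2 * (\<integral> z. gform s v \<phi> z \<partial>?P) = (\<integral> x. F x * \<phi> x \<partial>lborel)"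
    using w H z Lp unfolding weak_eq_def g_def \<phi>_def[abs_def] by blast+
  \<comment> \<open>\<phi> is a nondecreasing function of v - B, so the differences of \<phi> and of
    v - B never have opposite signs.\<close>
  have "gform s B \<phi> z \<le> gform s v \<phi> z" for z
  proof -
    have "(B x - B y) * (\<phi> x - \<phi> y) \<le> (v x - v y) * (\<phi> x - \<phi> y)" for x y
    proof (cases "\<phi> x \<ge> \<phi> y")
      case True
      then have "\<phi> x = \<phi> y \<or> B x - B y \<le> v x - v y" by (auto simp: \<phi>_def max_def split: if_splits)
      then show ?thesis using True by (auto intro: mult_right_mono)
    next
      case False
      then have "B x - B y \<ge> v x - v y" by (auto simp: \<phi>_def max_def split: if_splits)
      then show ?thesis using False by (auto intro: mult_right_mono_neg)
    qed
    then show ?thesis by (simp add: gform_def mult_right_mono)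
  qed
  then have "(\<integral> z. gform s B \<phi> z \<partial>?P) \<le> (\<integral> z. gform s v \<phi> z \<partial>?P)"
    by (intro integral_mono GB(1) Gv) auto
  then have "g / 2 * (\<integral> z. gform s B \<phi> z \<partial>?P) \<le> g / 2 * (\<integral> z. gform s v \<phi> z \<partial>?P)"
    using g by (intro mult_left_mono) auto
  then have "g / 2 * (2 * (\<integral> x. \<phi> x * frac_lap s B x \<partial>lborel)) \<le> (\<integral> x. F x * \<phi> x \<partial>lborel)"
    using GB(3) eq(2) by simp
  then have le: "(\<integral> x. g * (\<phi> x * frac_lap s B x) - F x * \<phi> x \<partial>lborel) \<le> 0"
    using GB(2) eq(1) by simp
  have I: "integrable lborel (\<lambda>x. g * (\<phi> x * frac_lap s B x) - F x * \<phi> x)"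
    using GB(2) eq(1) by simp
  have alt: "g * (\<phi> x * frac_lap s B x) - F x * \<phi> x = \<phi> x * (g * frac_lap s B x - F x)" for x
    by (simp add: algebra_simps)
  have nn: "AE x in lborel. 0 \<le> g * (\<phi> x * frac_lap s B x) - F x * \<phi> x"
    using super
  proof (rule eventually_mono)
    fix x assume h: "x \<in> \<Omega> \<and> B x < v x \<longrightarrow> F x < gamma_ns DIM('a) s * frac_lap s B x"
    show "0 \<le> g * (\<phi> x * frac_lap s B x) - F x * \<phi> x"
    proof (cases "x \<in> \<Omega> \<and> B x < v x")
      case True
      then show ?thesis unfolding alt using h by (intro mult_nonneg_nonneg) (auto simp: g_def \<phi>_def)
    next
      case False
      then have "\<phi> x = 0" using z by (auto simp: \<phi>_def)
      then show ?thesis by simp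
    qed
  qed
  \<comment> \<open>A nonnegative integrand with nonpositive integral vanishes almost everywhere; by
    strictness this leaves no room for v > B.\<close>
  have "(\<integral> x. g * (\<phi> x * frac_lap s B x) - F x * \<phi> x \<partial>lborel) = 0"
    using le integral_nonneg_AE[OF nn] by linarith
  then have "AE x in lborel. g * (\<phi> x * frac_lap s B x) - F x * \<phi> x = 0"
    using integral_nonneg_eq_0_iff_AE[OF I nn] by simp
  then show ?thesis
    using super
  proof eventually_elim
    case (elim x)
    show ?case
    proof (rule ccontr)
      assume "\<not> v x \<le> B x"
      then have "x \<in> \<Omega>" "\<phi> x > 0" using out[of x] by (auto simp: \<phi>_def)
      then show False using elim unfolding alt using \<open>\<not> v x \<le> B x\<close> by (auto simp: g_def)
    qed
  qed
qed

section \<open>Doubling of variables\<close>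

text \<open>Subadditivity defect of \<open>t^s\<close>: for small \<open>r\<close>, moving the pair to distances \<open>2r\<close> and \<open>2 + 2r\<close> costs less than staying at distance \<open>1\<close> twice.\<close>

lemma reflection_gain:
  fixes s :: real assumes s: "0 < s" "s < 1"
  obtains r where "0 < r" "r \<le> 1/4" "(2 * r) powr s + (2 + 2 * r) powr s < 2"
proof -
  have "((\<lambda>r. (2 * r) powr s + (2 + 2 * r) powr s) \<longlongrightarrow> (2 * 0) powr s + (2 + 2 * 0) powr s) (at_right 0)"
    using s by (intro tendsto_intros tendsto_powr') (auto intro!: eventually_at_right_less simp: eventually_at_filter)
  moreover have "(2 * 0) powr s + (2 + 2 * 0) powr s < (2::real)"
    using powr_less_mono[of s 1 2] s by simp
  ultimately have "eventually (\<lambda>r. (2 * r) powr s + (2 + 2 * r) powr s < 2) (at_right (0::real))"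
    by (rule order_tendstoD)
  moreover have "eventually (\<lambda>r. r \<in> {0<..<1/4}) (at_right (0::real))"
    by (rule eventually_at_right_real) simp
  ultimately have "eventually (\<lambda>r. (2 * r) powr s + (2 + 2 * r) powr s < 2 \<and> r \<in> {0<..<1/4}) (at_right (0::real))"
    by (rule eventually_conj)
  then obtain r where "(2 * r) powr s + (2 + 2 * r) powr s < 2" "r \<in> {0<..<1/4::real}"
    using eventually_happens'[OF trivial_limit_at_right_real] by blast
  then show ?thesis using that by auto
qed

text \<open>The maximum must be global, since it is later compared with translates by arbitrary z.
  Each penalty reaches the full oscillation 2M at distance \<rho>: the weight 2M/\<rho> does so for
  |x - x0|, the condition on L for |x - y|. Hence \<Phi> > 0 only on a compact set, where the
  continuous \<Phi> attains its maximum.\<close>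

lemma doubling_max:
  fixes u :: "'a::euclidean_space \<Rightarrow> real"
  assumes cont: "continuous_on UNIV u" and bdd: "\<And>x. \<bar>u x\<bar> \<le> M" and \<rho>: "\<rho> > 0" and s: "s > 0"
    and L: "L > 0" "2 * M \<le> L * \<rho> powr s"
    and \<Phi>: "\<Phi> = (\<lambda>x y. u x - u y - L * norm (x - y) powr s - 2 * M / \<rho> * min (norm (x - x0)) \<rho>)"
    and pos: "\<Phi> x1 y1 > 0"
  obtains x y where "\<Phi> x y > 0" "norm (x - x0) < \<rho>" "norm (x - y) < \<rho>" "\<And>x' y'. \<Phi> x' y' \<le> \<Phi> x y"
proof -
  have M0: "M \<ge> 0" using bdd[of x0] by linarith
  have near: "norm (x - x0) < \<rho> \<and> norm (x - y) < \<rho>" if "\<Phi> x y > 0" for x y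
  proof -
    have d: "u x - u y \<le> 2 * M" using bdd[of x] bdd[of y] by linarith
    have 1: "0 \<le> L * norm (x - y) powr s" using L by simp
    have 2: "0 \<le> 2 * M / \<rho> * min (norm (x - x0)) \<rho>" using M0 \<rho> by simp
    have "norm (x - x0) < \<rho>"
    proof (rule ccontr)
      assume "\<not> ?thesis"
      then have "2 * M / \<rho> * min (norm (x - x0)) \<rho> = 2 * M" using \<rho> by simp
      then show False using that d 1 by (simp add: \<Phi>)
    qed
    moreover have "norm (x - y) < \<rho>"
    proof (rule ccontr)
      assume "\<not> ?thesis"
      then have "\<rho> powr s \<le> norm (x - y) powr s" using \<rho> s by (intro powr_mono2) auto
      then have "2 * M \<le> L * norm (x - y) powr s" using L by (meson mult_left_mono less_imp_le order_trans)
      then show False using that d 2 by (simp add: \<Phi>)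
    qed
    ultimately show ?thesis by simp
  qed
  define S where "S = cball x0 \<rho> \<times> cball x0 (2 * \<rho>)"
  have inS: "(x, y) \<in> S" if "\<Phi> x y > 0" for x y
  proof -
    have "norm (y - x0) \<le> norm (x - x0) + norm (x - y)"
      using norm_triangle_ineq4[of "x - x0" "x - y"] by simp
    then show ?thesis using near[OF that] by (simp add: S_def dist_norm norm_minus_commute)
  qed
  have "compact S" unfolding S_def by (intro compact_Times compact_cball)
  moreover have "S \<noteq> {}" using inS[OF pos] by auto
  moreover have "continuous_on S (\<lambda>p. \<Phi> (fst p) (snd p))"
    unfolding \<Phi> using s
    by (intro continuous_intros continuous_on_compose2[OF cont] continuous_on_powr') auto
  ultimately obtain p where p: "p \<in> S" "\<And>q. q \<in> S \<Longrightarrow> \<Phi> (fst q) (snd q) \<le> \<Phi> (fst p) (snd p)"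
    using continuous_attains_sup[of S "\<lambda>p. \<Phi> (fst p) (snd p)"] by auto
  have pp: "\<Phi> (fst p) (snd p) > 0" using p(2)[OF inS[OF pos]] pos by simp
  moreover have "\<Phi> x' y' \<le> \<Phi> (fst p) (snd p)" for x' y'
    using p(2)[of "(x', y')"] inS[of x' y'] pp by force
  ultimately show ?thesis using that near by blast
qed

text \<open>Maximality is used at two shifted pairs added together. Parallel shifts (x \<plusminus>
  z, y \<plusminus> z) keep x - y, so only the localising penalty changes. For z close to -(x - y)/2
  the crossed pairs (x + z, y - z) and (x - z, y + z) are used instead: one distance nearly
  collapses, the other at most nearly doubles, and the defect \<kappa> is gained.\<close>

lemma doubling_estimate:
  fixes u :: "'a::euclidean_space \<Rightarrow> real"
  assumes s: "0 < s" and r: "0 < r" "r \<le> 1/4" and \<kappa>: "\<kappa> = 2 - ((2 * r) powr s + (2 + 2 * r) powr s)"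
    and \<rho>: "\<rho> > 0" and K: "K \<ge> 0" and L: "L \<ge> 0"
    and \<Phi>: "\<Phi> = (\<lambda>x y. u x - u y - L * norm (x - y) powr s - K * min (norm (x - x0)) \<rho>)"
    and max: "\<And>x' y'. \<Phi> x' y' \<le> \<Phi> x y"
  shows "(u (x + z) + u (x - z) - 2 * u x) - (u (y + z) + u (y - z) - 2 * u y)
    \<le> 2 * K * (1 + \<rho>) * min (norm z) 1
       - \<kappa> * L * norm (x - y) powr s * indicator (ball (- ((x - y) /\<^sub>R 2)) (r * norm (x - y))) z"
proof -
  define a where "a = x - y"
  define \<psi> where "\<psi> w = K * min (norm (w - x0)) \<rho>" for w
  have \<psi>: "\<psi> (x + h) - \<psi> x \<le> K * (1 + \<rho>) * min (norm h) 1" for h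
  proof -
    have "min (norm (x + h - x0)) \<rho> - min (norm (x - x0)) \<rho> \<le> min (norm h) \<rho>"
    proof -
      have "norm (x + h - x0) \<le> norm (x - x0) + norm h"
        using norm_triangle_ineq[of "x - x0" h] by (simp add: algebra_simps)
      then show ?thesis using norm_ge_zero[of "x - x0"] norm_ge_zero[of h] \<rho> by linarith
    qed
    \<comment> \<open>This turns the scale \<rho> of the penalty into the fixed weight min(|h|, 1),
      against which the kernel is integrable.\<close>
    also have "\<dots> \<le> (1 + \<rho>) * min (norm h) 1"
    proof (cases "norm h \<le> 1")
      case True
      then have "(1 + \<rho>) * min (norm h) 1 = norm h + \<rho> * norm h" by (simp add: distrib_right)
      moreover have "0 \<le> \<rho> * norm h" using \<rho> by simp
      ultimately show ?thesis by linarith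
    next
      case False then show ?thesis using \<rho> by simp
    qed
    finally show ?thesis
      unfolding \<psi>_def right_diff_distrib[symmetric] mult.assoc using K by (intro mult_left_mono) auto
  qed
  have m: "u x' - u y' - L * norm (x' - y') powr s - \<psi> x' \<le> u x - u y - L * norm a powr s - \<psi> x" for x' y'
    using max[of x' y'] by (simp add: \<Phi> \<psi>_def a_def)
  show ?thesis
  proof (cases "z \<in> ball (- ((x - y) /\<^sub>R 2)) (r * norm (x - y))")
    case False
    have "norm (x + z - (y + z)) = norm a" "norm (x - z - (y - z)) = norm a" by (simp_all add: a_def)
    then have "u (x + z) - u (y + z) - \<psi> (x + z) \<le> u x - u y - \<psi> x"
       "u (x - z) - u (y - z) - \<psi> (x - z) \<le> u x - u y - \<psi> x"
      using m[of "x + z" "y + z"] m[of "x - z" "y - z"] by simp_all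
    then show ?thesis using False \<psi>[of z] \<psi>[of "-z"] by simp
  next
    case True
    have "norm (a /\<^sub>R 2 + z) < r * norm a"
      using True by (simp add: a_def dist_norm norm_minus_commute add.commute)
    moreover have "a + 2 *\<^sub>R z = 2 *\<^sub>R (a /\<^sub>R 2 + z)" by (simp add: scaleR_add_right)
    ultimately have n1: "norm (a + 2 *\<^sub>R z) \<le> (2 * r) * norm a" by simp
    have e0: "2 *\<^sub>R a - (a + 2 *\<^sub>R z) = a - 2 *\<^sub>R z" by (simp add: scaleR_2)
    have "norm (a - 2 *\<^sub>R z) \<le> 2 * norm a + norm (a + 2 *\<^sub>R z)"
      using norm_triangle_ineq4[of "2 *\<^sub>R a" "a + 2 *\<^sub>R z"] unfolding e0 by simp
    then have n2: "norm (a - 2 *\<^sub>R z) \<le> (2 + 2 * r) * norm a"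
      using n1 by (simp add: distrib_right)
    have p1: "norm (a + 2 *\<^sub>R z) powr s \<le> (2 * r) powr s * norm a powr s"
      using powr_mono2[OF _ _ n1, of s] s r by (simp add: powr_mult)
    have p2: "norm (a - 2 *\<^sub>R z) powr s \<le> (2 + 2 * r) powr s * norm a powr s"
      using powr_mono2[OF _ _ n2, of s] s r by (simp add: powr_mult)
    have e1: "x + z - (y - z) = a + 2 *\<^sub>R z" "x - z - (y + z) = a - 2 *\<^sub>R z"
      by (simp_all add: a_def scaleR_2)
    have "L * (norm (a + 2 *\<^sub>R z) powr s + norm (a - 2 *\<^sub>R z) powr s)
       \<le> L * ((2 * r) powr s * norm a powr s + (2 + 2 * r) powr s * norm a powr s)"
      using p1 p2 L by (intro mult_left_mono add_mono) auto
    also have "\<dots> = 2 * (L * norm a powr s) - \<kappa> * L * norm a powr s"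
      by (simp add: \<kappa> algebra_simps)
    finally have "L * norm (a + 2 *\<^sub>R z) powr s + L * norm (a - 2 *\<^sub>R z) powr s
       \<le> 2 * (L * norm a powr s) - \<kappa> * L * norm a powr s"
      by (simp add: algebra_simps)
    then show ?thesis
      using True \<psi>[of z] \<psi>[of "-z"] m[of "x + z" "y - z"] m[of "x - z" "y + z"]
      unfolding e1 a_def[symmetric] by simp
  qed
qed

text \<open>Integrated against \<open>riesz\<close>, this is -2 times \<open>frac_lap\<close> where
  that converges absolutely. Having z and -z in one integrand is what permits the crossed pairing of
  shifts.\<close>

definition second_diff :: "('a::real_normed_vector \<Rightarrow> real) \<Rightarrow> 'a \<Rightarrow> 'a \<Rightarrow> real" where
  "second_diff u x z = u (x + z) + u (x - z) - 2 * u x"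

text \<open>The ball of gain has volume of order a^n with a = |x - y|, and the kernel there is at
  least a^(-n-2s), so the gain is c L a^(-s). Equation and penalty bound it by a constant R,
  contradicting the choice of L as a < \<rho>. \<open>L\<close> is fixed before \<open>u\<close>, so
  it serves a whole family of mollifications.\<close>

lemma interior_holder_onesided:
  assumes s: "0 < s" "s < 1/2" and \<rho>: "\<rho> > 0" and M: "M \<ge> 0" and H: "H \<ge> 0"
  obtains L where "L > 0" "\<And>(u::'a::euclidean_space \<Rightarrow> real) x0 y.
     continuous_on UNIV u \<Longrightarrow> (\<And>x. \<bar>u x\<bar> \<le> M) \<Longrightarrow>
     (\<And>x. x \<in> ball x0 (2 * \<rho>) \<Longrightarrow> integrable lborel (\<lambda>z. second_diff u x z * riesz s z)) \<Longrightarrow>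
     (\<And>x. x \<in> ball x0 (2 * \<rho>) \<Longrightarrow> \<bar>\<integral> z. second_diff u x z * riesz s z \<partial>lborel\<bar> \<le> H) \<Longrightarrow>
     u x0 - u y \<le> L * norm (x0 - y) powr s"
proof -
  obtain r where r: "0 < r" "r \<le> 1/4" "(2 * r) powr s + (2 + 2 * r) powr s < 2"
    using reflection_gain[of s] s by auto
  define \<kappa> where "\<kappa> = 2 - ((2 * r) powr s + (2 + 2 * r) powr s)"
  have \<kappa>: "\<kappa> > 0" using r by (simp add: \<kappa>_def)
  define N where "N = real DIM('a)"
  define U where "U = unit_ball_vol N"
  have U: "U > 0" unfolding U_def N_def by simp
  define J where "J = (\<integral> z. min (norm z) 1 * riesz s (z::'a) \<partial>lborel)"
  have J0: "J \<ge> 0" unfolding J_def by (intro integral_nonneg_AE AE_I2) simp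
  define K where "K = 2 * M / \<rho>"
  have K: "K \<ge> 0" using M \<rho> by (simp add: K_def)
  define R where "R = 2 * H + 2 * K * (1 + \<rho>) * J"
  have R0: "R \<ge> 0" using H K \<rho> J0 by (simp add: R_def)
  define c where "c = \<kappa> * U * r powr N"
  have c: "c > 0" using \<kappa> U r by (simp add: c_def)
  \<comment> \<open>The second summand confines the maximum as \<open>doubling_max\<close> demands,
    the third makes the gain at scale \<rho> at least R, and the 1 makes that inequality
    strict.\<close>
  define L where "L = 1 + 2 * M / \<rho> powr s + R * \<rho> powr s / c"
  have L: "L > 0" unfolding L_def using M R0 c by (intro add_pos_nonneg) auto
  have L2: "2 * M \<le> L * \<rho> powr s"
  proof -
    have "2 * M = 2 * M / \<rho> powr s * \<rho> powr s" using \<rho> by simp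
    also have "\<dots> \<le> L * \<rho> powr s"
      using R0 c by (intro mult_right_mono) (auto simp: L_def)
    finally show ?thesis .
  qed
  have L3: "R < c * L * \<rho> powr (- s)"
  proof -
    have "R = c * (R * \<rho> powr s / c) * \<rho> powr (- s)" using c \<rho> by (simp add: powr_minus)
    also have "\<dots> < c * L * \<rho> powr (- s)"
      using c \<rho> M by (intro mult_strict_right_mono mult_strict_left_mono) (auto simp: L_def add_pos_nonneg)
    finally show ?thesis .
  qed
  have main: "u x0 - u y0 \<le> L * norm (x0 - y0) powr s"
    if cont: "continuous_on UNIV u" and bdd: "\<And>x. \<bar>u x\<bar> \<le> M"
      and int: "\<And>x. x \<in> ball x0 (2 * \<rho>) \<Longrightarrow> integrable lborel (\<lambda>z. second_diff u x z * riesz s z)"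
      and est: "\<And>x. x \<in> ball x0 (2 * \<rho>) \<Longrightarrow> \<bar>\<integral> z. second_diff u x z * riesz s z \<partial>lborel\<bar> \<le> H"
    for u :: "'a \<Rightarrow> real" and x0 y0
  proof (rule ccontr)
    define \<Phi> where "\<Phi> = (\<lambda>x y. u x - u y - L * norm (x - y) powr s - K * min (norm (x - x0)) \<rho>)"
    assume "\<not> ?thesis"
    \<comment> \<open>The localising penalty vanishes at the centre x0, so a failure of the estimate
      is exactly positivity of \<Phi>.\<close>
    then have pos: "\<Phi> x0 y0 > 0" using \<rho> by (simp add: \<Phi>_def)
    obtain x y where xy: "\<Phi> x y > 0" "norm (x - x0) < \<rho>" "norm (x - y) < \<rho>" and max: "\<And>x' y'. \<Phi> x' y' \<le> \<Phi> x y"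
      using doubling_max[OF cont bdd \<rho> s(1) L L2 \<Phi>_def[unfolded K_def] pos] by blast
    have ne: "x \<noteq> y"
      using xy(1) mult_nonneg_nonneg[OF K, of "min (norm (x - x0)) \<rho>"] \<rho> by (auto simp: \<Phi>_def)
    define a where "a = norm (x - y)"
    have a: "0 < a" "a < \<rho>" using ne xy by (auto simp: a_def)
    have xin: "x \<in> ball x0 (2 * \<rho>)" using xy(2) \<rho> by (simp add: dist_norm norm_minus_commute)
    have "norm (y - x0) \<le> norm (x - x0) + norm (x - y)"
      using norm_triangle_ineq4[of "x - x0" "x - y"] by simp
    then have yin: "y \<in> ball x0 (2 * \<rho>)" using xy(2,3) by (simp add: dist_norm norm_minus_commute)
    define C where "C = ball (- ((x - y) /\<^sub>R 2)) (r * norm (x - y))"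
    \<comment> \<open>Here |z| lies between a/4 and 3a/4. The lower bound matters too:
      \<open>riesz s 0\<close> is 0 by division by zero.\<close>
    have kC: "a powr (- (N + 2 * s)) \<le> riesz s z" if "z \<in> C" for z
    proof -
      have d: "norm ((x - y) /\<^sub>R 2 + z) < r * a"
        using that by (simp add: C_def a_def dist_norm norm_minus_commute add.commute)
      have half: "norm ((x - y) /\<^sub>R 2) = a / 2" by (simp add: a_def)
      have ra: "r * a \<le> a / 4" using r a by simp
      have "norm z \<le> norm ((x - y) /\<^sub>R 2 + z) + norm ((x - y) /\<^sub>R 2)"
        using norm_triangle_ineq4[of "(x - y) /\<^sub>R 2 + z" "(x - y) /\<^sub>R 2"] by simp
      then have z1: "norm z \<le> a" using d ra a half by linarith
      have "norm ((x - y) /\<^sub>R 2) \<le> norm ((x - y) /\<^sub>R 2 + z) + norm z"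
        using norm_triangle_ineq4[of "(x - y) /\<^sub>R 2 + z" z] by simp
      then have z2: "norm z > 0" using d ra a half by linarith
      have "norm z powr (N + 2 * s) \<le> a powr (N + 2 * s)"
        using z1 z2 s by (intro powr_mono2) (auto simp: N_def)
      then show ?thesis
        using z2 a by (simp add: riesz_def N_def powr_minus_divide frac_le del: minus_add_distrib)
    qed
    have Cm: "emeasure lborel C = ennreal (U * (r * a) powr N)"
      using r a by (simp add: C_def a_def[symmetric] emeasure_ball U_def N_def powr_realpow)
    then have mC: "measure lborel C = U * (r * a) powr N" using U by (simp add: measure_def)
    have IC: "integrable lborel (\<lambda>z. indicator C z * (a powr (- (N + 2 * s))))"
      using Cm by (intro integrable_mult_left integrable_real_indicator) (auto simp: C_def)
    define T where "T = 2 * K * (1 + \<rho>)"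
    have T0: "T \<ge> 0" using K \<rho> by (simp add: T_def)
    have pw: "second_diff u x z * riesz s z - second_diff u y z * riesz s z
       \<le> T * (min (norm z) 1 * riesz s z) - \<kappa> * L * a powr s * (indicator C z * (a powr (- (N + 2 * s))))" for z
    proof -
      have "second_diff u x z - second_diff u y z \<le> T * min (norm z) 1 - \<kappa> * L * a powr s * indicator C z"
        using doubling_estimate[OF s(1) r(1,2) \<kappa>_def \<rho> K less_imp_le[OF L] \<Phi>_def max, of z]
        by (simp add: second_diff_def T_def a_def C_def)
      then have "(second_diff u x z - second_diff u y z) * riesz s z \<le> (T * min (norm z) 1 - \<kappa> * L * a powr s * indicator C z) * riesz s z"
        by (intro mult_right_mono) auto
      also have "\<dots> = T * (min (norm z) 1 * riesz s z) - \<kappa> * L * a powr s * (indicator C z * riesz s z)"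
        by (simp add: algebra_simps)
      also have "\<dots> \<le> T * (min (norm z) 1 * riesz s z) - \<kappa> * L * a powr s * (indicator C z * (a powr (- (N + 2 * s))))"
        using kC[of z] \<kappa> L by (cases "z \<in> C") (auto intro!: diff_left_mono mult_left_mono)
      finally show ?thesis by (simp add: algebra_simps)
    qed
    have "- (2 * H) \<le> (\<integral> z. second_diff u x z * riesz s z \<partial>lborel) - (\<integral> z. second_diff u y z * riesz s z \<partial>lborel)"
      using est[OF xin] est[OF yin] by linarith
    also have "\<dots> = (\<integral> z. second_diff u x z * riesz s z - second_diff u y z * riesz s z \<partial>lborel)"
      using int[OF xin] int[OF yin] by simp
    also have "\<dots> \<le> (\<integral> z. T * (min (norm z) 1 * riesz s z) - \<kappa> * L * a powr s * (indicator C z * (a powr (- (N + 2 * s)))) \<partial>lborel)"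
      using int[OF xin] int[OF yin] IC riesz_min1_integrable[OF s, where 'a='a] pw
      by (intro integral_mono) auto
    also have "\<dots> = T * J - \<kappa> * L * a powr s * (U * (r * a) powr N * a powr (- (N + 2 * s)))"
      using IC riesz_min1_integrable[OF s, where 'a='a] by (simp add: J_def mC)
    finally have fin: "\<kappa> * L * a powr s * (U * (r * a) powr N * a powr (- (N + 2 * s))) \<le> R"
      by (simp add: R_def T_def mult.assoc)
    have "a powr s * (a powr N * a powr (- (N + 2 * s))) = a powr (- s)"
      using a by (simp flip: powr_add)
    moreover have "\<kappa> * L * a powr s * (U * (r * a) powr N * a powr (- (N + 2 * s)))
        = \<kappa> * L * (U * r powr N * (a powr s * (a powr N * a powr (- (N + 2 * s)))))"
      using r a by (simp add: powr_mult)
    ultimately have "\<kappa> * L * (U * r powr N * a powr (- s)) \<le> R"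
      using fin by metis
    then have "c * L * a powr (- s) \<le> R" by (simp add: c_def mult_ac)
    moreover have "c * L * \<rho> powr (- s) \<le> c * L * a powr (- s)"
      using a c L s by (intro mult_left_mono powr_mono2') auto
    ultimately show False using L3 by linarith
  qed
  show ?thesis using that[OF L] main by blast
qed

lemma interior_holder:
  assumes s: "0 < s" "s < 1/2" and \<rho>: "\<rho> > 0" and M: "M \<ge> 0" and H: "H \<ge> 0"
  obtains L where "L > 0" "\<And>(u::'a::euclidean_space \<Rightarrow> real) x0 y.
     continuous_on UNIV u \<Longrightarrow> (\<And>x. \<bar>u x\<bar> \<le> M) \<Longrightarrow>
     (\<And>x. x \<in> ball x0 (2 * \<rho>) \<Longrightarrow> integrable lborel (\<lambda>z. second_diff u x z * riesz s z)) \<Longrightarrow>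
     (\<And>x. x \<in> ball x0 (2 * \<rho>) \<Longrightarrow> \<bar>\<integral> z. second_diff u x z * riesz s z \<partial>lborel\<bar> \<le> H) \<Longrightarrow>
     \<bar>u x0 - u y\<bar> \<le> L * norm (x0 - y) powr s"
proof -
  obtain L where L: "L > 0" and one: "\<And>(u::'a \<Rightarrow> real) x0 y.
     continuous_on UNIV u \<Longrightarrow> (\<And>x. \<bar>u x\<bar> \<le> M) \<Longrightarrow>
     (\<And>x. x \<in> ball x0 (2 * \<rho>) \<Longrightarrow> integrable lborel (\<lambda>z. second_diff u x z * riesz s z)) \<Longrightarrow>
     (\<And>x. x \<in> ball x0 (2 * \<rho>) \<Longrightarrow> \<bar>\<integral> z. second_diff u x z * riesz s z \<partial>lborel\<bar> \<le> H) \<Longrightarrow>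
     u x0 - u y \<le> L * norm (x0 - y) powr s"
    using interior_holder_onesided[OF s \<rho> M H, where 'a='a] by blast
  show ?thesis
  proof (rule that[OF L])
    fix u :: "'a \<Rightarrow> real" and x0 y
    assume c: "continuous_on UNIV u" and b: "\<And>x. \<bar>u x\<bar> \<le> M"
      and i: "\<And>x. x \<in> ball x0 (2 * \<rho>) \<Longrightarrow> integrable lborel (\<lambda>z. second_diff u x z * riesz s z)"
      and e: "\<And>x. x \<in> ball x0 (2 * \<rho>) \<Longrightarrow> \<bar>\<integral> z. second_diff u x z * riesz s z \<partial>lborel\<bar> \<le> H"
    have neg: "second_diff (\<lambda>x. - u x) x z * riesz s z = - (second_diff u x z * riesz s z)" for x z
      by (simp add: second_diff_def algebra_simps)
    have "- u x0 - - u y \<le> L * norm (x0 - y) powr s"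
      by (rule one) (use c b i e in \<open>auto simp: neg intro: continuous_on_minus\<close>)
    moreover have "u x0 - u y \<le> L * norm (x0 - y) powr s"
      by (rule one[OF c b]) (use i e in auto)
    ultimately show "\<bar>u x0 - u y\<bar> \<le> L * norm (x0 - y) powr s"
      by linarith
  qed
qed

section \<open>Mollification\<close>

text \<open>The \<open>itself\<close> argument fixes the dimension, which the radius alone does not
  determine.\<close>

definition tent_mass :: "'a::euclidean_space itself \<Rightarrow> real \<Rightarrow> real" where
  "tent_mass _ d = (\<integral> z. max (d - norm (z::'a)) 0 \<partial>lborel)"

text \<open>A Lipschitz bump suffices as mollifier: since 2s < 1, Lipschitz functions of compact
  support are admissible test functions.\<close>

definition tent :: "real \<Rightarrow> 'a::euclidean_space \<Rightarrow> real" where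
  "tent d z = max (d - norm z) 0 / tent_mass TYPE('a) d"

definition mollify :: "real \<Rightarrow> ('a::euclidean_space \<Rightarrow> real) \<Rightarrow> 'a \<Rightarrow> real" where
  "mollify d v x = (\<integral> y. v y * tent d (x - y) \<partial>lborel)"

lemma tent_integrand_integrable: "integrable lborel (\<lambda>z::'a::euclidean_space. max (d - norm z) 0)"
proof (rule Bochner_Integration.integrable_bound)
  show "integrable lborel (\<lambda>z::'a. \<bar>d\<bar> * indicator (ball 0 d) z)"
    using emeasure_bounded_finite[of "ball (0::'a) d"]
    by (intro integrable_mult_right integrable_real_indicator) (auto simp: less_top)
  show "AE z in lborel. norm (max (d - norm z) 0) \<le> norm (\<bar>d\<bar> * indicator (ball (0::'a) d) z)"
  proof (intro AE_I2)
    fix z :: 'a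
    show "norm (max (d - norm z) 0) \<le> norm (\<bar>d\<bar> * indicator (ball (0::'a) d) z)"
    proof -
      have "d - norm z \<le> \<bar>d\<bar>" using norm_ge_zero[of z] by linarith
      then show ?thesis by (cases "norm z < d") (simp_all add: indicator_def)
    qed
  qed
qed simp

text \<open>Half the radius costs half the height: on the ball of radius d/2 the unnormalised bump
  is at least d/2.\<close>

lemma tent_mass_ge:
  assumes d: "d > 0"
  shows "tent_mass TYPE('a::euclidean_space) d \<ge> d / 2 * (unit_ball_vol (real DIM('a)) * (d / 2) ^ DIM('a))"
proof -
  have m: "measure lborel (ball (0::'a) (d / 2)) = unit_ball_vol (real DIM('a)) * (d / 2) ^ DIM('a)"
    using d content_ball[of "d / 2" "0::'a"] by simp
  have "d / 2 * measure lborel (ball (0::'a) (d / 2)) = (\<integral> z. d / 2 * indicator (ball (0::'a) (d / 2)) z \<partial>lborel)"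
    by simp
  also have "\<dots> \<le> tent_mass TYPE('a) d"
    unfolding tent_mass_def
    using emeasure_bounded_finite[of "ball (0::'a) (d / 2)"]
    by (intro integral_mono tent_integrand_integrable integrable_mult_right integrable_real_indicator)
       (auto simp: indicator_def less_top max_def)
  finally show ?thesis by (simp add: m)
qed

lemma tent_mass_pos: "d > 0 \<Longrightarrow> tent_mass TYPE('a::euclidean_space) d > 0"
  by (rule less_le_trans[OF _ tent_mass_ge]) auto

lemma tent_measurable [measurable]: "tent d \<in> borel_measurable borel"
  unfolding tent_def[abs_def] by measurable

lemma tent_integrable [simp]: "integrable lborel (tent d :: 'a::euclidean_space \<Rightarrow> real)"
  unfolding tent_def[abs_def] by (intro integrable_divide tent_integrand_integrable)

lemma tent_integral: "d > 0 \<Longrightarrow> (\<integral> z. tent d (z::'a::euclidean_space) \<partial>lborel) = 1"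
  unfolding tent_def using tent_mass_pos[of d, where 'a='a] by (simp add: tent_mass_def)

lemma tent_nonneg: "d > 0 \<Longrightarrow> tent d (z::'a::euclidean_space) \<ge> 0"
  unfolding tent_def using tent_mass_pos[of d, where 'a='a] by simp

lemma tent_zero: "norm z \<ge> d \<Longrightarrow> tent d z = 0"
  by (simp add: tent_def)

lemma tent_le: "d > 0 \<Longrightarrow> tent d (z::'a::euclidean_space) \<le> d / tent_mass TYPE('a) d"
  unfolding tent_def using tent_mass_pos[of d, where 'a='a] by (intro divide_right_mono) auto

lemma tent_Lipschitz:
  assumes "d > 0"
  shows "\<bar>tent d z - tent d (w::'a::euclidean_space)\<bar> \<le> 1 / tent_mass TYPE('a) d * norm (z - w)"
proof -
  have m: "tent_mass TYPE('a) d > 0" using tent_mass_pos assms by blast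
  have "\<bar>max (d - norm z) 0 - max (d - norm w) 0\<bar> \<le> norm (z - w)"
    using norm_triangle_ineq3[of z w] by linarith
  moreover have "\<bar>tent d z - tent d w\<bar> = \<bar>max (d - norm z) 0 - max (d - norm w) 0\<bar> / tent_mass TYPE('a) d"
    using m by (simp add: tent_def diff_divide_distrib[symmetric])
  ultimately show ?thesis using m by (simp add: divide_right_mono)
qed

text \<open>The bump has height of order d^(-n) and lives where |z| < d, where the kernel exceeds
  d^(-n-2s). The origin is excluded because \<open>riesz\<close> takes the value 0 there.\<close>

lemma tent_le_riesz:
  assumes s: "s > 0"
  obtains C where "C > 0" "\<And>d z. d > 0 \<Longrightarrow> z \<noteq> (0::'a::euclidean_space) \<Longrightarrow> tent d z \<le> C * d powr (2 * s) * riesz s z"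
proof -
  define N where "N = real DIM('a)"
  define U where "U = unit_ball_vol N"
  have U: "U > 0" unfolding U_def N_def by simp
  define C where "C = 2 * 2 powr N / U"
  have "tent d z \<le> C * d powr (2 * s) * riesz s z" if d: "d > 0" and z: "z \<noteq> (0::'a)" for d z
  proof (cases "norm z < d")
    case True
    have m: "d / 2 * (U * (d / 2) powr N) \<le> tent_mass TYPE('a) d"
      using tent_mass_ge[OF d, where 'a='a] d by (simp add: U_def N_def powr_realpow)
    have "tent d z \<le> d / tent_mass TYPE('a) d" using tent_le[OF d] .
    also have "\<dots> \<le> d / (d / 2 * (U * (d / 2) powr N))"
      using m d U tent_mass_pos[OF d, where 'a='a] by (intro divide_left_mono mult_pos_pos) auto
    also have "\<dots> = C * d powr (- N)"
      using d U by (simp add: C_def powr_divide powr_minus field_simps)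
    also have "\<dots> = C * d powr (2 * s) * d powr (- (N + 2 * s))"
      by (simp add: mult.assoc flip: powr_add)
    also have "\<dots> \<le> C * d powr (2 * s) * riesz s z"
    proof (intro mult_left_mono)
      have "norm z powr (N + 2 * s) \<le> d powr (N + 2 * s)"
        using True s by (intro powr_mono2) (auto simp: N_def)
      then show "d powr (- (N + 2 * s)) \<le> riesz s z"
        using z d by (simp add: riesz_def N_def powr_minus_divide frac_le del: minus_add_distrib)
    qed (use U in \<open>auto simp: C_def\<close>)
    finally show ?thesis .
  next
    case False
    then show ?thesis using U by (simp add: tent_zero C_def)
  qed
  moreover have "C > 0" using U by (simp add: C_def)
  ultimately show ?thesis using that by blast
qed

lemma bounded_times_tent_integrable:
  fixes v :: "'a::euclidean_space \<Rightarrow> real"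
  assumes [measurable]: "v \<in> borel_measurable borel" and b: "\<And>x. \<bar>v x\<bar> \<le> M"
  shows "integrable lborel (\<lambda>y. v y * tent d (x - y))"
proof (rule Bochner_Integration.integrable_bound)
  show "integrable lborel (\<lambda>y. M * tent d (x - y))"
    by (intro integrable_mult_right) (subst integrable_reflect, auto)
  show "AE y in lborel. norm (v y * tent d (x - y)) \<le> norm (M * tent d (x - y))"
    using b by (intro AE_I2) (auto simp: abs_mult intro!: mult_right_mono order_trans[OF b abs_ge_self])
qed simp

lemma mollify_bounded:
  fixes v :: "'a::euclidean_space \<Rightarrow> real"
  assumes d: "d > 0" and [measurable]: "v \<in> borel_measurable borel" and b: "\<And>x. \<bar>v x\<bar> \<le> M"
  shows "\<bar>mollify d v x\<bar> \<le> M"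
proof -
  have "\<bar>mollify d v x\<bar> \<le> (\<integral> y. \<bar>v y * tent d (x - y)\<bar> \<partial>lborel)"
    unfolding mollify_def by (rule integral_abs_bound)
  also have "\<dots> \<le> (\<integral> y. M * tent d (x - y) \<partial>lborel)"
  proof (rule integral_mono)
    show "integrable lborel (\<lambda>y. \<bar>v y * tent d (x - y)\<bar>)"
      by (intro integrable_abs bounded_times_tent_integrable[OF _ b]) simp
    show "integrable lborel (\<lambda>y. M * tent d (x - y))"
      by (intro integrable_mult_right) (subst integrable_reflect, auto)
    show "\<bar>v y * tent d (x - y)\<bar> \<le> M * tent d (x - y)" for y
      using b[of y] tent_nonneg[OF d, of "x - y"] by (simp add: abs_mult mult_right_mono)
  qed
  also have "\<dots> = M" using tent_integral[OF d, where 'a='a] by (simp add: integral_reflect)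
  finally show ?thesis .
qed

text \<open>Boundedness of \<open>v\<close> is enough: two translated bumps differ by a Lipschitz
  amount and only on the union of two balls of radius d.\<close>

lemma mollify_continuous:
  fixes v :: "'a::euclidean_space \<Rightarrow> real"
  assumes d: "d > 0" and [measurable]: "v \<in> borel_measurable borel" and b: "\<And>x. \<bar>v x\<bar> \<le> M"
  shows "continuous_on UNIV (mollify d v)"
proof -
  define V where "V = measure lborel (ball (0::'a) d)"
  define \<Lambda> where "\<Lambda> = 1 / tent_mass TYPE('a) d"
  have \<Lambda>: "\<Lambda> > 0" using tent_mass_pos[OF d] by (simp add: \<Lambda>_def)
  have M0: "M \<ge> 0" using b[of 0] by linarith
  have V: "measure lborel (ball x d) = V" for x :: 'a
    using content_ball[of d x] content_ball[of d "0::'a"] d by (simp add: V_def)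
  have "\<bar>mollify d v x - mollify d v x'\<bar> \<le> (2 * M * \<Lambda> * V) * dist x x'" for x x'
  proof -
    note I = bounded_times_tent_integrable[OF \<open>v \<in> borel_measurable borel\<close> b]
    have Ib: "integrable lborel (\<lambda>y. M * (\<Lambda> * norm (x - x')) * (indicator (ball x d) y + indicator (ball x' d) y))"
      using emeasure_bounded_finite[of "ball x d"] emeasure_bounded_finite[of "ball x' d"]
      by (intro integrable_mult_right Bochner_Integration.integrable_add integrable_real_indicator) (auto simp: less_top)
    have "\<bar>mollify d v x - mollify d v x'\<bar> = \<bar>\<integral> y. v y * tent d (x - y) - v y * tent d (x' - y) \<partial>lborel\<bar>"
      unfolding mollify_def using I by simp
    also have "\<dots> \<le> (\<integral> y. \<bar>v y * tent d (x - y) - v y * tent d (x' - y)\<bar> \<partial>lborel)"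
      by (rule integral_abs_bound)
    also have "\<dots> \<le> (\<integral> y. M * (\<Lambda> * norm (x - x')) * (indicator (ball x d) y + indicator (ball x' d) y) \<partial>lborel)"
    proof (rule integral_mono[OF _ Ib])
      show "integrable lborel (\<lambda>y. \<bar>v y * tent d (x - y) - v y * tent d (x' - y)\<bar>)"
        using I by (intro integrable_abs Bochner_Integration.integrable_diff)
      fix y
      have "\<bar>tent d (x - y) - tent d (x' - y)\<bar> \<le> \<Lambda> * norm (x - x') * (indicator (ball x d) y + indicator (ball x' d) y)"
      proof (cases "y \<in> ball x d \<or> y \<in> ball x' d")
        case True
        have "\<bar>tent d (x - y) - tent d (x' - y)\<bar> \<le> \<Lambda> * norm (x - x') * 1"
          using tent_Lipschitz[OF d, of "x - y" "x' - y"] by (simp add: \<Lambda>_def)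
        also have "\<dots> \<le> \<Lambda> * norm (x - x') * (indicator (ball x d) y + indicator (ball x' d) y)"
          using True \<Lambda> by (intro mult_left_mono) (auto simp: indicator_def)
        finally show ?thesis .
      next
        case False
        then have "tent d (x - y) = 0" "tent d (x' - y) = 0" by (auto intro!: tent_zero simp: dist_norm)
        then show ?thesis using \<Lambda> by simp
      qed
      then have "\<bar>v y\<bar> * \<bar>tent d (x - y) - tent d (x' - y)\<bar> \<le> M * (\<Lambda> * norm (x - x') * (indicator (ball x d) y + indicator (ball x' d) y))"
        using b M0 by (intro mult_mono) auto
      then show "\<bar>v y * tent d (x - y) - v y * tent d (x' - y)\<bar> \<le> M * (\<Lambda> * norm (x - x')) * (indicator (ball x d) y + indicator (ball x' d) y)"
        by (simp add: abs_mult[symmetric] right_diff_distrib mult.assoc)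
    qed
    also have "\<dots> = M * (\<Lambda> * norm (x - x')) * (V + V)"
      using emeasure_bounded_finite[of "ball x d"] emeasure_bounded_finite[of "ball x' d"]
      by (subst integral_mult_right_zero, subst Bochner_Integration.integral_add) (auto simp: V less_top)
    finally show ?thesis by (simp add: dist_norm mult_ac)
  qed
  then have "(2 * M * \<Lambda> * V)-lipschitz_on UNIV (mollify d v)"
    using M0 \<Lambda> by (intro lipschitz_onI) (auto simp: dist_real_def V_def)
  then show ?thesis by (rule lipschitz_on_continuous_on)
qed

text \<open>Jensen and \<open>tent d z \<le> C d^(2s) riesz s z\<close>: the energy itself gives the rate of convergence.\<close>

lemma mollify_L2:
  assumes s: "s > 0"
  obtains C where "C > 0" "\<And>d v \<Omega> M. d > 0 \<Longrightarrow> v \<in> borel_measurable borel \<Longrightarrow> (\<Omega>::'a::euclidean_space set) \<in> sets borel \<Longrightarrow>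
     (\<And>x. \<bar>v x\<bar> \<le> M) \<Longrightarrow>
     (\<integral>\<^sup>+ x\<in>\<Omega>. ennreal ((mollify d v x - v x)\<^sup>2) \<partial>lborel) \<le> ennreal (C * d powr (2 * s)) * cyl_energy s \<Omega> v"
proof -
  obtain C where C: "C > 0" and ck: "\<And>d z. d > 0 \<Longrightarrow> z \<noteq> (0::'a) \<Longrightarrow> tent d z \<le> C * d powr (2 * s) * riesz s z"
    using tent_le_riesz[OF s, where 'a='a] by blast
  have "(\<integral>\<^sup>+ x\<in>\<Omega>. ennreal ((mollify d v x - v x)\<^sup>2) \<partial>lborel) \<le> ennreal (C * d powr (2 * s)) * cyl_energy s \<Omega> v"
    if d: "d > 0" and [measurable]: "v \<in> borel_measurable borel" "(\<Omega>::'a set) \<in> sets borel" and b: "\<And>x. \<bar>v x\<bar> \<le> M"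
    for d v \<Omega> M
  proof -
    have pw: "ennreal ((mollify d v x - v x)\<^sup>2) \<le> (\<integral>\<^sup>+ y. ennreal (C * d powr (2 * s)) * ennreal (gform s v v (x, y)) \<partial>lborel)" for x
    proof -
      define m where "m = mollify d v x - v x"
      have Ic: "integrable lborel (\<lambda>y. tent d (x - y))" by (subst integrable_reflect) auto
      have c1: "(\<integral> y. tent d (x - y) \<partial>lborel) = 1"
        using tent_integral[OF d, where 'a='a] by (simp add: integral_reflect)
      have Iv: "integrable lborel (\<lambda>y. (v y - v x) * tent d (x - y))"
      proof (intro bounded_times_tent_integrable[where M="M + M"])
        show "\<bar>v y - v x\<bar> \<le> M + M" for y using b[of x] b[of y] by linarith
      qed simp
      have mv: "(\<integral> y. (v y - v x) * tent d (x - y) \<partial>lborel) = m"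
        using Ic c1 bounded_times_tent_integrable[of v M d x, OF _ b]
        by (simp add: left_diff_distrib m_def mollify_def)
      have Iv2: "integrable lborel (\<lambda>y. (v y - v x)\<^sup>2 * tent d (x - y))"
      proof (intro bounded_times_tent_integrable[where M="(M + M)\<^sup>2"])
        fix y
        have "\<bar>v y - v x\<bar> \<le> M + M" using b[of x] b[of y] by linarith
        then show "\<bar>(v y - v x)\<^sup>2\<bar> \<le> (M + M)\<^sup>2" using power_mono[of "\<bar>v y - v x\<bar>" "M + M" 2] by simp
      qed simp
      \<comment> \<open>Nonnegativity of the variance of v(y) - v(x) under the probability density
        \<open>tent d (x - y)\<close>, whose mean is m.\<close>
      have "0 \<le> (\<integral> y. (v y - v x - m)\<^sup>2 * tent d (x - y) \<partial>lborel)"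
        by (intro integral_nonneg_AE AE_I2 mult_nonneg_nonneg tent_nonneg d) auto
      also have "\<dots> = (\<integral> y. (v y - v x)\<^sup>2 * tent d (x - y) - 2 * m * ((v y - v x) * tent d (x - y)) + m\<^sup>2 * tent d (x - y) \<partial>lborel)"
        by (intro Bochner_Integration.integral_cong refl) (simp add: power2_eq_square algebra_simps)
      also have "\<dots> = (\<integral> y. (v y - v x)\<^sup>2 * tent d (x - y) \<partial>lborel) - m\<^sup>2"
        using Ic Iv Iv2 c1 mv by (simp add: power2_eq_square)
      finally have "m\<^sup>2 \<le> (\<integral> y. (v y - v x)\<^sup>2 * tent d (x - y) \<partial>lborel)" by simp
      then have "ennreal (m\<^sup>2) \<le> ennreal (\<integral> y. (v y - v x)\<^sup>2 * tent d (x - y) \<partial>lborel)" by (rule ennreal_leI)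
      also have "\<dots> = (\<integral>\<^sup>+ y. ennreal ((v y - v x)\<^sup>2 * tent d (x - y)) \<partial>lborel)"
        using Iv2 by (intro nn_integral_eq_integral[symmetric] AE_I2 mult_nonneg_nonneg tent_nonneg d) auto
      also have "\<dots> \<le> (\<integral>\<^sup>+ y. ennreal (C * d powr (2 * s)) * ennreal (gform s v v (x, y)) \<partial>lborel)"
      proof (rule nn_integral_mono)
        fix y
        have "(v y - v x)\<^sup>2 * tent d (x - y) \<le> (v y - v x)\<^sup>2 * (C * d powr (2 * s) * riesz s (x - y))"
        proof (cases "x = y")
          case False
          then show ?thesis using ck[OF d, of "x - y"] by (intro mult_left_mono) auto
        qed simp
        also have "\<dots> = (C * d powr (2 * s)) * gform s v v (x, y)"
          by (simp add: gform_def power2_eq_square algebra_simps)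
        finally show "ennreal ((v y - v x)\<^sup>2 * tent d (x - y)) \<le> ennreal (C * d powr (2 * s)) * ennreal (gform s v v (x, y))"
          using C by (simp add: ennreal_mult[symmetric] ennreal_leI)
      qed
      finally show ?thesis by (simp add: m_def)
    qed
    have "(\<integral>\<^sup>+ x\<in>\<Omega>. ennreal ((mollify d v x - v x)\<^sup>2) \<partial>lborel)
      \<le> (\<integral>\<^sup>+ x\<in>\<Omega>. (\<integral>\<^sup>+ y. ennreal (C * d powr (2 * s)) * ennreal (gform s v v (x, y)) \<partial>lborel) \<partial>lborel)"
      by (intro nn_integral_mono mult_right_mono pw) auto
    also have "\<dots> = (\<integral>\<^sup>+ x. \<integral>\<^sup>+ y. ennreal (C * d powr (2 * s)) * (indicator (\<Omega> \<times> UNIV) (x, y) * ennreal (gform s v v (x, y))) \<partial>lborel \<partial>lborel)"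
      by (intro nn_integral_cong) (auto simp: indicator_def)
    also have "\<dots> = (\<integral>\<^sup>+ z. ennreal (C * d powr (2 * s)) * (indicator (\<Omega> \<times> UNIV) z * ennreal (gform s v v z)) \<partial>(lborel \<Otimes>\<^sub>M lborel))"
      by (rule lborel.nn_integral_fst) simp
    also have "\<dots> = ennreal (C * d powr (2 * s)) * cyl_energy s \<Omega> v"
      unfolding cyl_energy_def by (rule nn_integral_cmult) simp
    finally show ?thesis .
  qed
  then show ?thesis using that C by blast
qed

section \<open>Interior regularity\<close>

text \<open>Nonempty open sets have positive measure; this is how almost everywhere information
  reaches continuous functions.\<close>

lemma AE_ex_in_open:
  fixes S :: "'a::euclidean_space set"
  assumes ae: "AE x in lborel. P x" and S: "open S" "x \<in> S"
  obtains y where "y \<in> S" "P y"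
proof -
  obtain e where e: "e > 0" "ball x e \<subseteq> S" using S open_contains_ball by blast
  obtain N where N: "{x \<in> space lborel. \<not> P x} \<subseteq> N" "N \<in> null_sets lborel"
    using ae by (elim AE_E) (auto simp: null_sets_def)
  have "\<not> ball x e \<subseteq> N"
  proof
    assume "ball x e \<subseteq> N"
    then have "emeasure lborel (ball x e) \<le> emeasure lborel N" using N by (intro emeasure_mono) auto
    then have "emeasure lborel (ball x e) = 0" using N by auto
    then show False using e unit_ball_vol_pos[of "real DIM('a)"] by (simp add: emeasure_ball)
  qed
  then show ?thesis using N e that by auto
qed

lemma Lp_on_bounded:
  fixes \<phi> :: "'a::euclidean_space \<Rightarrow> real"
  assumes [measurable]: "\<phi> \<in> borel_measurable borel" "\<Omega> \<in> sets borel" and bd: "bounded \<Omega>" and p: "p > 0"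
    and c: "AE x in lborel. x \<in> \<Omega> \<longrightarrow> \<bar>\<phi> x\<bar> \<le> c"
  shows "Lp_on p \<Omega> \<phi>"
proof -
  have "(\<integral>\<^sup>+ x\<in>\<Omega>. ennreal (\<bar>\<phi> x\<bar> powr p) \<partial>lborel) \<le> (\<integral>\<^sup>+ x\<in>\<Omega>. ennreal (c powr p) \<partial>lborel)"
    using c by (intro nn_integral_mono_AE, elim eventually_mono)
      (use p in \<open>auto simp: indicator_def intro!: ennreal_leI powr_mono2\<close>)
  also have "\<dots> = ennreal (c powr p) * emeasure lborel \<Omega>" by (simp add: nn_integral_cmult_indicator)
  also have "\<dots> < \<infinity>" using emeasure_bounded_finite[OF bd] by (simp add: ennreal_mult_less_top less_top)
  finally show ?thesis by (simp add: Lp_on_def)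
qed

lemma Lipschitz_bounded_min1:
  fixes \<phi> :: "'a::euclidean_space \<Rightarrow> real"
  assumes "\<bar>\<phi> x - \<phi> y\<bar> \<le> \<Lambda> * norm (x - y)" "\<bar>\<phi> x - \<phi> y\<bar> \<le> c" "\<Lambda> \<ge> 0" "c \<ge> 0"
  shows "\<bar>\<phi> x - \<phi> y\<bar> \<le> (\<Lambda> + c) * min (norm (x - y)) 1"
proof (cases "norm (x - y) \<le> 1")
  case True
  have "\<Lambda> * norm (x - y) \<le> (\<Lambda> + c) * norm (x - y)" using assms by (intro mult_right_mono) auto
  then show ?thesis using True assms by simp
next
  case False then show ?thesis using assms by simp
qed

text \<open>The test function is the bump centred at x0, supported in \<Omega> by the inclusion of
  the ball. After the substitution y = x + z and Fubini, the inner integral in x is a combination of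
  convolutions of \<open>v\<close> with translated bumps, hence a second difference of the
  mollification at x0.\<close>

lemma mollify_equation:
  fixes v F :: "'a::euclidean_space \<Rightarrow> real"
  assumes s: "0 < s" "s < 1/2" and p: "p > 0" and w: "weak_eq s p \<Omega> v F" and O: "open \<Omega>" "bounded \<Omega>"
    and b: "\<And>x. \<bar>v x\<bar> \<le> M" and F: "AE x in lborel. x \<in> \<Omega> \<longrightarrow> \<bar>F x\<bar> \<le> H"
    and d: "d > 0" and sub: "cball x0 d \<subseteq> \<Omega>"
  shows "integrable lborel (\<lambda>z. second_diff (mollify d v) x0 z * riesz s z)"
    and "\<bar>\<integral> z. second_diff (mollify d v) x0 z * riesz s z \<partial>lborel\<bar> \<le> 2 * H / gamma_ns DIM('a) s"
proof -
  let ?P = "lborel \<Otimes>\<^sub>M lborel :: ('a \<times> 'a) measure"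
  have [measurable]: "v \<in> borel_measurable borel" "\<Omega> \<in> sets borel" using w O by (auto simp: weak_eq_def)
  define \<phi> where "\<phi> y = tent d (x0 - y)" for y
  have [measurable]: "\<phi> \<in> borel_measurable borel" unfolding \<phi>_def[abs_def] by measurable
  define c where "c = d / tent_mass TYPE('a) d"
  define \<Lambda> where "\<Lambda> = 1 / tent_mass TYPE('a) d"
  have c: "c \<ge> 0" "\<Lambda> \<ge> 0" using d tent_mass_pos[OF d, where 'a='a] by (auto simp: c_def \<Lambda>_def)
  have \<phi>0: "0 \<le> \<phi> y" "\<phi> y \<le> c" for y
    unfolding \<phi>_def c_def using tent_nonneg[OF d] tent_le[OF d] by auto
  have z: "\<phi> y = 0" if "y \<notin> \<Omega>" for y
  proof -
    have "y \<notin> cball x0 d" using that sub by auto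
    then show ?thesis unfolding \<phi>_def by (intro tent_zero) (simp add: dist_norm)
  qed
  have Lip: "\<bar>\<phi> x - \<phi> y\<bar> \<le> (\<Lambda> + c) * min (norm (x - y)) 1" for x y
  proof (rule Lipschitz_bounded_min1)
    show "\<bar>\<phi> x - \<phi> y\<bar> \<le> \<Lambda> * norm (x - y)"
      using tent_Lipschitz[OF d, of "x0 - x" "x0 - y"] by (simp add: \<phi>_def \<Lambda>_def norm_minus_commute)
    show "\<bar>\<phi> x - \<phi> y\<bar> \<le> c" using \<phi>0[of x] \<phi>0[of y] by linarith
  qed (use c in auto)
  have H: "\<phi> \<in> Hs_full s"
  proof (rule Hs_full_of_cyl[where \<Omega>=\<Omega>])
    show "cyl_energy s \<Omega> \<phi> < \<infinity>" by (rule cyl_energy_Lipschitz[OF s _ _ O(2) Lip]) auto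
    have "(\<integral>\<^sup>+ x. ennreal ((\<phi> x)\<^sup>2) \<partial>lborel) \<le> (\<integral>\<^sup>+ x. ennreal (c\<^sup>2) * indicator \<Omega> x \<partial>lborel)"
      using \<phi>0 by (intro nn_integral_mono) (auto simp: indicator_def z intro!: ennreal_leI power_mono)
    also have "\<dots> = ennreal (c\<^sup>2) * emeasure lborel \<Omega>" by (simp add: nn_integral_cmult_indicator)
    also have "\<dots> < \<infinity>" using emeasure_bounded_finite[OF O(2)] by (simp add: ennreal_mult_less_top less_top)
    finally show "(\<integral>\<^sup>+ x. ennreal ((\<phi> x)\<^sup>2) \<partial>lborel) < \<infinity>" .
  qed (use z in auto)
  have Lp: "Lp_on p \<Omega> \<phi>"
    using \<phi>0 by (intro Lp_on_bounded[where c=c] O p AE_I2) auto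
  define g where "g = gamma_ns DIM('a) s"
  have g: "g > 0" unfolding g_def using gamma_ns_pos s by blast
  have eq: "integrable lborel (\<lambda>x. F x * \<phi> x)" "g / 2 * (\<integral> z. gform s v \<phi> z \<partial>?P) = (\<integral> x. F x * \<phi> x \<partial>lborel)"
    using w H z Lp unfolding weak_eq_def g_def by blast+
  have Gi: "integrable ?P (gform s v \<phi>)"
    by (rule gform_integrable[OF _ _ _ H z]) (use w in \<open>auto simp: weak_eq_def\<close>)
  \<comment> \<open>Sheared coordinates: the second variable becomes the displacement, so the kernel
    depends on it alone.\<close>
  define G where "G z = gform s v \<phi> (fst z, fst z + snd z)" for z
  have [measurable]: "G \<in> borel_measurable ?P" unfolding G_def[abs_def] gform_def by measurable
  have inner_m: "(\<lambda>y. gform s v \<phi> (x, y)) \<in> borel_measurable borel" for x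
    unfolding gform_def fst_conv snd_conv by measurable
  have GI: "integrable ?P G"
  proof (rule integrableI_bounded)
    have "(\<integral>\<^sup>+ z. ennreal (norm (G z)) \<partial>?P) = (\<integral>\<^sup>+ x. \<integral>\<^sup>+ z. ennreal (norm (G (x, z))) \<partial>lborel \<partial>lborel)"
      by (subst lborel.nn_integral_fst[symmetric]) simp_all
    also have "\<dots> = (\<integral>\<^sup>+ x. \<integral>\<^sup>+ y. ennreal (norm (gform s v \<phi> (x, y))) \<partial>lborel \<partial>lborel)"
    proof (rule nn_integral_cong)
      fix x :: 'a
      show "(\<integral>\<^sup>+ z. ennreal (norm (G (x, z))) \<partial>lborel) = (\<integral>\<^sup>+ y. ennreal (norm (gform s v \<phi> (x, y))) \<partial>lborel)"
        unfolding G_def using nn_integral_shift[of "\<lambda>y. ennreal (norm (gform s v \<phi> (x, y)))" x] inner_m[of x] by simp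
    qed
    also have "\<dots> = (\<integral>\<^sup>+ z. ennreal (norm (gform s v \<phi> z)) \<partial>?P)"
      by (subst lborel.nn_integral_fst[symmetric]) simp_all
    also have "\<dots> < \<infinity>" using Gi by (simp add: integrable_iff_bounded)
    finally show "(\<integral>\<^sup>+ z. ennreal (norm (G z)) \<partial>?P) < \<infinity>" .
  qed simp
  have "integral\<^sup>L ?P (gform s v \<phi>) = (\<integral> x. \<integral> y. gform s v \<phi> (x, y) \<partial>lborel \<partial>lborel)"
    using lborel_pair.integral_fst'[OF Gi] by simp
  also have "\<dots> = (\<integral> x. \<integral> z. G (x, z) \<partial>lborel \<partial>lborel)"
    unfolding G_def using integral_shift[OF inner_m] by simp
  also have "\<dots> = integral\<^sup>L ?P G" using lborel_pair.integral_fst'[OF GI] by simp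
  also have "\<dots> = (\<integral> z. \<integral> x. G (x, z) \<partial>lborel \<partial>lborel)"
    using lborel_pair.integral_snd[of "\<lambda>x z. G (x, z)"] GI by simp
  finally have GG: "integral\<^sup>L ?P (gform s v \<phi>) = (\<integral> z. \<integral> x. G (x, z) \<partial>lborel \<partial>lborel)" .
  have GI2: "integrable lborel (\<lambda>z. \<integral> x. G (x, z) \<partial>lborel)"
    using lborel_pair.integrable_snd[of "\<lambda>x z. G (x, z)"] GI by simp
  \<comment> \<open>Of the four products, the two with equal arguments each integrate to the
    mollification at x0, the two mixed ones to its values at x0 - z and x0 + z.\<close>
  have inner: "(\<integral> x. G (x, z) \<partial>lborel) = - (second_diff (mollify d v) x0 z * riesz s z)" for z
  proof -
    note I = bounded_times_tent_integrable[OF \<open>v \<in> borel_measurable borel\<close> b]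
    have e1: "(\<lambda>x. v x * \<phi> x) = (\<lambda>x. v x * tent d (x0 - x))" by (simp add: \<phi>_def)
    have i1: "integrable lborel (\<lambda>x. v x * \<phi> x)" "(\<integral> x. v x * \<phi> x \<partial>lborel) = mollify d v x0"
      using I[of d x0] unfolding e1 mollify_def by simp_all
    have i2: "integrable lborel (\<lambda>x. v (z + x) * \<phi> (z + x))" "(\<integral> x. v (z + x) * \<phi> (z + x) \<partial>lborel) = mollify d v x0"
      using i1 integrable_shift[of "\<lambda>x. v x * \<phi> x" z] integral_shift[of "\<lambda>x. v x * \<phi> x" z] by simp_all
    have e3: "(\<lambda>x. v x * \<phi> (z + x)) = (\<lambda>x. v x * tent d ((x0 - z) - x))" by (simp add: \<phi>_def algebra_simps)
    have i3: "integrable lborel (\<lambda>x. v x * \<phi> (z + x))" "(\<integral> x. v x * \<phi> (z + x) \<partial>lborel) = mollify d v (x0 - z)"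
      using I[of d "x0 - z"] unfolding e3 mollify_def by simp_all
    have e4: "(\<lambda>x. v (z + x) * \<phi> x) = (\<lambda>x. (\<lambda>x'. v x' * tent d ((x0 + z) - x')) (z + x))"
      by (simp add: \<phi>_def algebra_simps)
    have i4: "integrable lborel (\<lambda>x. v (z + x) * \<phi> x)" "(\<integral> x. v (z + x) * \<phi> x \<partial>lborel) = mollify d v (x0 + z)"
      using I[of d "x0 + z"] integrable_shift[of "\<lambda>x'. v x' * tent d ((x0 + z) - x')" z]
        integral_shift[of "\<lambda>x'. v x' * tent d ((x0 + z) - x')" z] unfolding e4 mollify_def by simp_all
    have "(\<integral> x. G (x, z) \<partial>lborel) = (\<integral> x. (v x * \<phi> x + v (z + x) * \<phi> (z + x) - v x * \<phi> (z + x) - v (z + x) * \<phi> x) * riesz s z \<partial>lborel)"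
      by (intro Bochner_Integration.integral_cong refl) (simp add: G_def gform_def algebra_simps)
    also have "\<dots> = (mollify d v x0 + mollify d v x0 - mollify d v (x0 - z) - mollify d v (x0 + z)) * riesz s z"
      using i1 i2 i3 i4 by simp
    finally show ?thesis by (simp add: second_diff_def algebra_simps)
  qed
  show "integrable lborel (\<lambda>z. second_diff (mollify d v) x0 z * riesz s z)"
    using GI2 unfolding inner by simp
  have "g / 2 * \<bar>\<integral> z. second_diff (mollify d v) x0 z * riesz s z \<partial>lborel\<bar> = \<bar>\<integral> x. F x * \<phi> x \<partial>lborel\<bar>"
    using eq(2)[symmetric] g unfolding GG inner by (simp add: abs_mult)
  also have "\<dots> \<le> (\<integral> x. \<bar>F x * \<phi> x\<bar> \<partial>lborel)" by (rule integral_abs_bound)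
  also have "\<dots> \<le> (\<integral> x. H * \<phi> x \<partial>lborel)"
  proof (rule integral_mono_AE)
    show "integrable lborel (\<lambda>x. \<bar>F x * \<phi> x\<bar>)" using eq(1) by simp
    show "integrable lborel (\<lambda>x. H * \<phi> x)"
      unfolding \<phi>_def by (intro integrable_mult_right) (subst integrable_reflect, auto)
    show "AE x in lborel. \<bar>F x * \<phi> x\<bar> \<le> H * \<phi> x"
      using F
    proof eventually_elim
      case (elim x)
      show ?case
      proof (cases "x \<in> \<Omega>")
        case True then show ?thesis using elim \<phi>0[of x] by (simp add: abs_mult mult_right_mono)
      qed (simp add: z)
    qed
  qed
  also have "\<dots> = H"
    using tent_integral[OF d, where 'a='a] unfolding \<phi>_def by (simp add: integral_reflect)
  finally show "\<bar>\<integral> z. second_diff (mollify d v) x0 z * riesz s z \<partial>lborel\<bar> \<le> 2 * H / gamma_ns DIM('a) s"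
    using g by (simp add: g_def field_simps)
qed

text \<open>Equicontinuity upgrades the almost everywhere convergence of the mollifications to
  convergence at every point of \<Omega>, and the uniform Hoelder bounds pass to the limit, which is
  the desired representative.\<close>

lemma interior_regularity:
  fixes v F :: "'a::euclidean_space \<Rightarrow> real"
  assumes s: "0 < s" "s < 1/2" and p: "p > 0" and w: "weak_eq s p \<Omega> v F" and O: "open \<Omega>" "bounded \<Omega>"
    and b: "\<And>x. \<bar>v x\<bar> \<le> M" and F: "AE x in lborel. x \<in> \<Omega> \<longrightarrow> \<bar>F x\<bar> \<le> H"
  obtains u where "AE x in lborel. x \<in> \<Omega> \<longrightarrow> u x = v x" "holder_loc s \<Omega> u"
proof -
  have [measurable]: "v \<in> borel_measurable borel" "\<Omega> \<in> sets borel" using w O by (auto simp: weak_eq_def)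
  have M0: "M \<ge> 0" using b[of 0] by linarith
  have F': "AE x in lborel. x \<in> \<Omega> \<longrightarrow> \<bar>F x\<bar> \<le> \<bar>H\<bar>" using F by (rule eventually_mono) auto
  define H' where "H' = 2 * \<bar>H\<bar> / gamma_ns DIM('a) s"
  have H': "H' \<ge> 0" using gamma_ns_pos[OF s, of "DIM('a)"] by (simp add: H'_def)
  define d :: "nat \<Rightarrow> real" where "d j = (1/2) ^ j" for j
  have d: "d j > 0" for j by (simp add: d_def)
  define u where "u j = mollify (d j) v" for j
  have uc: "continuous_on UNIV (u j)" for j unfolding u_def by (rule mollify_continuous[OF d _ b]) simp
  have [measurable]: "u j \<in> borel_measurable borel" for j using uc borel_measurable_continuous_onI by blast
  have ub: "\<bar>u j x\<bar> \<le> M" for j x unfolding u_def by (rule mollify_bounded[OF d _ b]) simp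
  \<comment> \<open>The squared L^2 errors decay like 4^(-sj), so their sum over j is integrable;
    the terms tend to 0 almost everywhere without passing to a subsequence.\<close>
  have ae: "AE x in lborel. x \<in> \<Omega> \<longrightarrow> (\<lambda>j. u j x) \<longlonglongrightarrow> v x"
  proof -
    obtain C where C: "C > 0" and L2: "\<And>d v \<Omega> M. d > 0 \<Longrightarrow> v \<in> borel_measurable borel \<Longrightarrow> (\<Omega>::'a set) \<in> sets borel \<Longrightarrow>
     (\<And>x. \<bar>v x\<bar> \<le> M) \<Longrightarrow>
     (\<integral>\<^sup>+ x\<in>\<Omega>. ennreal ((mollify d v x - v x)\<^sup>2) \<partial>lborel) \<le> ennreal (C * d powr (2 * s)) * cyl_energy s \<Omega> v"
      using mollify_L2[OF s(1), where 'a='a] by blast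
    obtain E where E: "cyl_energy s \<Omega> v = ennreal E" "E \<ge> 0"
      using w by (cases "cyl_energy s \<Omega> v") (auto simp: weak_eq_def)
    have dp: "d j powr (2 * s) = (2 powr (- 2 * s)) ^ j" for j
    proof -
      have "d j = 2 powr (- real j)" by (simp add: d_def powr_minus powr_realpow power_one_over inverse_eq_divide)
      then show ?thesis by (simp only: powr_powr powr_power) (simp add: mult_ac)
    qed
    have fin: "(\<Sum>j. \<integral>\<^sup>+ x\<in>\<Omega>. ennreal ((u j x - v x)\<^sup>2) \<partial>lborel) < \<infinity>"
    proof (rule suminf_geometric_ennreal_finite[of "2 powr (- 2 * s)" "C * E"])
      fix j
      show "(\<integral>\<^sup>+ x\<in>\<Omega>. ennreal ((u j x - v x)\<^sup>2) \<partial>lborel) \<le> ennreal (C * E * (2 powr (- 2 * s)) ^ j)"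
      proof -
        have "(\<integral>\<^sup>+ x\<in>\<Omega>. ennreal ((u j x - v x)\<^sup>2) \<partial>lborel) \<le> ennreal (C * d j powr (2 * s)) * cyl_energy s \<Omega> v"
          unfolding u_def by (rule L2[OF d _ _ b]) auto
        also have "\<dots> = ennreal (C * E * (2 powr (- 2 * s)) ^ j)"
          unfolding dp E(1) using C E by (simp add: ennreal_mult[symmetric] mult_ac)
        finally show ?thesis .
      qed
    qed (use s C E in \<open>auto intro: powr_less_one\<close>)
    have "(\<integral>\<^sup>+ x. (\<Sum>j. ennreal ((u j x - v x)\<^sup>2) * indicator \<Omega> x) \<partial>lborel) < \<infinity>"
      using fin by (subst nn_integral_suminf) simp_all
    then have "AE x in lborel. (\<Sum>j. ennreal ((u j x - v x)\<^sup>2) * indicator \<Omega> x) \<noteq> \<infinity>"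
      by (intro nn_integral_PInf_AE) auto
    then show ?thesis
    proof (rule eventually_mono, intro impI)
      fix x assume h: "(\<Sum>j. ennreal ((u j x - v x)\<^sup>2) * indicator \<Omega> x) \<noteq> \<infinity>" "x \<in> \<Omega>"
      then have "summable (\<lambda>j. (u j x - v x)\<^sup>2)"
        by (intro summable_suminf_not_top) auto
      then have "(\<lambda>j. (u j x - v x)\<^sup>2) \<longlonglongrightarrow> 0" by (rule summable_LIMSEQ_zero)
      then have "(\<lambda>j. sqrt ((u j x - v x)\<^sup>2)) \<longlonglongrightarrow> sqrt 0" by (rule tendsto_real_sqrt)
      then have "(\<lambda>j. u j x - v x) \<longlonglongrightarrow> 0" by (simp add: tendsto_rabs_zero_iff)
      then show "(\<lambda>j. u j x) \<longlonglongrightarrow> v x" by (simp add: LIM_zero_iff)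
    qed
  qed
  have loc: "\<exists>L>0. \<exists>J. \<forall>j\<ge>J. \<forall>x\<in>K. \<forall>y. \<bar>u j x - u j y\<bar> \<le> L * norm (x - y) powr s" if K: "compact K" "K \<subseteq> \<Omega>" for K
  proof -
    obtain e where e: "e > 0" "(\<Union>x\<in>K. cball x e) \<subseteq> \<Omega>"
      using compact_subset_open_imp_cball_epsilon_subset[OF K(1) O(1) K(2)] by blast
    \<comment> \<open>Evaluation points range over radius 2\<rho> and the bump adds at most \<rho>,
      so everything stays within 3\<rho> < e of K.\<close>
    define \<rho> where "\<rho> = e / 4"
    have \<rho>: "\<rho> > 0" using e by (simp add: \<rho>_def)
    obtain L where L: "L > 0" and hold: "\<And>(u::'a \<Rightarrow> real) x0 y.
     continuous_on UNIV u \<Longrightarrow> (\<And>x. \<bar>u x\<bar> \<le> M) \<Longrightarrow>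
     (\<And>x. x \<in> ball x0 (2 * \<rho>) \<Longrightarrow> integrable lborel (\<lambda>z. second_diff u x z * riesz s z)) \<Longrightarrow>
     (\<And>x. x \<in> ball x0 (2 * \<rho>) \<Longrightarrow> \<bar>\<integral> z. second_diff u x z * riesz s z \<partial>lborel\<bar> \<le> H') \<Longrightarrow>
     \<bar>u x0 - u y\<bar> \<le> L * norm (x0 - y) powr s"
      using interior_holder[OF s \<rho> M0 H', where 'a='a] by blast
    obtain J where J: "d J < \<rho>" unfolding d_def using real_arch_pow_inv[OF \<rho>, of "1/2"] by auto
    have "\<bar>u j x0 - u j y\<bar> \<le> L * norm (x0 - y) powr s" if j: "j \<ge> J" and x0: "x0 \<in> K" for j x0 y
    proof (rule hold[OF uc ub])
      have "d j \<le> d J" unfolding d_def by (rule power_decreasing) (use j in auto)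
      then have dj: "d j \<le> \<rho>" using J by linarith
      fix x assume x: "x \<in> ball x0 (2 * \<rho>)"
      have "cball x (d j) \<subseteq> cball x0 e"
      proof
        fix y assume "y \<in> cball x (d j)"
        then show "y \<in> cball x0 e"
          using x dj \<rho> dist_triangle[of x0 y x] by (simp add: \<rho>_def)
      qed
      then have sub: "cball x (d j) \<subseteq> \<Omega>" using e x0 by blast
      show "integrable lborel (\<lambda>z. second_diff (u j) x z * riesz s z)" "\<bar>\<integral> z. second_diff (u j) x z * riesz s z \<partial>lborel\<bar> \<le> H'"
        unfolding u_def H'_def using mollify_equation[OF s p w O b F' d sub] by auto
    qed
    then show ?thesis using L by blast
  qed
  have conv: "convergent (\<lambda>j. u j x)" if x: "x \<in> \<Omega>" for x
  proof -
    obtain L J where L: "L > 0" and h: "\<And>j y. j \<ge> J \<Longrightarrow> \<bar>u j x - u j y\<bar> \<le> L * norm (x - y) powr s"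
      using loc[of "{x}"] x by auto
    have "Cauchy (\<lambda>j. u j x)"
    proof (rule metric_CauchyI)
      fix e :: real assume e: "e > 0"
      \<comment> \<open>S is open and nonempty, so it contains a point y of convergence; the uniform
        modulus transfers the Cauchy property from y to x at a cost of e/3 on either side.\<close>
      define S where "S = {y. L * norm (x - y) powr s < e / 3} \<inter> \<Omega>"
      have "open {y. L * norm (x - y) powr s < e / 3}"
        using s by (intro open_Collect_less continuous_intros continuous_on_powr') auto
      then have "open S" using O by (auto simp: S_def)
      moreover have "x \<in> S" using x e s by (simp add: S_def)
      ultimately obtain y where y: "y \<in> S" "y \<in> \<Omega> \<longrightarrow> (\<lambda>j. u j y) \<longlonglongrightarrow> v y"
        using AE_ex_in_open[OF ae] by blast
      then have "(\<lambda>j. u j y) \<longlonglongrightarrow> v y" by (simp add: S_def)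
      then have "Cauchy (\<lambda>j. u j y)" by (rule LIMSEQ_imp_Cauchy)
      then obtain N where N: "\<And>m n. m \<ge> N \<Longrightarrow> n \<ge> N \<Longrightarrow> dist (u m y) (u n y) < e / 3"
        using metric_CauchyD[of _ "e / 3"] e by (metis divide_pos_pos zero_less_numeral)
      show "\<exists>N. \<forall>m\<ge>N. \<forall>n\<ge>N. dist (u m x) (u n x) < e"
      proof (intro exI allI impI)
        fix m n assume mn: "m \<ge> max N J" "n \<ge> max N J"
        have y': "L * norm (x - y) powr s < e / 3" using y by (simp add: S_def)
        have "\<bar>u m x - u m y\<bar> < e / 3" "\<bar>u n x - u n y\<bar> < e / 3" "\<bar>u m y - u n y\<bar> < e / 3"
          using le_less_trans[OF h y'] N[of m n] mn by (auto simp: dist_real_def)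
        then show "dist (u m x) (u n x) < e"
          unfolding dist_real_def by linarith
      qed
    qed
    then show ?thesis by (rule Cauchy_convergent)
  qed
  define U where "U x = lim (\<lambda>j. u j x)" for x
  have lim: "(\<lambda>j. u j x) \<longlonglongrightarrow> U x" if "x \<in> \<Omega>" for x
    using conv[OF that] by (simp add: U_def convergent_LIMSEQ_iff)
  have ae': "AE x in lborel. x \<in> \<Omega> \<longrightarrow> U x = v x"
    using ae by (rule eventually_mono) (use lim LIMSEQ_unique in blast)
  have holdU: "\<exists>L>0. \<forall>x\<in>K. \<forall>y\<in>\<Omega>. \<bar>U x - U y\<bar> \<le> L * dist x y powr s" if K: "compact K" "K \<subseteq> \<Omega>" for K
  proof -
    obtain L J where L: "L > 0" and h: "\<And>j x y. j \<ge> J \<Longrightarrow> x \<in> K \<Longrightarrow> \<bar>u j x - u j y\<bar> \<le> L * norm (x - y) powr s"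
      using loc[OF K] by blast
    have "\<bar>U x - U y\<bar> \<le> L * dist x y powr s" if "x \<in> K" "y \<in> \<Omega>" for x y
    proof (rule LIMSEQ_le_const2)
      show "(\<lambda>j. \<bar>u j x - u j y\<bar>) \<longlonglongrightarrow> \<bar>U x - U y\<bar>"
        using that K by (intro tendsto_intros lim) auto
      show "\<exists>N. \<forall>n\<ge>N. \<bar>u n x - u n y\<bar> \<le> L * dist x y powr s"
        using h that by (auto simp: dist_norm)
    qed
    then show ?thesis using L by blast
  qed
  have "continuous_on \<Omega> U"
    unfolding continuous_on_def
  proof
    fix x assume x: "x \<in> \<Omega>"
    obtain L where L: "L > 0" "\<And>y. y \<in> \<Omega> \<Longrightarrow> \<bar>U x - U y\<bar> \<le> L * dist x y powr s"
      using holdU[of "{x}"] x by auto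
    have c: "continuous_on UNIV (\<lambda>y. L * dist x y powr s)"
      using s by (intro continuous_intros continuous_on_powr') auto
    have "((\<lambda>y. L * dist x y powr s) \<longlongrightarrow> 0) (at x within \<Omega>)"
      using c[unfolded continuous_on_def, rule_format, of x] s by (auto intro: tendsto_within_subset)
    then have "((\<lambda>y. U y - U x) \<longlongrightarrow> 0) (at x within \<Omega>)"
      by (rule Lim_null_comparison[rotated])
         (use L(2) in \<open>auto simp: eventually_at_filter abs_minus_commute intro!: always_eventually\<close>)
    then show "(U \<longlongrightarrow> U x) (at x within \<Omega>)" by (simp add: LIM_zero_iff)
  qed
  then have "holder_loc s \<Omega> U"
    unfolding holder_loc_def using holdU by (meson subsetD)
  then show ?thesis using that ae' by blast
qed

section \<open>Barriers\<close>

text \<open>Bernoulli's inequality, as weighted AM-GM for 1 + q and 1 with weights t and 1 -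
  t.\<close>

lemma one_plus_powr_le_linear:
  fixes q t :: real
  assumes "0 \<le> q" "0 < t" "t \<le> 1"
  shows "(1 + q) powr t \<le> 1 + t * q"
  using Youngs_inequality_0[of t "1 - t" "1 + q" 1] assms by (simp add: algebra_simps)

text \<open>The numbers 1/(1 + q) and q/(1 + q) add up to 1, and each is at most its own t-th
  power.\<close>

lemma one_plus_powr_le_powr:
  fixes q t :: real
  assumes q: "0 \<le> q" and t: "0 < t" "t \<le> 1"
  shows "(1 + q) powr t \<le> 1 + q powr t"
proof -
  have le: "x \<le> x powr t" if "0 \<le> x" "x \<le> 1" for x :: real
    using powr_mono'[of t 1 x] that t by (cases "x = 0") auto
  have "1 = 1 / (1 + q) + q / (1 + q)" using q by (simp add: add_divide_distrib[symmetric])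
  also have "\<dots> \<le> (1 / (1 + q)) powr t + (q / (1 + q)) powr t"
    using q by (intro add_mono le) auto
  also have "\<dots> = (1 + q powr t) / (1 + q) powr t"
    using q by (simp add: powr_divide add_divide_distrib)
  finally show ?thesis using q by (simp add: pos_le_divide_eq)
qed

text \<open>The factor t/s is the smallness that makes the barrier work, while the minimum is
  exactly the weight of \<open>riesz_moment\<close>. The bound with q^s is Bernoulli with exponent
  t/s applied to (1 + q)^s - 1.\<close>

lemma one_plus_powr_le_min:
  fixes q t s :: real
  assumes q: "0 \<le> q" and t: "0 < t" "t \<le> s" and s: "s \<le> 1"
  shows "(1 + q) powr t - 1 \<le> t / s * min q (q powr s)"
proof -
  have s0: "s > 0" using t by simp
  have "(1 + q) powr t - 1 \<le> t / s * q"
  proof -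
    have "t * q \<le> t / s * q" using q t s s0 by (intro mult_right_mono) (auto simp: field_simps)
    then show ?thesis using one_plus_powr_le_linear[of q t] assms by linarith
  qed
  moreover have "(1 + q) powr t - 1 \<le> t / s * q powr s"
  proof -
    define y where "y = (1 + q) powr s - 1"
    have y: "y \<ge> 0" using q s0 by (simp add: y_def ge_one_powr_ge_zero)
    have "(1 + q) powr t = (1 + y) powr (t / s)" using s0 by (simp add: y_def powr_powr)
    also have "\<dots> \<le> 1 + t / s * y"
      using y t s0 by (intro one_plus_powr_le_linear) (auto simp: field_simps)
    also have "\<dots> \<le> 1 + t / s * q powr s"
      using one_plus_powr_le_powr[OF q s0 s] t s0 by (intro add_left_mono mult_left_mono) (auto simp: y_def)
    finally show ?thesis by simp
  qed
  ultimately show ?thesis by (simp add: min_def)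
qed

text \<open>The linear cap near \<open>K\<close> and the constant cap far away make \<open>dist(y, K)^\<alpha>\<close> bounded and Lipschitz without changing it where \<open>\<eta> \<le> dist(y, K) \<le> R\<close>.\<close>

definition barrier :: "real \<Rightarrow> real \<Rightarrow> real \<Rightarrow> 'a::euclidean_space set \<Rightarrow> 'a \<Rightarrow> real" where
  "barrier \<alpha> \<eta> R K y = min (min (infdist y K powr \<alpha>) (\<eta> powr (\<alpha> - 1) * infdist y K)) (R powr \<alpha>)"

lemma barrier_bounds: "0 \<le> barrier \<alpha> \<eta> R K y" "barrier \<alpha> \<eta> R K y \<le> R powr \<alpha>" "barrier \<alpha> \<eta> R K y \<le> infdist y K powr \<alpha>"
  by (auto simp: barrier_def infdist_nonneg)

lemma barrier_zero: "y \<in> K \<Longrightarrow> barrier \<alpha> \<eta> R K y = 0"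
  by (simp add: barrier_def)

lemma barrier_eq:
  assumes "0 < \<eta>" "\<eta> \<le> infdist y K" "infdist y K \<le> R" "0 < \<alpha>" "\<alpha> \<le> 1"
  shows "barrier \<alpha> \<eta> R K y = infdist y K powr \<alpha>"
proof -
  define D where "D = infdist y K"
  have D: "D > 0" "\<eta> \<le> D" "D \<le> R" using assms by (auto simp: D_def)
  have "D powr \<alpha> = D powr (\<alpha> - 1) * D" using D by (simp add: powr_diff)
  also have "\<dots> \<le> \<eta> powr (\<alpha> - 1) * D" using D assms by (intro mult_right_mono powr_mono2') auto
  finally have "D powr \<alpha> \<le> \<eta> powr (\<alpha> - 1) * D" .
  moreover have "D powr \<alpha> \<le> R powr \<alpha>" using D assms by (intro powr_mono2) auto
  ultimately show ?thesis by (simp add: barrier_def D_def[symmetric])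
qed

text \<open>Where the power is the smaller branch at t, one has t^(\<alpha>-1) <
  \<eta>^(\<alpha>-1); Bernoulli then serves as the tangent line estimate of a concave
  function.\<close>

lemma min_powr_linear_Lipschitz:
  fixes \<eta> \<alpha> t t' :: real
  assumes \<eta>: "0 < \<eta>" and \<alpha>: "0 < \<alpha>" "\<alpha> \<le> 1" and t: "0 \<le> t" "t \<le> t'"
  shows "min (t' powr \<alpha>) (\<eta> powr (\<alpha> - 1) * t') - min (t powr \<alpha>) (\<eta> powr (\<alpha> - 1) * t) \<le> \<eta> powr (\<alpha> - 1) * (t' - t)"
proof (cases "min (t powr \<alpha>) (\<eta> powr (\<alpha> - 1) * t) = \<eta> powr (\<alpha> - 1) * t")
  case True
  then show ?thesis by (simp add: right_diff_distrib)
next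
  case False
  then have less: "t powr \<alpha> < \<eta> powr (\<alpha> - 1) * t" by (auto simp: min_def split: if_splits)
  then have t0: "t > 0" using t by (cases "t = 0") auto
  have "t powr (\<alpha> - 1) * t < \<eta> powr (\<alpha> - 1) * t" using less t0 by (simp add: powr_diff)
  then have le: "t powr (\<alpha> - 1) \<le> \<eta> powr (\<alpha> - 1)" using t0 by simp
  define q where "q = t' / t - 1"
  have q: "q \<ge> 0" using t t0 by (simp add: q_def)
  have "t' powr \<alpha> = t powr \<alpha> * (1 + q) powr \<alpha>" using t0 t by (simp add: q_def flip: powr_mult)
  also have "\<dots> \<le> t powr \<alpha> * (1 + \<alpha> * q)" using one_plus_powr_le_linear[OF q \<alpha>] by (intro mult_left_mono) auto
  also have "\<dots> = t powr \<alpha> + \<alpha> * (t powr (\<alpha> - 1) * (t' - t))"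
    using t0 by (simp add: q_def powr_diff field_simps)
  also have "\<dots> \<le> t powr \<alpha> + 1 * (\<eta> powr (\<alpha> - 1) * (t' - t))"
    using le t \<alpha> by (intro add_left_mono mult_mono mult_right_mono) auto
  finally have "t' powr \<alpha> - t powr \<alpha> \<le> \<eta> powr (\<alpha> - 1) * (t' - t)" by simp
  then show ?thesis using less by (simp add: min_def)
qed

lemma barrier_Lipschitz:
  fixes K :: "'a::euclidean_space set"
  assumes \<eta>: "0 < \<eta>" and \<alpha>: "0 < \<alpha>" "\<alpha> \<le> 1"
  shows "\<bar>barrier \<alpha> \<eta> R K x - barrier \<alpha> \<eta> R K y\<bar> \<le> (\<eta> powr (\<alpha> - 1) + R powr \<alpha>) * min (norm (x - y)) 1"
proof (rule Lipschitz_bounded_min1)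
  define h where "h t = min (t powr \<alpha>) (\<eta> powr (\<alpha> - 1) * t)" for t
  have mono: "h t \<le> h t'" if "0 \<le> t" "t \<le> t'" for t t'
    unfolding h_def using that \<alpha> by (intro min.mono powr_mono2 mult_left_mono) auto
  have one: "\<bar>h t' - h t\<bar> \<le> \<eta> powr (\<alpha> - 1) * \<bar>t' - t\<bar>" if "0 \<le> t" "t \<le> t'" for t t'
    using mono[OF that] min_powr_linear_Lipschitz[OF \<eta> \<alpha> that] that by (simp add: h_def)
  have both: "\<bar>h t' - h t\<bar> \<le> \<eta> powr (\<alpha> - 1) * \<bar>t' - t\<bar>" if "0 \<le> t" "0 \<le> t'" for t t'
    using one[of t t'] one[of t' t] that by (cases "t \<le> t'") (auto simp: abs_minus_commute)
  have "\<bar>barrier \<alpha> \<eta> R K x - barrier \<alpha> \<eta> R K y\<bar> \<le> \<bar>h (infdist x K) - h (infdist y K)\<bar>"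
    unfolding barrier_def h_def[symmetric] by linarith
  also have "\<dots> \<le> \<eta> powr (\<alpha> - 1) * \<bar>infdist x K - infdist y K\<bar>"
    by (intro both infdist_nonneg)
  also have "\<dots> \<le> \<eta> powr (\<alpha> - 1) * norm (x - y)"
    using infdist_triangle_abs[of x K y] by (intro mult_left_mono) (auto simp: dist_norm)
  finally show "\<bar>barrier \<alpha> \<eta> R K x - barrier \<alpha> \<eta> R K y\<bar> \<le> \<eta> powr (\<alpha> - 1) * norm (x - y)" .
  show "\<bar>barrier \<alpha> \<eta> R K x - barrier \<alpha> \<eta> R K y\<bar> \<le> R powr \<alpha>"
    using barrier_bounds[of \<alpha> \<eta> R K x] barrier_bounds[of \<alpha> \<eta> R K y] by linarith
qed auto

lemma barrier_measurable [measurable]: "barrier \<alpha> \<eta> R K \<in> borel_measurable borel"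
proof -
  have "continuous_on UNIV (\<lambda>y. infdist y K)" by (intro continuous_intros)
  then have [measurable]: "(\<lambda>y. infdist y K) \<in> borel_measurable borel" by (rule borel_measurable_continuous_onI)
  show ?thesis unfolding barrier_def[abs_def] by measurable
qed

text \<open>The ball is the image of \<open>cball p \<rho>\<close> under the homothety with centre y
  and ratio l, which maps the convex K into itself. It provides mass of K at every small scale next
  to any of its points.\<close>

lemma convex_inner_ball:
  fixes K :: "'a::euclidean_space set"
  assumes K: "convex K" "cball p \<rho> \<subseteq> K" "y \<in> K" and l: "0 < l" "l \<le> 1"
  shows "cball (y + l *\<^sub>R (p - y)) (l * \<rho>) \<subseteq> K"
proof
  fix z assume "z \<in> cball (y + l *\<^sub>R (p - y)) (l * \<rho>)"
  define w where "w = y + l *\<^sub>R (p - y) - z"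
  with \<open>z \<in> _\<close> have w: "norm w \<le> l * \<rho>" by (simp add: dist_norm)
  define q where "q = p - w /\<^sub>R l"
  have "norm (p - q) = norm w / l" using l by (simp add: q_def divide_inverse_commute)
  also have "\<dots> \<le> \<rho>" using w l by (simp add: pos_divide_le_eq mult.commute)
  finally have "q \<in> K" using K by (auto simp: dist_norm)
  then have "(1 - l) *\<^sub>R y + l *\<^sub>R q \<in> K" using K l by (intro convexD) auto
  also have "l *\<^sub>R q = l *\<^sub>R p - w" using l by (simp add: q_def scaleR_diff_right)
  also have "(1 - l) *\<^sub>R y + (l *\<^sub>R p - w) = z" by (simp add: w_def algebra_simps)
  finally show "z \<in> K" .
qed

text \<open>Write D for the distance from x to K. On K the barrier drops from D^\<alpha> to 0, and K
  contains a ball of size comparable to D within distance 3D, which gives at least c1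
  D^(\<alpha>-2s). Off K the barrier can exceed D^\<alpha>, but the total loss carries the factor
  \<alpha>/s. Neither \<alpha> nor c depends on K, p, \<eta> or x.\<close>

lemma barrier_supersolution:
  assumes s: "0 < s" "s < 1/2" and \<rho>: "0 < \<rho>" "\<rho> \<le> R"
  obtains \<alpha> c where "0 < \<alpha>" "\<alpha> \<le> s" "c > 0"
    "\<And>K (p::'a::euclidean_space) \<eta> x. compact K \<Longrightarrow> convex K \<Longrightarrow> cball p \<rho> \<subseteq> K \<Longrightarrow> K \<subseteq> cball p R \<Longrightarrow>
      0 < \<eta> \<Longrightarrow> \<eta> \<le> infdist x K \<Longrightarrow> infdist x K \<le> R \<Longrightarrow> c \<le> frac_lap s (barrier \<alpha> \<eta> R K) x"
proof -
  define N where "N = real DIM('a)"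
  define U where "U = unit_ball_vol N"
  have U: "U > 0" unfolding U_def N_def by simp
  obtain C where C: "C > 0" and mom: "\<And>D. D > 0 \<Longrightarrow>
    (\<integral>\<^sup>+ z. ennreal (min (norm z / D) ((norm z / D) powr s) * riesz s (z::'a)) \<partial>lborel) \<le> ennreal (C * D powr (- 2 * s))"
    using riesz_moment[OF s, where 'a='a] by blast
  define c1 where "c1 = U * (\<rho> / R) powr N * 3 powr (- (N + 2 * s))"
  have c1: "c1 > 0" using U \<rho> by (simp add: c1_def)
  \<comment> \<open>Chosen so that the loss (\<alpha>/s) C consumes at most half of the gain
    c1.\<close>
  define \<alpha> where "\<alpha> = min s (s * c1 / (2 * C))"
  have \<alpha>: "0 < \<alpha>" "\<alpha> \<le> s" using s c1 C by (auto simp: \<alpha>_def)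
  have \<alpha>C: "\<alpha> / s * C \<le> c1 / 2"
  proof -
    have "\<alpha> \<le> s * c1 / (2 * C)" by (simp add: \<alpha>_def)
    then show ?thesis using s C by (simp add: field_simps)
  qed
  \<comment> \<open>Since \<alpha> < 2s, the power D^(\<alpha>-2s) is smallest at the largest
    admissible distance D = R.\<close>
  define c where "c = R powr (\<alpha> - 2 * s) * (c1 / 2)"
  have c: "c > 0" using \<rho> c1 by (simp add: c_def)
  have "c \<le> frac_lap s (barrier \<alpha> \<eta> R K) x"
    if K: "compact K" "convex K" "cball p \<rho> \<subseteq> K" "K \<subseteq> cball p R"
      and \<eta>: "0 < \<eta>" "\<eta> \<le> infdist x K" "infdist x K \<le> R" for K :: "'a set" and p \<eta> x
  proof -
    let ?b = "barrier \<alpha> \<eta> R K"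
    define D where "D = infdist x K"
    have D: "0 < D" "D \<le> R" using \<eta> by (auto simp: D_def)
    have Kne: "K \<noteq> {}" using K(3) \<rho> by auto
    have [measurable]: "K \<in> sets borel" using borel_closed[OF compact_imp_closed[OF K(1)]] by simp
    have bx: "?b x = D powr \<alpha>" unfolding D_def using \<eta> \<alpha> s by (intro barrier_eq) auto
    have Ib: "integrable lborel (\<lambda>y. (?b x - ?b y) * riesz s (x - y))"
      using \<alpha> s by (intro frac_lap_integrable[OF s _ barrier_Lipschitz] \<eta>) auto
    define m where "m z = min (norm z / D) ((norm z / D) powr s) * riesz s z" for z :: 'a
    have m0: "m z \<ge> 0" for z using D by (simp add: m_def)
    have [measurable]: "m \<in> borel_measurable borel" unfolding m_def[abs_def] by measurable
    have Im: "integrable lborel m"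
    proof (rule integrableI_nonneg)
      show "(\<integral>\<^sup>+ z. ennreal (m z) \<partial>lborel) < \<infinity>"
        using mom[OF D(1)] unfolding m_def by (rule le_less_trans) simp
    qed (use m0 in auto)
    have m_le: "integral\<^sup>L lborel m \<le> C * D powr (- 2 * s)"
    proof -
      have "ennreal (integral\<^sup>L lborel m) = (\<integral>\<^sup>+ z. ennreal (m z) \<partial>lborel)"
        using m0 by (intro nn_integral_eq_integral[symmetric] Im) auto
      also have "\<dots> \<le> ennreal (C * D powr (- 2 * s))" using mom[OF D(1)] by (simp add: m_def)
      finally show ?thesis using C by (simp add: ennreal_le_iff)
    qed
    obtain y0 where y0: "y0 \<in> K" "D = dist x y0"
      using infdist_attains_inf[OF compact_imp_closed[OF K(1)] Kne, of x] unfolding D_def by blast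
    \<comment> \<open>With ratio D/R the ball B has radius D\<rho>/R \<le> D and its centre is
      within D of y0; adding |x - y0| = D gives the distance 3D.\<close>
    define l where "l = D / R"
    have l: "0 < l" "l \<le> 1" using D \<rho> by (auto simp: l_def)
    define B where "B = ball (y0 + l *\<^sub>R (p - y0)) (l * \<rho>)"
    have BK: "B \<subseteq> K" using convex_inner_ball[OF K(2,3) y0(1) l] ball_subset_cball unfolding B_def by blast
    have kB: "(3 * D) powr (- (N + 2 * s)) \<le> riesz s (x - y)" if "y \<in> B" for y
    proof -
      have "y \<in> K" using that BK by auto
      then have "D \<le> dist x y" unfolding D_def by (rule infdist_le)
      then have pos: "norm (x - y) > 0" using D(1) unfolding dist_norm by linarith
      have "norm (p - y0) \<le> R" using y0(1) K(4) by (auto simp: dist_norm)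
      then have "l * norm (p - y0) \<le> l * R" using l by (intro mult_left_mono) auto
      then have 1: "norm (l *\<^sub>R (p - y0)) \<le> D" using D \<rho> by (simp add: l_def)
      have 2: "norm (y0 + l *\<^sub>R (p - y0) - y) \<le> D"
      proof -
        have "norm (y0 + l *\<^sub>R (p - y0) - y) \<le> l * \<rho>" using that by (simp add: B_def dist_norm)
        also have "\<dots> \<le> l * R" using l \<rho> by (intro mult_left_mono) auto
        also have "\<dots> = D" using \<rho> by (simp add: l_def)
        finally show ?thesis .
      qed
      have "x - y = (x - y0) - l *\<^sub>R (p - y0) + (y0 + l *\<^sub>R (p - y0) - y)" by simp
      then have "norm (x - y) \<le> norm (x - y0) + norm (l *\<^sub>R (p - y0)) + norm (y0 + l *\<^sub>R (p - y0) - y)"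
        by (metis add_right_mono norm_triangle_ineq norm_triangle_ineq4 order_trans)
      then have "norm (x - y) \<le> 3 * D" using 1 2 y0(2) by (simp add: dist_norm)
      then have "norm (x - y) powr (N + 2 * s) \<le> (3 * D) powr (N + 2 * s)"
        using s by (intro powr_mono2) (auto simp: N_def)
      then show ?thesis
        using pos D by (simp add: riesz_def N_def powr_minus_divide frac_le del: minus_add_distrib)
    qed
    have Bm: "emeasure lborel B = ennreal (U * (l * \<rho>) powr N)"
      using l \<rho> by (simp add: B_def emeasure_ball U_def N_def powr_realpow)
    then have mB: "measure lborel B = U * (l * \<rho>) powr N" using U by (simp add: measure_def)
    have IB: "integrable lborel (\<lambda>y. D powr \<alpha> * ((3 * D) powr (- (N + 2 * s)) * indicator B y))"
      using Bm by (intro integrable_mult_right integrable_real_indicator) (auto simp: B_def)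
    have Imx: "integrable lborel (\<lambda>y. D powr \<alpha> * (\<alpha> / s * m (x - y)))"
      by (intro integrable_mult_right) (subst integrable_reflect, auto intro: Im)
    \<comment> \<open>On K only the part in B is kept; off K the triangle inequality bounds the
      barrier at y by (D + |x - y|)^\<alpha>.\<close>
    have pw: "D powr \<alpha> * ((3 * D) powr (- (N + 2 * s)) * indicator B y) - D powr \<alpha> * (\<alpha> / s * m (x - y))
        \<le> (?b x - ?b y) * riesz s (x - y)" for y
    proof (cases "y \<in> K")
      case True
      have "(3 * D) powr (- (N + 2 * s)) * indicator B y \<le> riesz s (x - y)"
        using kB[of y] by (cases "y \<in> B") auto
      then have "D powr \<alpha> * ((3 * D) powr (- (N + 2 * s)) * indicator B y) \<le> D powr \<alpha> * riesz s (x - y)"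
        by (intro mult_left_mono) auto
      moreover have "0 \<le> D powr \<alpha> * (\<alpha> / s * m (x - y))" using \<alpha> s m0 by simp
      ultimately show ?thesis using True by (simp add: bx barrier_zero)
    next
      case False
      define q where "q = norm (x - y) / D"
      have q: "q \<ge> 0" using D by (simp add: q_def)
      have "?b y \<le> infdist y K powr \<alpha>" by (rule barrier_bounds)
      also have "\<dots> \<le> (D * (1 + q)) powr \<alpha>"
        using infdist_triangle[of y K x] D \<alpha>
        by (intro powr_mono2) (auto simp: q_def D_def infdist_nonneg dist_norm norm_minus_commute distrib_left)
      also have "\<dots> = D powr \<alpha> * (1 + q) powr \<alpha>" using D q by (simp add: powr_mult)
      finally have "?b y - ?b x \<le> D powr \<alpha> * ((1 + q) powr \<alpha> - 1)" by (simp add: bx algebra_simps)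
      also have "\<dots> \<le> D powr \<alpha> * (\<alpha> / s * min q (q powr s))"
        using one_plus_powr_le_min[OF q \<alpha>] s by (intro mult_left_mono) auto
      finally have "(?b y - ?b x) * riesz s (x - y) \<le> D powr \<alpha> * (\<alpha> / s * min q (q powr s)) * riesz s (x - y)"
        by (intro mult_right_mono) auto
      then have "- (D powr \<alpha> * (\<alpha> / s * m (x - y))) \<le> (?b x - ?b y) * riesz s (x - y)"
        by (simp add: m_def q_def algebra_simps)
      moreover have "indicator B y = (0::real)" using False BK by (auto simp: indicator_def)
      ultimately show ?thesis by simp
    qed
    have "c \<le> D powr (\<alpha> - 2 * s) * (c1 / 2)"
      unfolding c_def using D \<alpha> s c1 by (intro mult_right_mono powr_mono2') auto
    also have "\<dots> \<le> D powr (\<alpha> - 2 * s) * (c1 - \<alpha> / s * C)"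
      using \<alpha>C by (intro mult_left_mono) auto
    also have "\<dots> = D powr \<alpha> * ((3 * D) powr (- (N + 2 * s)) * (U * (l * \<rho>) powr N)) - D powr \<alpha> * (\<alpha> / s * (C * D powr (- 2 * s)))"
    proof -
      have "(3 * D) powr (- (N + 2 * s)) * (U * (l * \<rho>) powr N) = U * (\<rho> / R) powr N * 3 powr (- (N + 2 * s)) * (D powr (- (N + 2 * s)) * D powr N)"
        using D \<rho> by (simp add: l_def powr_mult powr_divide)
      also have "D powr (- (N + 2 * s)) * D powr N = D powr (- 2 * s)" by (simp flip: powr_add)
      finally have e: "(3 * D) powr (- (N + 2 * s)) * (U * (l * \<rho>) powr N) = c1 * D powr (- 2 * s)"
        by (simp add: c1_def)
      have "D powr (\<alpha> - 2 * s) = D powr \<alpha> * D powr (- 2 * s)" by (simp flip: powr_add)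
      then show ?thesis unfolding e by (simp add: algebra_simps)
    qed
    also have "\<dots> \<le> D powr \<alpha> * ((3 * D) powr (- (N + 2 * s)) * measure lborel B) - D powr \<alpha> * (\<alpha> / s * integral\<^sup>L lborel m)"
      unfolding mB using m_le \<alpha> s by (intro diff_left_mono mult_left_mono) auto
    also have "\<dots> = (\<integral> y. D powr \<alpha> * ((3 * D) powr (- (N + 2 * s)) * indicator B y) - D powr \<alpha> * (\<alpha> / s * m (x - y)) \<partial>lborel)"
      using IB Imx integral_reflect[of m x] by (subst Bochner_Integration.integral_diff) (auto simp: B_def)
    also have "\<dots> \<le> frac_lap s ?b x"
      unfolding frac_lap_def using IB Imx Ib pw by (intro integral_mono) auto
    finally show ?thesis .
  qed
  then show ?thesis using that \<alpha> c by blast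
qed

section \<open>Boundary behaviour\<close>

text \<open>Moving from x0 in directions where the derivative of \<psi> is positive makes \<psi>
  positive to first order, uniformly over a small ball of directions.\<close>

lemma exterior_cone:
  fixes \<Omega> :: "'a::euclidean_space set"
  assumes sm: "smooth_boundary \<Omega>" and O: "open \<Omega>" and x0: "x0 \<in> frontier \<Omega>"
  obtains e \<rho> where "\<rho> > 0" "\<And>t q. 0 < t \<Longrightarrow> t \<le> 1 \<Longrightarrow> q \<in> cball e \<rho> \<Longrightarrow> x0 + t *\<^sub>R q \<notin> closure \<Omega>"
proof -
  obtain U \<psi> where all: "open U \<and> x0 \<in> U \<and> Cinf_on U \<psi> \<and>
        (\<forall>y\<in>U. frechet_derivative \<psi> (at y) \<noteq> (\<lambda>_. 0)) \<and> \<Omega> \<inter> U = {y\<in>U. \<psi> y < 0}"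
    using sm[unfolded smooth_boundary_def, rule_format, OF x0] by (elim exE)
  have U: "open U" "x0 \<in> U" and smooth: "Cinf_on U \<psi>"
    and nz: "frechet_derivative \<psi> (at x0) \<noteq> (\<lambda>_. 0)" and eq: "\<Omega> \<inter> U = {y\<in>U. \<psi> y < 0}"
    using all by simp_all
  have "Ck_on (Suc 0) U \<psi>" using smooth by (simp add: Cinf_on_def)
  then have cont: "continuous_on U \<psi>" and "\<psi> differentiable_on U" by auto
  then have "\<psi> differentiable (at x0)" using U
    by (simp add: differentiable_on_eq_differentiable_at)
  then have der: "(\<psi> has_derivative frechet_derivative \<psi> (at x0)) (at x0)"
    by (simp add: frechet_derivative_works)
  define f where "f = frechet_derivative \<psi> (at x0)"
  have der': "(\<psi> has_derivative f) (at x0)" using der by (simp add: f_def)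
  interpret f: bounded_linear f using der' by (rule has_derivative_bounded_linear)
  have x0O: "x0 \<notin> \<Omega>" using x0 O by (simp add: frontier_def interior_open)
  have \<psi>0: "\<psi> x0 \<ge> 0"
  proof (rule ccontr)
    assume "\<not> ?thesis"
    then have "x0 \<in> \<Omega> \<inter> U" unfolding eq using U(2) by simp
    then show False using x0O by simp
  qed
  obtain a where a: "f a \<noteq> 0" using nz unfolding f_def by (metis ext)
  \<comment> \<open>The factor \<open>f a\<close> fixes the sign: f(e) = (f a)^2 > 0 whichever sign
    \<open>f a\<close> has.\<close>
  define e where "e = f a *\<^sub>R a"
  have "f e = (f a)\<^sup>2" by (simp add: e_def f.scaleR power2_eq_square)
  then have fe: "f e > 0" using a by simp
  obtain B where B: "B > 0" "\<And>x. norm (f x) \<le> norm x * B" using f.pos_bounded by blast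
  define m where "m = f e / 2"
  have m: "m > 0" using fe by (simp add: m_def)
  define \<rho> where "\<rho> = m / B"
  have \<rho>: "\<rho> > 0" using m B by (simp add: \<rho>_def)
  have fq: "f q \<ge> m" if "q \<in> cball e \<rho>" for q
  proof -
    have "norm (f (e - q)) \<le> norm (e - q) * B" by (rule B)
    also have "\<dots> \<le> \<rho> * B" using that B by (intro mult_right_mono) (auto simp: dist_norm)
    also have "\<dots> = m" using B by (simp add: \<rho>_def)
    finally have "\<bar>f e - f q\<bar> \<le> f e / 2" by (simp add: f.diff m_def)
    then show ?thesis unfolding m_def by linarith
  qed
  define Q where "Q = norm e + \<rho>"
  have Q: "Q > 0" using \<rho> by (simp add: Q_def add_nonneg_pos)
  have nq: "norm q \<le> Q" if "q \<in> cball e \<rho>" for q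
    using that norm_triangle_ineq3[of e q] unfolding Q_def mem_cball dist_norm by linarith
  \<comment> \<open>Makes the first order error at x0 + tq at most tm/2, half of the linear increase
    tm.\<close>
  define \<epsilon> where "\<epsilon> = m / (2 * Q)"
  have \<epsilon>: "\<epsilon> > 0" using m Q by (simp add: \<epsilon>_def)
  obtain d1 where d1: "d1 > 0" "\<And>y. norm (y - x0) < d1 \<Longrightarrow> norm (\<psi> y - \<psi> x0 - f (y - x0)) \<le> \<epsilon> * norm (y - x0)"
    using conjunct2[OF der'[unfolded has_derivative_at_alt], rule_format, OF \<epsilon>] by (elim exE conjE) (rule that, auto)
  obtain d2 where d2: "d2 > 0" "ball x0 d2 \<subseteq> U" using U open_contains_ball by blast
  define t0 where "t0 = min d1 d2 / (2 * Q)"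
  have t0: "t0 > 0" using d1 d2 Q by (simp add: t0_def)
  have pos: "x0 + t *\<^sub>R q \<in> U \<and> \<psi> (x0 + t *\<^sub>R q) > 0" if t: "0 < t" "t \<le> t0" and q: "q \<in> cball e \<rho>" for t q
  proof -
    have "norm (t *\<^sub>R q) \<le> t0 * Q" using t nq[OF q] Q by (simp add: mult_mono)
    also have "\<dots> = min d1 d2 / 2" using Q by (simp add: t0_def)
    also have "\<dots> < min d1 d2" using d1(1) d2(1) by linarith
    finally have small: "norm (t *\<^sub>R q) < d1" "norm (t *\<^sub>R q) < d2" by auto
    have inU: "x0 + t *\<^sub>R q \<in> U" using small d2 by (auto simp: dist_norm)
    have "norm (\<psi> (x0 + t *\<^sub>R q) - \<psi> x0 - f (t *\<^sub>R q)) \<le> \<epsilon> * norm (t *\<^sub>R q)"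
      using d1(2)[of "x0 + t *\<^sub>R q"] small by simp
    also have "\<dots> \<le> \<epsilon> * (t * Q)" using t nq[OF q] \<epsilon> by (intro mult_left_mono) (auto intro: mult_left_mono)
    also have "\<dots> = t * m / 2" using Q by (simp add: \<epsilon>_def)
    finally have "\<bar>\<psi> (x0 + t *\<^sub>R q) - \<psi> x0 - f (t *\<^sub>R q)\<bar> \<le> t * m / 2" by simp
    moreover have "f (t *\<^sub>R q) \<ge> t * m" using fq[OF q] t by (simp add: f.scaleR mult_left_mono)
    moreover have "t * m > 0" using t m by simp
    ultimately have "\<psi> (x0 + t *\<^sub>R q) > 0" using \<psi>0 by linarith
    then show ?thesis using inU by simp
  qed
  \<comment> \<open>Openness of {\<psi> > 0} gives disjointness from the closure of \<Omega>, not
    only from \<Omega>; the later separation by \<eta> needs the closure.\<close>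
  have op: "open {y \<in> U. \<psi> y > 0}"
  proof -
    have "{y \<in> U. \<psi> y > 0} = U \<inter> \<psi> -` {0<..}" by auto
    then show ?thesis using continuous_open_preimage[OF cont U(1) open_greaterThan[of 0]] by simp
  qed
  have disj: "y \<notin> closure \<Omega>" if "y \<in> U" "\<psi> y > 0" for y
  proof -
    have "\<not> \<psi> z > 0" if "z \<in> \<Omega>" "z \<in> U" for z
    proof -
      have "z \<in> {y\<in>U. \<psi> y < 0}" unfolding eq[symmetric] using that by simp
      then show ?thesis by simp
    qed
    then have "{y \<in> U. \<psi> y > 0} \<inter> \<Omega> = {}" by blast
    then have "{y \<in> U. \<psi> y > 0} \<inter> closure \<Omega> = {}" using open_Int_closure_eq_empty[OF op] by blast
    then show ?thesis using that by auto
  qed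
  show ?thesis
  \<comment> \<open>Scaling direction and radius by t0 normalises the admissible parameters from (0,
    t0] to (0, 1].\<close>
  proof (rule that[of "t0 * \<rho>" "t0 *\<^sub>R e"])
    show "t0 * \<rho> > 0" using t0 \<rho> by simp
    fix t q assume t: "0 < t" "t \<le> (1::real)" and q: "q \<in> cball (t0 *\<^sub>R e) (t0 * \<rho>)"
    define q' where "q' = q /\<^sub>R t0"
    have qq: "q = t0 *\<^sub>R q'" using t0 by (simp add: q'_def)
    have "t0 * norm (e - q') \<le> t0 * \<rho>"
      using q t0 unfolding qq mem_cball dist_norm scaleR_diff_right[symmetric] by simp
    then have "q' \<in> cball e \<rho>" using t0 by (simp add: dist_norm)
    moreover have "t * t0 \<le> t0" using t t0 by simp
    ultimately show "x0 + t *\<^sub>R q \<notin> closure \<Omega>"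
      using pos[of "t * t0" q'] disj t t0 unfolding qq by simp
  qed
qed

text \<open>The cone over a ball of directions, cut off at parameter \<tau> > 0 so that it avoids
  the vertex x0 and remains at positive distance from \<Omega>. At t = 1 it contains a ball whose
  radius does not depend on \<tau>.\<close>

definition trunc_cone :: "'a::euclidean_space \<Rightarrow> 'a \<Rightarrow> real \<Rightarrow> real \<Rightarrow> 'a set" where
  "trunc_cone x0 e \<rho> \<tau> = {x0 + t *\<^sub>R q | t q. t \<in> {\<tau>..1} \<and> q \<in> cball e \<rho>}"

lemma trunc_cone_compact: "compact (trunc_cone x0 e \<rho> \<tau>)"
proof -
  have "trunc_cone x0 e \<rho> \<tau> = (\<lambda>z. x0 + fst z *\<^sub>R snd z) ` ({\<tau>..1} \<times> cball e \<rho>)"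
    by (force simp: trunc_cone_def)
  moreover have "compact ((\<lambda>z. x0 + fst z *\<^sub>R snd z) ` ({\<tau>..1} \<times> cball e \<rho>))"
    by (intro compact_continuous_image continuous_intros compact_Times compact_cball compact_Icc)
  ultimately show ?thesis by simp
qed

lemma trunc_cone_convex:
  assumes "\<tau> > 0" shows "convex (trunc_cone x0 e \<rho> \<tau>)"
proof (rule convexI)
  fix x y :: 'a and a b :: real
  assume x: "x \<in> trunc_cone x0 e \<rho> \<tau>" and y: "y \<in> trunc_cone x0 e \<rho> \<tau>" and ab: "0 \<le> a" "0 \<le> b" "a + b = 1"
  obtain t1 q1 where 1: "x = x0 + t1 *\<^sub>R q1" "\<tau> \<le> t1" "t1 \<le> 1" "q1 \<in> cball e \<rho>" using x by (auto simp: trunc_cone_def)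
  obtain t2 q2 where 2: "y = x0 + t2 *\<^sub>R q2" "\<tau> \<le> t2" "t2 \<le> 1" "q2 \<in> cball e \<rho>" using y by (auto simp: trunc_cone_def)
  define t where "t = a * t1 + b * t2"
  have "a * \<tau> + b * \<tau> \<le> t" unfolding t_def using 1 2 ab by (intro add_mono mult_left_mono) auto
  then have t1: "\<tau> \<le> t" using ab by (simp add: distrib_right[symmetric])
  have "t \<le> a * 1 + b * 1" unfolding t_def using 1 2 ab by (intro add_mono mult_left_mono) auto
  then have t2: "t \<le> 1" using ab by simp
  have t0: "t > 0" using t1 assms by simp
  \<comment> \<open>Averaging directions with weights proportional to a t1 and b t2 turns the sum of
    scaled vectors into one scaled vector.\<close>
  define q where "q = (a * t1 / t) *\<^sub>R q1 + (b * t2 / t) *\<^sub>R q2"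
  have "q \<in> cball e \<rho>"
    unfolding q_def using 1 2 ab t0 assms
    by (intro convexD[OF convex_cball]) (auto simp: t_def add_divide_distrib[symmetric])
  moreover have "a *\<^sub>R x + b *\<^sub>R y = x0 + t *\<^sub>R q"
  proof -
    have "t *\<^sub>R q = (a * t1) *\<^sub>R q1 + (b * t2) *\<^sub>R q2" using t0 by (simp add: q_def scaleR_add_right)
    moreover have "a *\<^sub>R x + b *\<^sub>R y = (a + b) *\<^sub>R x0 + ((a * t1) *\<^sub>R q1 + (b * t2) *\<^sub>R q2)"
      unfolding 1(1) 2(1) by (simp add: algebra_simps)
    ultimately show ?thesis using ab by simp
  qed
  ultimately show "a *\<^sub>R x + b *\<^sub>R y \<in> trunc_cone x0 e \<rho> \<tau>"
    using t1 t2 by (auto simp: trunc_cone_def)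
qed

lemma frac_lap_bound:
  fixes B :: "'a::euclidean_space \<Rightarrow> real"
  assumes s: "0 < s" "s < 1/2" and [measurable]: "B \<in> borel_measurable borel"
    and L: "\<And>y. \<bar>B x - B y\<bar> \<le> A * min (norm (x - y)) 1"
  shows "\<bar>frac_lap s B x\<bar> \<le> A * (\<integral> z. min (norm z) 1 * riesz s (z::'a) \<partial>lborel)"
proof -
  note I = riesz_min1_integrable[OF s, where 'a='a]
  have "\<bar>frac_lap s B x\<bar> \<le> (\<integral> y. \<bar>(B x - B y) * riesz s (x - y)\<bar> \<partial>lborel)"
    unfolding frac_lap_def by (rule integral_abs_bound)
  also have "\<dots> \<le> (\<integral> y. A * (min (norm (x - y)) 1 * riesz s (x - y)) \<partial>lborel)"
  proof (rule integral_mono)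
    show "integrable lborel (\<lambda>y. \<bar>(B x - B y) * riesz s (x - y)\<bar>)"
      by (intro integrable_abs frac_lap_integrable[OF s _ L]) simp
    show "integrable lborel (\<lambda>y. A * (min (norm (x - y)) 1 * riesz s (x - y)))"
      by (intro integrable_mult_right) (subst integrable_reflect, auto intro: I)
    show "\<bar>(B x - B y) * riesz s (x - y)\<bar> \<le> A * (min (norm (x - y)) 1 * riesz s (x - y))" for y
      using mult_right_mono[OF L[of y] riesz_nonneg[of s "x - y"]] by (simp add: abs_mult mult.assoc)
  qed
  also have "\<dots> = A * (\<integral> z. min (norm z) 1 * riesz s (z::'a) \<partial>lborel)"
    using integral_reflect[of "\<lambda>z. min (norm z) 1 * riesz s z" x] by simp
  finally show ?thesis .
qed

lemma frac_lap_add_scale: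
  fixes g b :: "'a::euclidean_space \<Rightarrow> real"
  assumes "integrable lborel (\<lambda>y. (g x - g y) * riesz s (x - y))" "integrable lborel (\<lambda>y. (b x - b y) * riesz s (x - y))"
  shows "frac_lap s (\<lambda>x. g x + C * b x) x = frac_lap s g x + C * frac_lap s b x"
proof -
  have "frac_lap s (\<lambda>x. g x + C * b x) x = (\<integral> y. (g x - g y) * riesz s (x - y) + C * ((b x - b y) * riesz s (x - y)) \<partial>lborel)"
    unfolding frac_lap_def by (intro Bochner_Integration.integral_cong refl) (simp add: algebra_simps)
  also have "\<dots> = frac_lap s g x + C * frac_lap s b x"
    unfolding frac_lap_def using assms by simp
  finally show ?thesis .
qed

text \<open>Compare \<open>v\<close> with g + C \<open>barrier\<close> over the truncated cone, then
  let \<tau> tend to 0. \<open>v\<close>, \<open>F\<close> and \<open>g\<close> are quantified after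
  \<open>C\<close> and \<open>\<alpha>\<close>, so the same constants serve the negated problem and
  give the lower bound.\<close>

lemma boundary_upper:
  fixes \<Omega> :: "'a::euclidean_space set"
  assumes s: "0 < s" "s < 1/2" and p: "p > 0" and O: "open \<Omega>" "bounded \<Omega>" 
    and \<rho>: "\<rho> > 0" and ext: "\<And>t q. 0 < t \<Longrightarrow> t \<le> 1 \<Longrightarrow> q \<in> cball e \<rho> \<Longrightarrow> x0 + t *\<^sub>R q \<notin> closure \<Omega>"
    and A: "A \<ge> 0"
  obtains C \<alpha> where "C > 0" "\<alpha> > 0" "\<And>v F g. weak_eq s p \<Omega> v F \<Longrightarrow> g \<in> borel_measurable borel \<Longrightarrow>
     (\<And>x. \<bar>v x\<bar> \<le> M) \<Longrightarrow> (\<And>x. \<bar>g x\<bar> \<le> M) \<Longrightarrow> (\<And>x. x \<notin> \<Omega> \<Longrightarrow> v x = g x) \<Longrightarrow>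
     (\<And>x y. x \<in> \<Omega> \<Longrightarrow> \<bar>g x - g y\<bar> \<le> A * min (norm (x - y)) 1) \<Longrightarrow>
     (AE x in lborel. x \<in> \<Omega> \<longrightarrow> \<bar>F x\<bar> \<le> H) \<Longrightarrow>
     (AE x in lborel. v x - g x \<le> C * dist x x0 powr \<alpha>)"
proof -
  define p0 where "p0 = x0 + e"
  obtain R0 where R0: "\<And>y. y \<in> \<Omega> \<Longrightarrow> dist p0 y \<le> R0" using O(2) bounded_any_center[of \<Omega> p0] by blast
  \<comment> \<open>Large enough both for the cone, contained in the ball of radius 2|e| + \<rho>
    about p0, and for the distance from points of \<Omega> to p0.\<close>
  define R where "R = \<bar>R0\<bar> + 2 * norm e + \<rho>"
  have R: "\<rho> \<le> R" "R0 \<le> R" using norm_ge_zero[of e] \<rho> abs_ge_self[of R0] abs_ge_zero[of R0] unfolding R_def by linarith+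
  obtain \<alpha> c where \<alpha>: "0 < \<alpha>" "\<alpha> \<le> s" and c: "c > 0" and super:
    "\<And>K (p::'a) \<eta> x. compact K \<Longrightarrow> convex K \<Longrightarrow> cball p \<rho> \<subseteq> K \<Longrightarrow> K \<subseteq> cball p R \<Longrightarrow>
      0 < \<eta> \<Longrightarrow> \<eta> \<le> infdist x K \<Longrightarrow> infdist x K \<le> R \<Longrightarrow> c \<le> frac_lap s (barrier \<alpha> \<eta> R K) x"
    using barrier_supersolution[OF s \<rho> R(1), where 'a='a] by blast
  define J where "J = (\<integral> z. min (norm z) 1 * riesz s (z::'a) \<partial>lborel)"
  have J0: "J \<ge> 0" unfolding J_def by (intro integral_nonneg_AE AE_I2) simp
  define \<gamma> where "\<gamma> = gamma_ns DIM('a) s"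
  have \<gamma>: "\<gamma> > 0" unfolding \<gamma>_def using gamma_ns_pos s by blast
  \<comment> \<open>A J bounds the fractional Laplacian of \<open>g\<close>; the extra 1 makes the
    supersolution inequality strict.\<close>
  define C where "C = (\<bar>H\<bar> / \<gamma> + A * J + 1) / c"
  have C: "C > 0" unfolding C_def using c \<gamma> A J0 by (intro divide_pos_pos add_nonneg_pos) auto
  have Cc: "\<gamma> * (- (A * J) + C * c) > \<bar>H\<bar>"
    using c \<gamma> by (simp add: C_def field_simps)
  have main: "AE x in lborel. v x - g x \<le> C * dist x x0 powr \<alpha>"
    if w: "weak_eq s p \<Omega> v F" and [measurable]: "g \<in> borel_measurable borel"
      and vb: "\<And>x. \<bar>v x\<bar> \<le> M" and gb: "\<And>x. \<bar>g x\<bar> \<le> M" and out: "\<And>x. x \<notin> \<Omega> \<Longrightarrow> v x = g x"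
      and gL: "\<And>x y. x \<in> \<Omega> \<Longrightarrow> \<bar>g x - g y\<bar> \<le> A * min (norm (x - y)) 1"
      and F: "AE x in lborel. x \<in> \<Omega> \<longrightarrow> \<bar>F x\<bar> \<le> H" for v F g
  proof -
    have [measurable]: "v \<in> borel_measurable borel" "\<Omega> \<in> sets borel" using w O by (auto simp: weak_eq_def)
    have step: "AE x in lborel. v x \<le> g x + C * (dist x x0 + \<tau> * norm e) powr \<alpha>" if \<tau>: "0 < \<tau>" "\<tau> \<le> 1" for \<tau>
    proof -
      define K where "K = trunc_cone x0 e \<rho> \<tau>"
      have K1: "compact K" "convex K" using trunc_cone_compact trunc_cone_convex \<tau> by (auto simp: K_def)
      have K2: "cball p0 \<rho> \<subseteq> K"
      proof
        fix z assume "z \<in> cball p0 \<rho>"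
        then have "z - x0 \<in> cball e \<rho>" by (simp add: p0_def dist_norm algebra_simps)
        then show "z \<in> K" unfolding K_def trunc_cone_def using \<tau>
          by (intro CollectI exI[of _ 1] exI[of _ "z - x0"]) auto
      qed
      have K3: "K \<subseteq> cball p0 R"
      proof
        fix z assume "z \<in> K"
        then obtain t q where z: "z = x0 + t *\<^sub>R q" "\<tau> \<le> t" "t \<le> 1" "q \<in> cball e \<rho>" by (auto simp: K_def trunc_cone_def)
        have "norm q \<le> norm e + \<rho>"
          using z(4) norm_triangle_ineq3[of e q] unfolding mem_cball dist_norm by linarith
        then have "t * norm q \<le> 1 * (norm e + \<rho>)" using z \<tau> by (intro mult_mono) auto
        then have "norm (e - t *\<^sub>R q) \<le> norm e + (norm e + \<rho>)"
          using norm_triangle_ineq4[of e "t *\<^sub>R q"] z \<tau> by simp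
        then show "z \<in> cball p0 R" by (simp add: z(1) p0_def dist_norm R_def)
      qed
      have Kne: "p0 \<in> K" using K2 \<rho> by auto
      have disj: "closure \<Omega> \<inter> K = {}"
      proof -
        have "z \<notin> closure \<Omega>" if zK: "z \<in> K" for z
        proof -
          obtain t q where z: "z = x0 + t *\<^sub>R q" "\<tau> \<le> t" "t \<le> 1" "q \<in> cball e \<rho>"
            using zK by (auto simp: K_def trunc_cone_def)
          then show ?thesis using ext[of t q] \<tau> by simp
        qed
        then show ?thesis by blast
      qed
      \<comment> \<open>\<eta> shrinks with \<tau>, but it enters only the Lipschitz constant of the
        barrier, which the conclusion of the comparison does not see.\<close>
      obtain \<eta> where "0 < \<eta> \<and> (\<forall>x\<in>closure \<Omega>. \<forall>y\<in>K. \<eta> \<le> dist x y)"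
        using separate_closed_compact[OF closed_closure K1(1) disj] by (elim exE)
      then have \<eta>: "\<eta> > 0" "\<And>x y. x \<in> closure \<Omega> \<Longrightarrow> y \<in> K \<Longrightarrow> \<eta> \<le> dist x y"
        by simp_all
      have D: "\<eta> \<le> infdist x K" "infdist x K \<le> R" if "x \<in> \<Omega>" for x
      proof -
        have "x \<in> closure \<Omega>" using that closure_subset by blast
        moreover obtain y where "y \<in> K" "infdist x K = dist x y"
          using infdist_attains_inf[OF compact_imp_closed[OF K1(1)], of x] Kne by blast
        ultimately show "\<eta> \<le> infdist x K" using \<eta>(2) by simp
        have "infdist x K \<le> dist x p0" using Kne by (rule infdist_le)
        also have "\<dots> \<le> R" using R0[OF that] R(2) by (simp add: dist_commute)
        finally show "infdist x K \<le> R" .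
      qed
      define b where "b = barrier \<alpha> \<eta> R K"
      have [measurable]: "b \<in> borel_measurable borel" unfolding b_def by simp
      have bL: "\<bar>b x - b y\<bar> \<le> (\<eta> powr (\<alpha> - 1) + R powr \<alpha>) * min (norm (x - y)) 1" for x y
        unfolding b_def using \<alpha> s by (intro barrier_Lipschitz \<eta>) auto
      define B where "B x = g x + C * b x" for x
      have [measurable]: "B \<in> borel_measurable borel" unfolding B_def[abs_def] by measurable
      have "AE x in lborel. v x \<le> B x"
      proof (rule comparison[OF s w])
        show "\<bar>B x - B y\<bar> \<le> (A + C * (\<eta> powr (\<alpha> - 1) + R powr \<alpha>)) * min (norm (x - y)) 1" if "x \<in> \<Omega>" for x y
        proof -
          have "\<bar>B x - B y\<bar> = \<bar>(g x - g y) + C * (b x - b y)\<bar>" by (simp add: B_def algebra_simps)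
          also have "\<dots> \<le> \<bar>g x - g y\<bar> + C * \<bar>b x - b y\<bar>"
            using C abs_triangle_ineq[of "g x - g y" "C * (b x - b y)"] by (simp add: abs_mult)
          also have "\<dots> \<le> A * min (norm (x - y)) 1 + C * ((\<eta> powr (\<alpha> - 1) + R powr \<alpha>) * min (norm (x - y)) 1)"
            using C by (intro add_mono gL that mult_left_mono bL) auto
          finally show ?thesis by (simp add: algebra_simps)
        qed
        have bb: "0 \<le> b x" "b x \<le> R powr \<alpha>" for x unfolding b_def by (rule barrier_bounds)+
        have Cb: "0 \<le> C * b x" "C * b x \<le> C * R powr \<alpha>" for x using bb[of x] C by auto
        show "\<bar>B x\<bar> \<le> M + C * R powr \<alpha>" for x
          using gb[of x] Cb[of x] unfolding B_def by linarith
        show "v x \<le> B x" if "x \<notin> \<Omega>" for x using out[OF that] Cb[of x] by (simp add: B_def)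
        have "\<bar>max (v x - B x) 0\<bar> \<le> 2 * M" for x
          using vb[of x] gb[of x] Cb[of x] unfolding B_def by linarith
        then show "Lp_on p \<Omega> (\<lambda>x. max (v x - B x) 0)"
          by (intro Lp_on_bounded[OF _ _ O(2) p, where c="2 * M"]) auto
        show "AE x in lborel. x \<in> \<Omega> \<and> B x < v x \<longrightarrow> F x < gamma_ns DIM('a) s * frac_lap s B x"
          using F
        proof (rule eventually_mono, intro impI)
          fix x assume h: "x \<in> \<Omega> \<longrightarrow> \<bar>F x\<bar> \<le> H" "x \<in> \<Omega> \<and> B x < v x"
          then have x: "x \<in> \<Omega>" by simp
          have e: "frac_lap s B x = frac_lap s g x + C * frac_lap s b x"
            unfolding B_def[abs_def]
            by (intro frac_lap_add_scale frac_lap_integrable[OF s _ gL[OF x]] frac_lap_integrable[OF s _ bL]) auto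
          have "- (A * J) \<le> frac_lap s g x"
            using frac_lap_bound[OF s \<open>g \<in> borel_measurable borel\<close> gL[OF x]] unfolding J_def by linarith
          moreover have "c \<le> frac_lap s b x"
            unfolding b_def by (rule super[OF K1 K2 K3 \<eta>(1) D[OF x]])
          then have "C * c \<le> C * frac_lap s b x" using C by simp
          ultimately have "- (A * J) + C * c \<le> frac_lap s B x" unfolding e by linarith
          then have "\<gamma> * (- (A * J) + C * c) \<le> \<gamma> * frac_lap s B x"
            by (rule mult_left_mono) (use \<gamma> in simp)
          then show "F x < gamma_ns DIM('a) s * frac_lap s B x"
            using Cc h x unfolding \<gamma>_def[symmetric] by linarith
        qed
      qed (use O in auto)
      then show ?thesis
      proof (rule eventually_mono)
        fix x assume "v x \<le> B x"
        also have "B x \<le> g x + C * (dist x x0 + \<tau> * norm e) powr \<alpha>"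
        proof -
          \<comment> \<open>The tip of the axis lies at distance \<tau>|e| from the vertex, so
            distance to the cone is within that error of distance to x0.\<close>
          have "x0 + \<tau> *\<^sub>R e \<in> K" unfolding K_def trunc_cone_def using \<tau> \<rho>
            by (intro CollectI exI[of _ \<tau>] exI[of _ e]) auto
          then have "infdist x K \<le> dist x (x0 + \<tau> *\<^sub>R e)" by (rule infdist_le)
          also have "\<dots> \<le> dist x x0 + dist x0 (x0 + \<tau> *\<^sub>R e)" by (rule dist_triangle)
          also have "dist x0 (x0 + \<tau> *\<^sub>R e) = \<tau> * norm e" using \<tau> by (simp add: dist_norm)
          finally have "infdist x K powr \<alpha> \<le> (dist x x0 + \<tau> * norm e) powr \<alpha>"
            using \<alpha> by (intro powr_mono2) (auto simp: infdist_nonneg)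
          then have "b x \<le> (dist x x0 + \<tau> * norm e) powr \<alpha>"
            using barrier_bounds(3)[of \<alpha> \<eta> R K x] by (simp add: b_def)
          then show ?thesis using C by (simp add: B_def)
        qed
        finally show "v x \<le> g x + C * (dist x x0 + \<tau> * norm e) powr \<alpha>" .
      qed
    qed
    \<comment> \<open>A countable sequence of \<tau> keeps a single exceptional null set.\<close>
    have "AE x in lborel. \<forall>n. v x \<le> g x + C * (dist x x0 + inverse (real (Suc n)) * norm e) powr \<alpha>"
      unfolding AE_all_countable by (intro allI step) (auto simp: field_simps)
    then show ?thesis
    proof (rule eventually_mono)
      fix x assume h: "\<forall>n. v x \<le> g x + C * (dist x x0 + inverse (real (Suc n)) * norm e) powr \<alpha>"
      have "(\<lambda>n. g x + C * (dist x x0 + inverse (real (Suc n)) * norm e) powr \<alpha>) \<longlonglongrightarrow> g x + C * (dist x x0 + 0 * norm e) powr \<alpha>"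
        using \<alpha> by (intro tendsto_intros tendsto_powr' LIMSEQ_inverse_real_of_nat) auto
      then have "v x \<le> g x + C * (dist x x0 + 0 * norm e) powr \<alpha>"
        by (rule LIMSEQ_le_const) (use h in auto)
      then show "v x - g x \<le> C * dist x x0 powr \<alpha>" by simp
    qed
  qed
  show ?thesis using that[OF C \<alpha>(1)] main by blast
qed

lemma boundary_estimate:
  fixes v F g :: "'a::euclidean_space \<Rightarrow> real"
  assumes s: "0 < s" "s < 1/2" and p: "p > 0" and O: "open \<Omega>" "bounded \<Omega>" "smooth_boundary \<Omega>"
    and w: "weak_eq s p \<Omega> v F" and [measurable]: "g \<in> borel_measurable borel"
      and vb: "\<And>x. \<bar>v x\<bar> \<le> M" and gb: "\<And>x. \<bar>g x\<bar> \<le> M" and out: "\<And>x. x \<notin> \<Omega> \<Longrightarrow> v x = g x"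
      and gL: "\<And>x y. x \<in> \<Omega> \<Longrightarrow> \<bar>g x - g y\<bar> \<le> A * min (norm (x - y)) 1"
      and F: "AE x in lborel. x \<in> \<Omega> \<longrightarrow> \<bar>F x\<bar> \<le> H"
    and x0: "x0 \<in> frontier \<Omega>" and A: "A \<ge> 0"
  obtains C \<alpha> where "C > 0" "\<alpha> > 0" "AE x in lborel. \<bar>v x - g x\<bar> \<le> C * dist x x0 powr \<alpha>"
proof -
  obtain e \<rho> where \<rho>: "\<rho> > 0" and ext: "\<And>t q. 0 < t \<Longrightarrow> t \<le> 1 \<Longrightarrow> q \<in> cball e \<rho> \<Longrightarrow> x0 + t *\<^sub>R q \<notin> closure \<Omega>"
  proof (rule exterior_cone[OF O(3,1) x0])
    fix e \<rho> assume "\<rho> > 0" "\<And>t q. 0 < t \<Longrightarrow> t \<le> 1 \<Longrightarrow> q \<in> cball e \<rho> \<Longrightarrow> x0 + t *\<^sub>R q \<notin> closure \<Omega>"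
    then show thesis by (rule that)
  qed
  show ?thesis
  proof (rule boundary_upper[OF s p O(1,2) \<rho> ext A, where M=M and H=H])
    fix C \<alpha> :: real
    assume C: "C > 0" "\<alpha> > 0" and main: "\<And>v F g. weak_eq s p \<Omega> v F \<Longrightarrow> g \<in> borel_measurable borel \<Longrightarrow>
     (\<And>x. \<bar>v x\<bar> \<le> M) \<Longrightarrow> (\<And>x. \<bar>g x\<bar> \<le> M) \<Longrightarrow> (\<And>x. x \<notin> \<Omega> \<Longrightarrow> v x = g x) \<Longrightarrow>
     (\<And>x y. x \<in> \<Omega> \<Longrightarrow> \<bar>g x - g y\<bar> \<le> A * min (norm (x - y)) 1) \<Longrightarrow>
     (AE x in lborel. x \<in> \<Omega> \<longrightarrow> \<bar>F x\<bar> \<le> H) \<Longrightarrow>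
     (AE x in lborel. v x - g x \<le> C * dist x x0 powr \<alpha>)"
  have 1: "AE x in lborel. v x - g x \<le> C * dist x x0 powr \<alpha>"
    by (rule main[OF w _ vb gb out gL F]) auto
  have 2: "AE x in lborel. - v x - - g x \<le> C * dist x x0 powr \<alpha>"
    by (rule main[OF weak_eq_uminus[OF w]]) (use vb gb out gL F in \<open>auto simp: abs_minus_commute\<close>)
  have "AE x in lborel. \<bar>v x - g x\<bar> \<le> C * dist x x0 powr \<alpha>"
    using 1 2 by eventually_elim auto
  then show ?thesis using that C by blast
  qed
qed

section \<open>Regularity up to the boundary\<close>

lemma locally_lipschitz_continuous:
  assumes "locally_lipschitz g" shows "continuous_on UNIV g"
proof -
  have "isCont g x" for x
  proof -
    obtain L where "L-lipschitz_on (cball x 1) g"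
      using assms unfolding locally_lipschitz_def by (meson compact_cball)
    then have "continuous_on (ball x 1) g"
      using lipschitz_on_continuous_on continuous_on_subset ball_subset_cball by metis
    then show ?thesis by (simp add: continuous_on_eq_continuous_at)
  qed
  then show ?thesis by (simp add: continuous_at_imp_continuous_on)
qed

lemma locally_lipschitz_min1:
  fixes g :: "'a::euclidean_space \<Rightarrow> real"
  assumes g: "locally_lipschitz g" and b: "\<And>x. \<bar>g x\<bar> \<le> M" and bd: "bounded \<Omega>"
  obtains A where "A \<ge> 0" "\<And>x y. x \<in> \<Omega> \<Longrightarrow> \<bar>g x - g y\<bar> \<le> A * min (norm (x - y)) 1"
proof -
  obtain r where r: "\<And>x. x \<in> \<Omega> \<Longrightarrow> norm x \<le> r" using bd by (meson bounded_iff)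
  obtain L where L: "L-lipschitz_on (cball 0 (r + 1)) g"
    using g unfolding locally_lipschitz_def by (meson compact_cball)
  have L0: "L \<ge> 0" using L by (rule lipschitz_on_nonneg)
  have M0: "M \<ge> 0" using b[of 0] by linarith
  have "\<bar>g x - g y\<bar> \<le> (L + 2 * M) * min (norm (x - y)) 1" if x: "x \<in> \<Omega>" for x y
  proof (cases "norm (x - y) \<le> 1")
    case True
    have "norm y \<le> norm x + norm (x - y)" using norm_triangle_ineq4[of x "x - y"] by simp
    then have "x \<in> cball 0 (r + 1)" "y \<in> cball 0 (r + 1)" using r[OF x] True by auto
    then have "\<bar>g x - g y\<bar> \<le> L * norm (x - y)"
      using lipschitz_onD[OF L] by (simp add: dist_norm)
    also have "\<dots> \<le> (L + 2 * M) * norm (x - y)" using M0 by (intro mult_right_mono) auto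
    finally show ?thesis using True by simp
  next
    case False
    then show ?thesis using b[of x] b[of y] L0 by simp
  qed
  then show ?thesis using that[of "L + 2 * M"] L0 M0 by auto
qed

text \<open>The mean value theorem produces a point in (1, t) where W' > 0; a change of sign before
  t would force a zero of W'.\<close>

lemma deriv_pos_right:
  fixes W W' :: "real \<Rightarrow> real"
  assumes der: "\<And>x. (W has_real_derivative W' x) (at x)" and cont: "continuous_on UNIV W'"
    and W1: "W 1 = 0" and pos: "\<And>t. t > 1 \<Longrightarrow> W t > 0" and nz: "\<And>t. t > 1 \<Longrightarrow> W' t \<noteq> 0" and t: "t > 1"
  shows "W' t > 0"
proof (rule ccontr)
  assume n: "\<not> ?thesis"
  obtain z where z: "1 < z" "z < t" "W t - W 1 = (t - 1) * W' z"
    using MVT2[of 1 t W W'] der t by blast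
  then have "W' z > 0" using pos[OF t] W1 t by (simp add: zero_less_mult_iff)
  moreover have "continuous_on {z..t} W'" using cont continuous_on_subset by blast
  ultimately obtain x where "z \<le> x" "x \<le> t" "W' x = 0"
    using IVT2'[of W' t 0 z] n z by auto
  then show False using nz z by force
qed

text \<open>The integrals may be combined only after integrability of each term is known, since a
  Bochner integral defaults to 0. For W'(v) \<phi> this comes from the upper growth bound and both
  functions lying in L^p on \<Omega>.\<close>

lemma weak_eq_of_weak_solution:
  fixes v f :: "'a::euclidean_space \<Rightarrow> real"
  assumes s: "0 < s" "s < 1/2" and p: "1 < p" and c: "c > 0"
    and Wm [measurable]: "W' \<in> borel_measurable borel" and W'_def: "W' = deriv W"
    and growth: "\<And>t. \<bar>W' t\<bar> \<le> c * (\<bar>t\<bar> powr (p - 1) + 1)"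
    and O: "bounded \<Omega>" "open \<Omega>" and fm [measurable]: "f \<in> borel_measurable borel" and fb: "AE x in lborel. x \<in> \<Omega> \<longrightarrow> \<bar>f x\<bar> \<le> Hf"
    and v: "v \<in> Hhat s \<Omega>" and vp: "Lp_on p \<Omega> v" and sol: "weak_solution s p W \<epsilon> \<Omega> f v"
  shows "weak_eq s p \<Omega> v (\<lambda>x. f x - \<epsilon> powr (- 2 * s) * W' (v x))"
proof -
  let ?P = "lborel \<Otimes>\<^sub>M lborel :: ('a \<times> 'a) measure"
  have [measurable]: "\<Omega> \<in> sets borel" using O by simp
  have L2l: "L2_loc v" and en: "frac_energy s v \<Omega> < \<infinity>" using v by (auto simp: Hhat_def)
  have [measurable]: "v \<in> borel_measurable borel" using L2l by (simp add: L2_loc_def)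
  have cyl: "cyl_energy s \<Omega> v < \<infinity>" by (rule cyl_energy_finite[OF s _ _ en]) auto
  have "(\<integral>\<^sup>+ x\<in>\<Omega>. ennreal ((v x)\<^sup>2) \<partial>lborel) \<le> (\<integral>\<^sup>+ x\<in>closure \<Omega>. ennreal ((v x)\<^sup>2) \<partial>lborel)"
    using closure_subset[of \<Omega>] by (intro nn_integral_mono) (auto simp: indicator_def)
  also have "\<dots> < \<infinity>" using L2l O by (simp add: L2_loc_def compact_closure)
  finally have L2: "(\<integral>\<^sup>+ x\<in>\<Omega>. ennreal ((v x)\<^sup>2) \<partial>lborel) < \<infinity>" .
  have pw_int: "integrable lborel (\<lambda>x. indicator \<Omega> x * \<bar>\<psi> x\<bar> powr p)" if "Lp_on p \<Omega> \<psi>" for \<psi> :: "'a \<Rightarrow> real"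
  proof (rule integrableI_nonneg)
    have [measurable]: "\<psi> \<in> borel_measurable borel" using that by (simp add: Lp_on_def)
    show "(\<lambda>x. indicator \<Omega> x * \<bar>\<psi> x\<bar> powr p) \<in> borel_measurable lborel" by simp
    have "(\<integral>\<^sup>+ x. ennreal (indicator \<Omega> x * \<bar>\<psi> x\<bar> powr p) \<partial>lborel) = (\<integral>\<^sup>+ x\<in>\<Omega>. ennreal (\<bar>\<psi> x\<bar> powr p) \<partial>lborel)"
      by (intro nn_integral_cong) (auto simp: indicator_def)
    then show "(\<integral>\<^sup>+ x. ennreal (indicator \<Omega> x * \<bar>\<psi> x\<bar> powr p) \<partial>lborel) < \<infinity>" using that by (simp add: Lp_on_def)
  qed auto
  have "integrable lborel (\<lambda>x. (f x - \<epsilon> powr (- 2 * s) * W' (v x)) * \<phi> x) \<and>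
        gamma_ns DIM('a) s / 2 * (\<integral> z. gform s v \<phi> z \<partial>?P) = (\<integral> x. (f x - \<epsilon> powr (- 2 * s) * W' (v x)) * \<phi> x \<partial>lborel)"
    if H: "\<phi> \<in> Hs_full s" and z: "\<And>x. x \<notin> \<Omega> \<Longrightarrow> \<phi> x = 0" and Lp: "Lp_on p \<Omega> \<phi>" for \<phi>
  proof -
    have [measurable]: "\<phi> \<in> borel_measurable borel" using H by (simp add: Hs_full_def)
    have int: "integrable lborel \<phi>" by (rule Hs_full_integrable[OF H _ O(1) z]) auto
    have If: "integrable lborel (\<lambda>x. f x * \<phi> x)"
    proof (rule Bochner_Integration.integrable_bound)
      show "integrable lborel (\<lambda>x. \<bar>Hf\<bar> * \<bar>\<phi> x\<bar>)" using int by simp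
      show "AE x in lborel. norm (f x * \<phi> x) \<le> norm (\<bar>Hf\<bar> * \<bar>\<phi> x\<bar>)"
        using fb
      proof eventually_elim
        case (elim x)
        show ?case
        proof (cases "x \<in> \<Omega>")
          case True then show ?thesis using elim by (auto simp: abs_mult intro!: mult_right_mono)
        qed (simp add: z)
      qed
    qed simp
    have IW: "integrable lborel (\<lambda>x. W' (v x) * \<phi> x)"
    proof (rule Bochner_Integration.integrable_bound)
      show "integrable lborel (\<lambda>x. c * ((indicator \<Omega> x * \<bar>v x\<bar> powr p + indicator \<Omega> x * \<bar>\<phi> x\<bar> powr p) + \<bar>\<phi> x\<bar>))"
        using int pw_int[OF vp] pw_int[OF Lp] by simp
      show "AE x in lborel. norm (W' (v x) * \<phi> x) \<le> norm (c * ((indicator \<Omega> x * \<bar>v x\<bar> powr p + indicator \<Omega> x * \<bar>\<phi> x\<bar> powr p) + \<bar>\<phi> x\<bar>))"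
      proof (rule AE_I2)
        fix x
        show "norm (W' (v x) * \<phi> x) \<le> norm (c * ((indicator \<Omega> x * \<bar>v x\<bar> powr p + indicator \<Omega> x * \<bar>\<phi> x\<bar> powr p) + \<bar>\<phi> x\<bar>))"
        proof (cases "x \<in> \<Omega>")
          case True
          \<comment> \<open>A crude Young inequality: both factors are bounded by powers of the
            larger of |v| and |\<phi>|.\<close>
          have young: "\<bar>v x\<bar> powr (p - 1) * \<bar>\<phi> x\<bar> \<le> \<bar>v x\<bar> powr p + \<bar>\<phi> x\<bar> powr p"
          proof -
            define m where "m = max \<bar>v x\<bar> \<bar>\<phi> x\<bar>"
            have m0: "m \<ge> 0" by (simp add: m_def)
            have "\<bar>v x\<bar> powr (p - 1) * \<bar>\<phi> x\<bar> \<le> m powr (p - 1) * m"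
              using p by (intro mult_mono powr_mono2) (auto simp: m_def)
            also have "\<dots> = m powr p" using m0 by (cases "m = 0") (auto simp: powr_diff)
            also have "\<dots> \<le> \<bar>v x\<bar> powr p + \<bar>\<phi> x\<bar> powr p" by (auto simp: m_def max_def)
            finally show ?thesis .
          qed
          have "norm (W' (v x) * \<phi> x) \<le> (c * (\<bar>v x\<bar> powr (p - 1) + 1)) * \<bar>\<phi> x\<bar>"
            using growth[of "v x"] by (simp add: abs_mult mult_right_mono)
          also have "\<dots> = c * (\<bar>v x\<bar> powr (p - 1) * \<bar>\<phi> x\<bar> + \<bar>\<phi> x\<bar>)" by (simp add: algebra_simps)
          also have "\<dots> \<le> c * ((\<bar>v x\<bar> powr p + \<bar>\<phi> x\<bar> powr p) + \<bar>\<phi> x\<bar>)"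
            using young c by (intro mult_left_mono) auto
          finally show ?thesis using True c by simp
        qed (simp add: z)
      qed
    qed simp
    have "\<phi> \<in> Hs00 s \<Omega>" using H z by (simp add: Hs00_def)
    then have eq: "frac_form s \<Omega> v \<phi> + \<epsilon> powr (-2 * s) * (\<integral> x. indicator \<Omega> x * (W' (v x) * \<phi> x) \<partial>lborel)
        = (\<integral> x. indicator \<Omega> x * (f x * \<phi> x) \<partial>lborel)"
      using sol Lp unfolding weak_solution_def W'_def by blast
    have i1: "(\<integral> x. indicator \<Omega> x * (W' (v x) * \<phi> x) \<partial>lborel) = (\<integral> x. W' (v x) * \<phi> x \<partial>lborel)"
      by (intro Bochner_Integration.integral_cong refl) (auto simp: indicator_def z)
    have i2: "(\<integral> x. indicator \<Omega> x * (f x * \<phi> x) \<partial>lborel) = (\<integral> x. f x * \<phi> x \<partial>lborel)"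
      by (intro Bochner_Integration.integral_cong refl) (auto simp: indicator_def z)
    have form: "frac_form s \<Omega> v \<phi> = gamma_ns DIM('a) s / 2 * (\<integral> z. gform s v \<phi> z \<partial>?P)"
      by (rule frac_form_whole[OF gform_integrable[OF _ _ cyl H z] _ z]) auto
    have e: "(f x - \<epsilon> powr (- 2 * s) * W' (v x)) * \<phi> x = f x * \<phi> x - \<epsilon> powr (- 2 * s) * (W' (v x) * \<phi> x)" for x
      by (simp add: algebra_simps)
    show ?thesis unfolding e using If IW eq form i1 i2 by simp
  qed
  then show ?thesis using cyl L2 by (simp add: weak_eq_def)
qed

text \<open>Comparison with a constant, whose fractional Laplacian vanishes; M \<ge> 0 ensures (v -
  M)+ \<le> |v|, so the truncation inherits the L^p bound.\<close>

lemma weak_eq_bounded_above: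
  fixes v F :: "'a::euclidean_space \<Rightarrow> real"
  assumes s: "0 < s" "s < 1/2" and p: "0 < p" and O: "bounded \<Omega>" "open \<Omega>" and w: "weak_eq s p \<Omega> v F"
    and vp: "Lp_on p \<Omega> v" and M: "M \<ge> 0" and out: "\<And>x. x \<notin> \<Omega> \<Longrightarrow> v x \<le> M"
    and F: "AE x in lborel. x \<in> \<Omega> \<and> v x > M \<longrightarrow> F x < 0"
  shows "AE x in lborel. v x \<le> M"
proof (rule comparison[OF s w, where A=0 and c=M and B="\<lambda>_. M"])
  have [measurable]: "\<Omega> \<in> sets borel" using O by simp
  have [measurable]: "v \<in> borel_measurable borel" using w by (simp add: weak_eq_def)
  show "Lp_on p \<Omega> (\<lambda>x. max (v x - M) 0)"
  proof -
    have "(\<integral>\<^sup>+ x\<in>\<Omega>. ennreal (\<bar>max (v x - M) 0\<bar> powr p) \<partial>lborel) \<le> (\<integral>\<^sup>+ x\<in>\<Omega>. ennreal (\<bar>v x\<bar> powr p) \<partial>lborel)"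
      using M p by (intro nn_integral_mono mult_right_mono ennreal_leI powr_mono2) auto
    also have "\<dots> < \<infinity>" using vp by (simp add: Lp_on_def)
    finally show ?thesis by (simp add: Lp_on_def)
  qed
  show "AE x in lborel. x \<in> \<Omega> \<and> M < v x \<longrightarrow> F x < gamma_ns DIM('a) s * frac_lap s (\<lambda>_. M) x"
    using F by (simp add: frac_lap_def)
qed (use O M out in auto)

lemma continuous_AE_le:
  fixes h k :: "'a::euclidean_space \<Rightarrow> real"
  assumes ae: "AE x in lborel. x \<in> S \<longrightarrow> h x \<le> k x" and S: "open S"
    and c: "continuous_on S h" "continuous_on S k" and x: "x \<in> S"
  shows "h x \<le> k x"
proof (rule ccontr)
  assume n: "\<not> ?thesis"
  have "open (S \<inter> (\<lambda>x. h x - k x) -` {0<..})"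
    by (intro continuous_open_preimage continuous_on_diff c S open_greaterThan)
  moreover have "x \<in> S \<inter> (\<lambda>x. h x - k x) -` {0<..}" using n x by simp
  ultimately obtain y where "y \<in> S \<inter> (\<lambda>x. h x - k x) -` {0<..}" "y \<in> S \<longrightarrow> h y \<le> k y"
    by (rule AE_ex_in_open[OF ae])
  then show False by simp
qed

text \<open>The representative glues the interior Hoelder function to \<open>g\<close>. Only
  frontier points need an argument: there the barrier estimate, first almost everywhere, holds
  everywhere in \<Omega> by continuity and forces U - g to 0.\<close>

lemma regularity:
  fixes v F g :: "'a::euclidean_space \<Rightarrow> real"
  assumes s: "0 < s" "s < 1/2" and p: "p > 0" and O: "open \<Omega>" "bounded \<Omega>" "smooth_boundary \<Omega>"
    and w: "weak_eq s p \<Omega> v F" and g: "locally_lipschitz g"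
      and vb: "\<And>x. \<bar>v x\<bar> \<le> M" and gb: "\<And>x. \<bar>g x\<bar> \<le> M" and out: "\<And>x. x \<notin> \<Omega> \<Longrightarrow> v x = g x"
      and F: "AE x in lborel. x \<in> \<Omega> \<longrightarrow> \<bar>F x\<bar> \<le> H"
  shows "\<exists>w. (AE x in lborel. w x = v x) \<and> holder_loc s \<Omega> w \<and> continuous_on UNIV w"
proof -
  have gc: "continuous_on UNIV g" using g by (rule locally_lipschitz_continuous)
  then have [measurable]: "g \<in> borel_measurable borel" by (rule borel_measurable_continuous_onI)
  obtain A where A: "A \<ge> 0" and gL: "\<And>x y. x \<in> \<Omega> \<Longrightarrow> \<bar>g x - g y\<bar> \<le> A * min (norm (x - y)) 1"
    using locally_lipschitz_min1[OF g gb O(2)] by blast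
  obtain u where u: "AE x in lborel. x \<in> \<Omega> \<longrightarrow> u x = v x" "holder_loc s \<Omega> u"
    using interior_regularity[OF s p w O(1,2) vb F] by blast
  have uc: "continuous_on \<Omega> u" using u by (simp add: holder_loc_def)
  define U where "U x = (if x \<in> \<Omega> then u x else g x)" for x
  have ae: "AE x in lborel. U x = v x"
    using u(1) by (rule eventually_mono) (auto simp: U_def out)
  have "continuous_on \<Omega> U \<longleftrightarrow> continuous_on \<Omega> u" by (intro continuous_on_cong) (auto simp: U_def)
  then have cO: "continuous_on \<Omega> U" using uc by simp
  have "\<exists>C. \<forall>x\<in>K. \<forall>y\<in>K. \<bar>U x - U y\<bar> \<le> C * dist x y powr s" if "compact K" "K \<subseteq> \<Omega>" for K
  proof -
    obtain C where "\<forall>x\<in>K. \<forall>y\<in>K. \<bar>u x - u y\<bar> \<le> C * dist x y powr s"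
      using u(2) \<open>compact K\<close> \<open>K \<subseteq> \<Omega>\<close> unfolding holder_loc_def by blast
    moreover have "U x = u x" if "x \<in> K" for x using that \<open>K \<subseteq> \<Omega>\<close> by (auto simp: U_def)
    ultimately have "\<forall>x\<in>K. \<forall>y\<in>K. \<bar>U x - U y\<bar> \<le> C * dist x y powr s" by simp
    then show ?thesis ..
  qed
  then have hU: "holder_loc s \<Omega> U" using cO by (simp add: holder_loc_def)
  have "isCont U x" for x
  proof -
    consider "x \<in> \<Omega>" | "x \<in> - closure \<Omega>" | "x \<in> frontier \<Omega>"
      using O(1) by (auto simp: frontier_def interior_open)
    then show ?thesis
    proof cases
      case 1
      then show ?thesis using cO O(1) by (simp add: continuous_on_eq_continuous_at)
    next
      case 2
      have "continuous_on (- closure \<Omega>) U \<longleftrightarrow> continuous_on (- closure \<Omega>) g"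
        using closure_subset[of \<Omega>] by (intro continuous_on_cong) (auto simp: U_def)
      then have "continuous_on (- closure \<Omega>) U" using gc continuous_on_subset by blast
      then show ?thesis using 2 by (simp add: continuous_on_eq_continuous_at open_Compl)
    next
      case 3
      then have xO: "x \<notin> \<Omega>" using O(1) by (simp add: frontier_def interior_open)
      obtain C \<alpha> where C: "C > 0" "\<alpha> > 0" and est: "AE y in lborel. \<bar>v y - g y\<bar> \<le> C * dist y x powr \<alpha>"
        using boundary_estimate[OF s p O w \<open>g \<in> borel_measurable borel\<close> vb gb out gL F 3 A] by blast
      have ae2: "AE y in lborel. y \<in> \<Omega> \<longrightarrow> \<bar>u y - g y\<bar> \<le> C * dist y x powr \<alpha>"
        using est u(1) by eventually_elim auto
      have cd: "continuous_on UNIV (\<lambda>y. C * dist y x powr \<alpha>)"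
        using C by (intro continuous_intros continuous_on_powr') auto
      have bound: "\<bar>U y - g y\<bar> \<le> C * dist y x powr \<alpha>" for y
      proof (cases "y \<in> \<Omega>")
        case True
        have "\<bar>u y - g y\<bar> \<le> C * dist y x powr \<alpha>"
        proof (rule continuous_AE_le[OF ae2 O(1) _ _ True])
          show "continuous_on \<Omega> (\<lambda>y. \<bar>u y - g y\<bar>)"
            using uc gc continuous_on_subset by (intro continuous_intros) blast+
          show "continuous_on \<Omega> (\<lambda>y. C * dist y x powr \<alpha>)" using cd continuous_on_subset by blast
        qed
        then show ?thesis using True by (simp add: U_def)
      next
        case False
        then show ?thesis using C by (simp add: U_def)
      qed
      have "((\<lambda>y. C * dist y x powr \<alpha>) \<longlongrightarrow> C * dist x x powr \<alpha>) (at x)"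
        using cd unfolding continuous_on_def by blast
      then have "((\<lambda>y. C * dist y x powr \<alpha>) \<longlongrightarrow> 0) (at x)" using C by simp
      then have "((\<lambda>y. U y - g y) \<longlongrightarrow> 0) (at x)"
        by (rule Lim_null_comparison[rotated]) (use bound in \<open>auto intro!: always_eventually\<close>)
      moreover have "(g \<longlongrightarrow> g x) (at x)" using gc by (simp add: continuous_on_def)
      ultimately have "((\<lambda>y. (U y - g y) + g y) \<longlongrightarrow> 0 + g x) (at x)" by (rule tendsto_add)
      moreover have "U x = g x" using xO by (simp add: U_def)
      ultimately show ?thesis by (simp add: isCont_def)
    qed
  qed
  then have "continuous_on UNIV U" by (simp add: continuous_at_imp_continuous_on)
  then show ?thesis using ae hU by blast
qed

text \<open>The growth bound controls only |W'|; the sign comes from W being positive beyond its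
  zeros, on the left after reflecting t to -t.\<close>

lemma potential_threshold:
  fixes W :: "real \<Rightarrow> real"
  assumes W: "C2_real W" "\<And>t. W t \<ge> 0" "{t. W t = 0} = {-1, 1}" and p: "1 < p" and c: "0 < c"
    and low: "\<And>t. (\<bar>t\<bar> powr (p - 1) - 1) / c \<le> \<bar>deriv W t\<bar>" and E: "E > 0"
  obtains M0 where "M0 \<ge> M" "\<And>t. t > M0 \<Longrightarrow> E * deriv W t > H" "\<And>t. t < - M0 \<Longrightarrow> E * deriv W t < - H"
proof -
  have der: "(W has_real_derivative deriv W t) (at t)" for t
    using W(1) by (simp add: C2_real_def DERIV_deriv_iff_real_differentiable)
  have cont: "continuous_on UNIV (deriv W)"
    using W(1) by (auto simp: C2_real_def intro!: continuous_at_imp_continuous_on differentiable_imp_continuous_within)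
  have zero: "W t = 0 \<longleftrightarrow> t = -1 \<or> t = 1" for t using W(3) by (auto simp: set_eq_iff)
  have lb: "\<bar>deriv W t\<bar> > 0" if "\<bar>t\<bar> > 1" for t
  proof -
    have "1 < \<bar>t\<bar> powr (p - 1)" using that p by (simp add: gr_one_powr)
    then have "0 < (\<bar>t\<bar> powr (p - 1) - 1) / c" using c by simp
    then show ?thesis using low[of t] by linarith
  qed
  have right: "deriv W t > 0" if "t > 1" for t
  proof (rule deriv_pos_right[OF der cont _ _ _ that])
    show "W 1 = 0" using zero by simp
    show "W t > 0" if "t > 1" for t using W(2)[of t] zero[of t] that by (simp add: less_le)
    show "deriv W t \<noteq> 0" if "t > 1" for t using lb[of t] that by simp
  qed
  have left: "- deriv W (- t) > 0" if "t > 1" for t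
  proof (rule deriv_pos_right[where W="\<lambda>t. W (- t)" and W'="\<lambda>t. - deriv W (- t)", OF _ _ _ _ _ that])
    show "((\<lambda>t. W (- t)) has_real_derivative - deriv W (- x)) (at x)" for x
      using DERIV_chain2[OF der[of "- x"] DERIV_minus[OF DERIV_ident]] by simp
    show "continuous_on UNIV (\<lambda>t. - deriv W (- t))"
      by (intro continuous_intros continuous_on_compose2[OF cont]) auto
    show "W (- 1) = 0" using zero by simp
    show "W (- t) > 0" if "t > 1" for t using W(2)[of "- t"] zero[of "- t"] that by (simp add: less_le)
    show "- deriv W (- t) \<noteq> 0" if "t > 1" for t using lb[of "- t"] that by simp
  qed
  \<comment> \<open>The value of |t|^(p-1) at which the lower growth bound, multiplied by E, reaches
    |H| + 1.\<close>
  define q where "q = 1 + c * (\<bar>H\<bar> + 1) / E"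
  have q: "q \<ge> 1" using c E by (simp add: q_def)
  define M0 where "M0 = max (max 1 M) (q powr (1 / (p - 1)))"
  have big: "E * ((t powr (p - 1) - 1) / c) > \<bar>H\<bar>" if "t > M0" for t
  proof -
    have "q = (q powr (1 / (p - 1))) powr (p - 1)" using p q by (simp add: powr_powr)
    also have "\<dots> \<le> t powr (p - 1)" using that p by (intro powr_mono2) (auto simp: M0_def)
    finally have "c * (\<bar>H\<bar> + 1) / E \<le> t powr (p - 1) - 1" by (simp add: q_def)
    then have "\<bar>H\<bar> + 1 \<le> E * ((t powr (p - 1) - 1) / c)" using c E by (simp add: field_simps)
    then show ?thesis by simp
  qed
  show ?thesis
  proof (rule that[of M0])
    show "M \<le> M0" by (simp add: M0_def)
    fix t assume t: "t > M0"
    then have t1: "t > 1" by (simp add: M0_def)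
    have "(t powr (p - 1) - 1) / c \<le> deriv W t" using low[of t] right[OF t1] t1 by simp
    then have "E * ((t powr (p - 1) - 1) / c) \<le> E * deriv W t" using E by (intro mult_left_mono) auto
    then show "E * deriv W t > H" using big[OF t] by linarith
  next
    fix t assume "t < - M0"
    then have t: "- t > M0" by simp
    then have t1: "- t > 1" by (simp add: M0_def)
    have "((- t) powr (p - 1) - 1) / c \<le> - deriv W t" using low[of t] left[OF t1] t1 by simp
    then have "E * (((- t) powr (p - 1) - 1) / c) \<le> E * (- deriv W t)" using E by (intro mult_left_mono) auto
    then show "E * deriv W t < - H" using big[OF t] by simp
  qed
qed

section \<open>Reduction of the semilinear problem to bounded data\<close>

theorem theorem3p9:
  fixes s :: real
  assumes n2: "DIM('a::euclidean_space) \<ge> 2"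
    and s: "0 < s" "s < 1/2"
  shows "\<exists>\<beta>::real. 0 < \<beta> \<and> \<beta> < 1 \<and>
    (\<forall>(W::real \<Rightarrow> real) (p::real) (c\<^sub>W::real) (\<Omega>::'a set) (\<epsilon>::real) (g::'a \<Rightarrow> real) (f::'a \<Rightarrow> real) (v::'a \<Rightarrow> real).
       C2_real W \<and> (\<forall>t. W t \<ge> 0) \<and> {t. W t = 0} = {-1, 1} \<and>
       deriv (deriv W) 1 > 0 \<and> deriv (deriv W) (-1) > 0 \<and>
       1 < p \<and> 0 < c\<^sub>W \<and>
       (\<forall>t. (\<bar>t\<bar> powr (p-1) - 1) / c\<^sub>W \<le> \<bar>deriv W t\<bar> \<and> \<bar>deriv W t\<bar> \<le> c\<^sub>W * (\<bar>t\<bar> powr (p-1) + 1)) \<and>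
       bounded \<Omega> \<and> open \<Omega> \<and> smooth_boundary \<Omega> \<and>
       0 < \<epsilon> \<and>
       locally_lipschitz g \<and> Linf g UNIV \<and>
       Linf f \<Omega> \<and>
       v \<in> Hs_g s \<Omega> g \<and> Lp_on p \<Omega> v \<and>
       weak_solution s p W \<epsilon> \<Omega> f v
       \<longrightarrow> (\<exists>w. (AE x in lborel. w x = v x) \<and> holder_loc \<beta> \<Omega> w \<and> continuous_on UNIV w))"
proof (intro exI[of _ s] conjI allI impI; (elim conjE)?)
  \<comment> \<open>The witness \<beta> = s is chosen before W, \<Omega> and the data.\<close>
  show "0 < s" "s < 1" using s by auto
next
  fix W :: "real \<Rightarrow> real" and p c \<epsilon> :: real and \<Omega> :: "'a set" and g f v :: "'a \<Rightarrow> real"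
  assume W: "C2_real W" "\<forall>t. W t \<ge> 0" "{t. W t = 0} = {-1, 1}" and p: "1 < p" and c: "0 < c"
    and growth: "\<forall>t. (\<bar>t\<bar> powr (p-1) - 1) / c \<le> \<bar>deriv W t\<bar> \<and> \<bar>deriv W t\<bar> \<le> c * (\<bar>t\<bar> powr (p-1) + 1)"
    and O: "bounded \<Omega>" "open \<Omega>" "smooth_boundary \<Omega>" and \<epsilon>: "0 < \<epsilon>"
    and g: "locally_lipschitz g" "Linf g UNIV" and f: "Linf f \<Omega>"
    and v: "v \<in> Hs_g s \<Omega> g" "Lp_on p \<Omega> v" and sol: "weak_solution s p W \<epsilon> \<Omega> f v"
  have [measurable]: "\<Omega> \<in> sets borel" using O by simp
  have [measurable]: "v \<in> borel_measurable borel" using v by (simp add: Lp_on_def)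
  obtain Hf where [measurable]: "f \<in> borel_measurable borel" and fb: "AE x in lborel. x \<in> \<Omega> \<longrightarrow> \<bar>f x\<bar> \<le> Hf"
    using f by (auto simp: Linf_def)
  obtain Mg where ag: "AE x in lborel. x \<in> UNIV \<longrightarrow> \<bar>g x\<bar> \<le> Mg" using g(2) by (auto simp: Linf_def)
  have gc: "continuous_on UNIV g" using g(1) by (rule locally_lipschitz_continuous)
  then have [measurable]: "g \<in> borel_measurable borel" by (rule borel_measurable_continuous_onI)
  have gb: "\<bar>g x\<bar> \<le> Mg" for x
    by (rule continuous_AE_le[OF ag]) (use gc in \<open>auto intro!: continuous_intros\<close>)
  have Mg0: "Mg \<ge> 0" using gb[of 0] by linarith
  define E where "E = \<epsilon> powr (- 2 * s)"
  have E: "E > 0" using \<epsilon> by (simp add: E_def)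
  obtain M where M: "M \<ge> Mg" and Wr: "\<And>t. t > M \<Longrightarrow> E * deriv W t > Hf" and Wl: "\<And>t. t < - M \<Longrightarrow> E * deriv W t < - Hf"
    using potential_threshold[OF W(1) W(2)[rule_format] W(3) p c _ E, of Mg Hf] growth by blast
  have M0: "M \<ge> 0" using M Mg0 by simp
  have contW: "continuous_on UNIV (deriv W)"
    using W(1) by (auto simp: C2_real_def intro!: continuous_at_imp_continuous_on differentiable_imp_continuous_within)
  then have [measurable]: "deriv W \<in> borel_measurable borel" by (rule borel_measurable_continuous_onI)
  define F where "F x = f x - E * deriv W (v x)" for x
  have w: "weak_eq s p \<Omega> v F"
    unfolding F_def[abs_def] E_def
    by (rule weak_eq_of_weak_solution[OF s p c _ refl _ O(1,2) _ fb _ v(2) sol])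
       (use growth v in \<open>auto simp: Hs_g_def\<close>)
  \<comment> \<open>Exterior values of \<open>v\<close> agree with \<open>g\<close> only almost
    everywhere; comparison requires them at every point.\<close>
  define v0 where "v0 x = (if x \<in> \<Omega> then v x else g x)" for x
  have [measurable]: "v0 \<in> borel_measurable borel" unfolding v0_def[abs_def] by measurable
  have v0v: "AE x in lborel. v0 x = v x"
    using v(1) by (auto simp: Hs_g_def v0_def elim!: eventually_mono)
  have w0: "weak_eq s p \<Omega> v0 F" by (rule weak_eq_cong_AE[OF w v0v]) auto
  have "(\<integral>\<^sup>+ x\<in>\<Omega>. ennreal (\<bar>v0 x\<bar> powr p) \<partial>lborel) = (\<integral>\<^sup>+ x\<in>\<Omega>. ennreal (\<bar>v x\<bar> powr p) \<partial>lborel)"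
    by (intro nn_integral_cong) (auto simp: v0_def indicator_def)
  then have L0: "Lp_on p \<Omega> v0" "Lp_on p \<Omega> (\<lambda>x. - v0 x)" using v(2) by (auto simp: Lp_on_def)
  have up: "AE x in lborel. v0 x \<le> M"
  proof (rule weak_eq_bounded_above[OF s _ O(1,2) w0 L0(1) M0])
    show "v0 x \<le> M" if "x \<notin> \<Omega>" for x using gb[of x] M that by (simp add: v0_def)
    show "AE x in lborel. x \<in> \<Omega> \<and> M < v0 x \<longrightarrow> F x < 0"
      using fb
    proof (rule eventually_mono, intro impI)
      fix x assume h: "x \<in> \<Omega> \<longrightarrow> \<bar>f x\<bar> \<le> Hf" "x \<in> \<Omega> \<and> M < v0 x"
      then have "E * deriv W (v x) > Hf" by (intro Wr) (auto simp: v0_def)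
      moreover have "f x \<le> Hf" using h by auto
      ultimately show "F x < 0" by (simp add: F_def)
    qed
  qed (use p in simp)
  have lo: "AE x in lborel. - v0 x \<le> M"
  proof (rule weak_eq_bounded_above[OF s _ O(1,2) weak_eq_uminus[OF w0] L0(2) M0])
    show "- v0 x \<le> M" if "x \<notin> \<Omega>" for x using gb[of x] M that by (simp add: v0_def)
    show "AE x in lborel. x \<in> \<Omega> \<and> M < - v0 x \<longrightarrow> - F x < 0"
      using fb
    proof (rule eventually_mono, intro impI)
      fix x assume h: "x \<in> \<Omega> \<longrightarrow> \<bar>f x\<bar> \<le> Hf" "x \<in> \<Omega> \<and> M < - v0 x"
      then have "E * deriv W (v x) < - Hf" by (intro Wl) (auto simp: v0_def)
      moreover have "- Hf \<le> f x" using h by auto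
      ultimately show "- F x < 0" by (simp add: F_def)
    qed
  qed (use p in simp)
  \<comment> \<open>Clipping makes the bound hold at every point. Exterior values survive because
    |g| \<le> M, and \<open>F\<close>, still written with \<open>v\<close>, is unchanged.\<close>
  define v1 where "v1 x = max (- M) (min M (v0 x))" for x
  have v1b: "\<bar>v1 x\<bar> \<le> M" for x using M0 by (auto simp: v1_def)
  have v1v0: "AE x in lborel. v1 x = v0 x" using up lo by eventually_elim (auto simp: v1_def)
  have w1: "weak_eq s p \<Omega> v1 F"
    by (rule weak_eq_cong_AE[OF w0 v1v0]) (auto simp: v1_def[abs_def])
  have v1out: "v1 x = g x" if "x \<notin> \<Omega>" for x using gb[of x] M that by (auto simp: v1_def v0_def)
  have Fb: "AE x in lborel. x \<in> \<Omega> \<longrightarrow> \<bar>F x\<bar> \<le> Hf + E * (c * (M powr (p - 1) + 1))"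
    using fb up lo
  proof eventually_elim
    case (elim x)
    show ?case
    proof
      assume x: "x \<in> \<Omega>"
      have vM: "\<bar>v x\<bar> \<le> M" using elim x by (auto simp: v0_def)
      have "\<bar>deriv W (v x)\<bar> \<le> c * (\<bar>v x\<bar> powr (p - 1) + 1)" using growth by blast
      also have "\<dots> \<le> c * (M powr (p - 1) + 1)"
        using vM c p by (intro mult_left_mono add_right_mono powr_mono2) auto
      finally have "E * \<bar>deriv W (v x)\<bar> \<le> E * (c * (M powr (p - 1) + 1))" using E by simp
      moreover have "\<bar>F x\<bar> \<le> \<bar>f x\<bar> + E * \<bar>deriv W (v x)\<bar>"
        using E abs_triangle_ineq4[of "f x" "E * deriv W (v x)"] by (simp add: F_def abs_mult)
      ultimately show "\<bar>F x\<bar> \<le> Hf + E * (c * (M powr (p - 1) + 1))" using elim x by simp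
    qed
  qed
  have gb': "\<bar>g x\<bar> \<le> M" for x using gb[of x] M by linarith
  obtain u where u: "AE x in lborel. u x = v1 x" "holder_loc s \<Omega> u" "continuous_on UNIV u"
    using regularity[OF s _ O(2,1,3) w1 g(1) v1b gb' v1out Fb] p by auto
  have "AE x in lborel. u x = v x" using u(1) v1v0 v0v by eventually_elim simp
  then show "\<exists>w. (AE x in lborel. w x = v x) \<and> holder_loc s \<Omega> w \<and> continuous_on UNIV w"
    using u by blast
qed

end
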